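(* Let $\mathbf k$ be a field of characteristic $0$, $\lambda\in\mathbf k$, and let $\mathfrak g,\mathfrak h$ be vector spaces over $\mathbf k$. Let $$L'=\mathrm{Hom}(\bar\wedge(\mathfrak g\oplus\mathfrak h),\mathfrak g\oplus\mathfrak h),\quad M'=\mathrm{Hom}(\bar\wedge\mathfrak g,\mathfrak g)\oplus\mathrm{Hom}(\bar\wedge\mathfrak g\otimes\bar\wedge\mathfrak h,\mathfrak h)\oplus\mathrm{Hom}(\bar\wedge\mathfrak h,\mathfrak h),\quad A'=\mathrm{Hom}(\bar\wedge\mathfrak g,\mathfrak h),$$ let $\iota_{M'}:M'\to L'$ and $\iota_{A'}:A'\to L'$ be the natural injections, and $P':L'\to A'$ the natural surjection. Then $(L',M',\iota_{M'},A',\iota_{A'},P',\Delta'=0)$ is a generalised V-datum, and an $L_\infty[1]$-algebra structure on $sM'\oplus A'$ is given by $$l_2(sf,sg)=(-1)^{|f|}s[f,g]_{\mathrm{NR}},\qquad l_i(sf,\xi_1,\dots,\xi_{i-1})=\lambda^{i-2}P'[\cdots[f,\xi_1]_{\mathrm{NR}},\cdots,\xi_{i-1}]_{\mathrm{NR}}\quad(i\ge2)$$ for homogeneous $f,g\in M'$, $\xi_1,\dots,\xi_{i-1}\in A'$, all other components vanishing (apart from those determined by graded symmetry).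
   Context: $\bar\wedge V=\bigoplus_{k\ge1}\wedge^kV$. $\mathrm{Hom}(\bar\wedge V,V)$ is the graded space with $\mathrm{Hom}(\wedge^{n+1}V,V)$ in degree $n$; it is a graded Lie algebra under the Nijenhuis-Richardson bracket $[f,g]_{\mathrm{NR}}=f\bar\circ g-(-1)^{pq}g\bar\circ f$ for $f\in\mathrm{Hom}(\wedge^{p+1}V,V)$, $g\in\mathrm{Hom}(\wedge^{q+1}V,V)$, where $$f\bar\circ g(x_1,\dots,x_{p+q+1})=\sum_{\sigma\in\mathrm{Sh}(q+1,p)}\mathrm{sgn}(\sigma)f(g(x_{\sigma(1)},\dots,x_{\sigma(q+1)}),x_{\sigma(q+2)},\dots,x_{\sigma(p+q+1)}).$$ $L'$ carries this bracket. Via $\wedge^n(\mathfrak g\oplus\mathfrak h)\cong\bigoplus_{k+l=n}\wedge^k\mathfrak g\otimes\wedge^l\mathfrak h$, $\mathrm{Hom}(\wedge^k\mathfrak g\otimes\wedge^l\mathfrak h,X)$ with $X\in\{\mathfrak g,\mathfrak h\}$ is regarded as a subspace (direct summand) of $L'$ in degree $k+l-1$, an element $F$ corresponding to $(x_1+u_1)\wedge\dots\wedge(x_n+u_n)\mapsto\sum_{\sigma\in\mathrm{Sh}(k,l)}\mathrm{sgn}(\sigma)F(x_{\sigma(1)}\wedge\dots\wedge x_{\sigma(k)}\otimes u_{\sigma(k+1)}\wedge\dots\wedge u_{\sigma(n)})$. $M'$ carries the bracket induced from $L'$, and $A'$ the induced (zero) bracket. All graded spaces are $\mathbb Z$-graded;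 $(sV)^n=V^{n+1}$. A generalised V-datum $(L,M,\iota_M,A,\iota_A,P,\Delta)$ consists of: a graded Lie algebra $L$; graded Lie algebra $M$ with injective graded Lie homomorphism $\iota_M:M\to L$; abelian graded Lie algebra $A$ with injective graded Lie homomorphism $\iota_A:A\to L$; a degree $0$ linear map $P:L\to A$ with $P\circ\iota_A=\mathrm{Id}_A$ and $\mathrm{Ker}(P)$ a graded Lie subalgebra; $\Delta\in\mathrm{Ker}(P)^1$ with $[\Delta,\Delta]=0$ and $[\Delta,\iota_M(M)]\subset\iota_M(M)$. An $L_\infty[1]$-algebra is a graded vector space $\mathfrak L$ with degree $1$ linear maps $l_n:\mathfrak L^{\otimes n}\to\mathfrak L$, $n\ge1$, that are graded symmetric (with Koszul sign $\varepsilon(\sigma)$) and satisfy $\sum_{i=1}^n\sum_{\sigma\in\mathrm{Sh}(i,n-i)}\varepsilon(\sigma)l_{n-i+1}(l_i(x_{\sigma(1)},\dots,x_{\sigma(i)}),x_{\sigma(i+1)},\dots,x_{\sigma(n)})=0$ for $n\ge1$. *)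

theory Defs
  imports
    "HOL-Analysis.Product_Vector"
    "HOL-Combinatorics.Permutations"
    "HOL-Library.Function_Algebras"
begin

section \<open>Signs and shuffles\<close>

text \<open>Permutations act on the positions \<open>0, \<dots>, n - 1\<close> of a list of length \<open>n\<close>;
  \<^const>\<open>permute_list\<close> sends \<open>[x\<^sub>0, \<dots>]\<close> to \<open>[x\<^bsub>\<sigma> 0\<^esub>, \<dots>]\<close>.\<close>

definition shuffles_perm :: "nat \<Rightarrow> nat \<Rightarrow> (nat \<Rightarrow> nat) set" where
  "shuffles_perm k l = {\<sigma>. \<sigma> permutes {..<k + l} \<and>
     strict_mono_on {..<k} \<sigma> \<and> strict_mono_on {k..<k + l} \<sigma>}"

text \<open>\<open>koszul_sign \<sigma> ds\<close> is determined by
  \<open>x\<^bsub>\<sigma> 0\<^esub> \<odot> \<dots> \<odot> x\<^bsub>\<sigma> (n - 1)\<^esub> = \<epsilon>(\<sigma>) x\<^sub>0 \<odot> \<dots> \<odot> x\<^bsub>n - 1\<^esub>\<close>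
  in the graded symmetric algebra, where \<open>x\<^sub>i\<close> has degree \<open>ds ! i\<close>: each inversion contributes
  the product of the degrees of the two elements that are interchanged.\<close>

definition koszul_sign :: "(nat \<Rightarrow> nat) \<Rightarrow> int list \<Rightarrow> 'k::field" where
  "koszul_sign \<sigma> ds =
     (\<Prod>(i, j)\<in>{(i, j). i < j \<and> j < length ds \<and> \<sigma> j < \<sigma> i}. (-1) powi (ds ! \<sigma> i * ds ! \<sigma> j))"

section \<open>Graded spaces\<close>

text \<open>A \<open>\<int>\<close>-graded vector space is given as a family of independent subspaces of an ambient
  vector space; the graded space itself is their (internal direct) sum, not the ambient space.\<close>

locale graded_space = vector_space s
  for s :: "'k::field \<Rightarrow> 'v::ab_group_add \<Rightarrow> 'v" +
  fixes V :: "int \<Rightarrow> 'v set"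
  assumes subspace_component: "subspace (V n)"
    and independent_components:
      "finite I \<Longrightarrow> (\<And>n. n \<in> I \<Longrightarrow> x n \<in> V n) \<Longrightarrow> (\<Sum>n\<in>I. x n) = 0 \<Longrightarrow> n \<in> I \<Longrightarrow> x n = 0"

definition gtotal :: "('k::field \<Rightarrow> 'v::ab_group_add \<Rightarrow> 'v) \<Rightarrow> (int \<Rightarrow> 'v set) \<Rightarrow> 'v set" where
  "gtotal s V = module.span s (\<Union>n. V n)"

definition linear_on_set :: "('k \<Rightarrow> 'v::ab_group_add \<Rightarrow> 'v) \<Rightarrow> ('k \<Rightarrow> 'w::ab_group_add \<Rightarrow> 'w)
    \<Rightarrow> 'v set \<Rightarrow> ('v \<Rightarrow> 'w) \<Rightarrow> bool" where
  "linear_on_set s1 s2 S f \<longleftrightarrow>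
     (\<forall>x\<in>S. \<forall>y\<in>S. f (x + y) = f x + f y) \<and> (\<forall>c. \<forall>x\<in>S. f (s1 c x) = s2 c (f x))"

definition gshift :: "(int \<Rightarrow> 'v set) \<Rightarrow> int \<Rightarrow> 'v set" where
  "gshift V n = V (n + 1)"

definition gsum :: "(int \<Rightarrow> 'v set) \<Rightarrow> (int \<Rightarrow> 'w set) \<Rightarrow> int \<Rightarrow> ('v \<times> 'w) set" where
  "gsum V W n = V n \<times> W n"

section \<open>Graded Lie algebras and generalised V-data\<close>

locale graded_lie_algebra = graded_space s L
  for s :: "'k::field \<Rightarrow> 'v::ab_group_add \<Rightarrow> 'v" and L :: "int \<Rightarrow> 'v set" +
  fixes br :: "'v \<Rightarrow> 'v \<Rightarrow> 'v"
  assumes linear_left: "y \<in> gtotal s L \<Longrightarrow> linear_on_set s s (gtotal s L) (\<lambda>x. br x y)"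
    and linear_right: "x \<in> gtotal s L \<Longrightarrow> linear_on_set s s (gtotal s L) (br x)"
    and bracket_degree: "x \<in> L m \<Longrightarrow> y \<in> L n \<Longrightarrow> br x y \<in> L (m + n)"
    and antisymmetry: "x \<in> L m \<Longrightarrow> y \<in> L n \<Longrightarrow> br x y = - s ((-1) powi (m * n)) (br y x)"
    and jacobi: "x \<in> L m \<Longrightarrow> y \<in> L n \<Longrightarrow> z \<in> L r \<Longrightarrow>
      br x (br y z) = br (br x y) z + s ((-1) powi (m * n)) (br y (br x z))"

definition graded_lie_subalgebra :: "('k::field \<Rightarrow> 'v::ab_group_add \<Rightarrow> 'v) \<Rightarrow> (int \<Rightarrow> 'v set) \<Rightarrow>
    ('v \<Rightarrow> 'v \<Rightarrow> 'v) \<Rightarrow> (int \<Rightarrow> 'v set) \<Rightarrow> bool" where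
  "graded_lie_subalgebra s L br K \<longleftrightarrow>
     (\<forall>n. module.subspace s (K n) \<and> K n \<subseteq> L n) \<and>
     (\<forall>m n. \<forall>x\<in>K m. \<forall>y\<in>K n. br x y \<in> K (m + n))"

definition graded_linear :: "('k::field \<Rightarrow> 'v::ab_group_add \<Rightarrow> 'v) \<Rightarrow> (int \<Rightarrow> 'v set) \<Rightarrow>
    ('k \<Rightarrow> 'w::ab_group_add \<Rightarrow> 'w) \<Rightarrow> (int \<Rightarrow> 'w set) \<Rightarrow> ('v \<Rightarrow> 'w) \<Rightarrow> bool" where
  "graded_linear s1 V s2 W f \<longleftrightarrow> linear_on_set s1 s2 (gtotal s1 V) f \<and> (\<forall>n. f ` V n \<subseteq> W n)"

definition graded_lie_hom :: "('k::field \<Rightarrow> 'v::ab_group_add \<Rightarrow> 'v) \<Rightarrow> (int \<Rightarrow> 'v set) \<Rightarrow>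
    ('v \<Rightarrow> 'v \<Rightarrow> 'v) \<Rightarrow> ('k \<Rightarrow> 'w::ab_group_add \<Rightarrow> 'w) \<Rightarrow> (int \<Rightarrow> 'w set) \<Rightarrow>
    ('w \<Rightarrow> 'w \<Rightarrow> 'w) \<Rightarrow> ('v \<Rightarrow> 'w) \<Rightarrow> bool" where
  "graded_lie_hom s1 V br1 s2 W br2 f \<longleftrightarrow> graded_linear s1 V s2 W f \<and>
     (\<forall>x\<in>gtotal s1 V. \<forall>y\<in>gtotal s1 V. f (br1 x y) = br2 (f x) (f y))"

locale generalised_V_datum =
  L: graded_lie_algebra sL L brL + M: graded_lie_algebra sM M brM + A: graded_lie_algebra sA A brA
  for sL :: "'k::field \<Rightarrow> 'l::ab_group_add \<Rightarrow> 'l" and L brL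
    and sM :: "'k \<Rightarrow> 'm::ab_group_add \<Rightarrow> 'm" and M brM
    and sA :: "'k \<Rightarrow> 'a::ab_group_add \<Rightarrow> 'a" and A brA +
  fixes \<iota>\<^sub>M :: "'m \<Rightarrow> 'l" and \<iota>\<^sub>A :: "'a \<Rightarrow> 'l" and P :: "'l \<Rightarrow> 'a" and \<Delta> :: 'l
  assumes M_hom: "graded_lie_hom sM M brM sL L brL \<iota>\<^sub>M"
    and M_inj: "inj_on \<iota>\<^sub>M (gtotal sM M)"
    and A_abelian: "\<And>a b. a \<in> gtotal sA A \<Longrightarrow> b \<in> gtotal sA A \<Longrightarrow> brA a b = 0"
    and A_hom: "graded_lie_hom sA A brA sL L brL \<iota>\<^sub>A"
    and A_inj: "inj_on \<iota>\<^sub>A (gtotal sA A)"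
    and P_linear: "graded_linear sL L sA A P"
    and P_retraction: "\<And>a. a \<in> gtotal sA A \<Longrightarrow> P (\<iota>\<^sub>A a) = a"
    and P_kernel: "graded_lie_subalgebra sL L brL (\<lambda>n. {x \<in> L n. P x = 0})"
    and Delta_degree: "\<Delta> \<in> L 1"
    and Delta_kernel: "P \<Delta> = 0"
    and Delta_square: "brL \<Delta> \<Delta> = 0"
    and Delta_M: "\<And>x. x \<in> gtotal sM M \<Longrightarrow> brL \<Delta> (\<iota>\<^sub>M x) \<in> \<iota>\<^sub>M ` gtotal sM M"

section \<open>\<open>L\<^sub>\<infinity>[1]\<close>-algebras\<close>

text \<open>The map \<open>l\<^sub>n\<close> on the \<open>n\<close>-fold tensor power is given as a multilinear map \<open>l n\<close> on lists of
  length \<open>n\<close>.  The values of \<open>l 0\<close>, and of \<open>l n\<close> on lists of other lengths or with entries outside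
  the graded space, are irrelevant.\<close>

locale L_infinity_1_algebra = graded_space s V
  for s :: "'k::field \<Rightarrow> 'v::ab_group_add \<Rightarrow> 'v" and V :: "int \<Rightarrow> 'v set" +
  fixes l :: "nat \<Rightarrow> 'v list \<Rightarrow> 'v"
  assumes multilinear: "length xs = n \<Longrightarrow> set xs \<subseteq> gtotal s V \<Longrightarrow> i < n \<Longrightarrow>
      linear_on_set s s (gtotal s V) (\<lambda>x. l n (xs[i := x]))"
    and degree_one: "n \<ge> 1 \<Longrightarrow> length ds = n \<Longrightarrow> list_all2 (\<lambda>x d. x \<in> V d) xs ds \<Longrightarrow>
      l n xs \<in> V (sum_list ds + 1)"
    and graded_symmetric: "n \<ge> 1 \<Longrightarrow> length ds = n \<Longrightarrow> list_all2 (\<lambda>x d. x \<in> V d) xs ds \<Longrightarrow>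
      \<sigma> permutes {..<n} \<Longrightarrow> l n (permute_list \<sigma> xs) = s (koszul_sign \<sigma> ds) (l n xs)"
    and relations: "n \<ge> 1 \<Longrightarrow> length ds = n \<Longrightarrow> list_all2 (\<lambda>x d. x \<in> V d) xs ds \<Longrightarrow>
      (\<Sum>i=1..n. \<Sum>\<sigma>\<in>shuffles_perm i (n - i). s (koszul_sign \<sigma> ds)
         (l (n - i + 1) (l i (take i (permute_list \<sigma> xs)) # drop i (permute_list \<sigma> xs)))) = 0"

section \<open>Alternating maps and the Nijenhuis-Richardson bracket\<close>

definition fun_scale :: "('k \<Rightarrow> 'w \<Rightarrow> 'w) \<Rightarrow> 'k \<Rightarrow> ('i \<Rightarrow> 'w) \<Rightarrow> 'i \<Rightarrow> 'w" where
  "fun_scale s c f = (\<lambda>x. s c (f x))"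

text \<open>\<open>Hom(\<wedge>\<^sup>n V, W)\<close>, as alternating \<open>n\<close>-linear maps on lists of length \<open>n\<close>, extended by zero to all
  other lists.  Because of the extension by zero the spaces for different \<open>n\<close> are independent
  inside the space of all functions on lists.\<close>

definition alt_hom :: "('k::field \<Rightarrow> 'v::ab_group_add \<Rightarrow> 'v) \<Rightarrow> ('k \<Rightarrow> 'w::ab_group_add \<Rightarrow> 'w) \<Rightarrow>
    nat \<Rightarrow> ('v list \<Rightarrow> 'w) set" where
  "alt_hom sV sW n = {f.
     (\<forall>xs. length xs \<noteq> n \<longrightarrow> f xs = 0) \<and>
     (\<forall>xs i. length xs = n \<and> i < n \<longrightarrow> Vector_Spaces.linear sV sW (\<lambda>x. f (xs[i := x]))) \<and>
     (\<forall>xs i j. length xs = n \<and> i < j \<and> j < n \<and> xs ! i = xs ! j \<longrightarrow> f xs = 0)}"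

text \<open>\<open>Hom(\<wedge>\<^sup>k \<gg> \<otimes> \<wedge>\<^sup>l \<hh>, W)\<close>\<close>

definition mixed_hom :: "('k::field \<Rightarrow> 'g::ab_group_add \<Rightarrow> 'g) \<Rightarrow> ('k \<Rightarrow> 'h::ab_group_add \<Rightarrow> 'h) \<Rightarrow>
    ('k \<Rightarrow> 'w::ab_group_add \<Rightarrow> 'w) \<Rightarrow> nat \<Rightarrow> nat \<Rightarrow> ('g list \<Rightarrow> 'h list \<Rightarrow> 'w) set" where
  "mixed_hom sg sh sW k l = {F.
     (\<forall>us. (\<lambda>xs. F xs us) \<in> alt_hom sg sW k) \<and> (\<forall>xs. F xs \<in> alt_hom sh sW l)}"

definition hom_bar :: "('k::field \<Rightarrow> 'v::ab_group_add \<Rightarrow> 'v) \<Rightarrow> int \<Rightarrow> ('v list \<Rightarrow> 'v) set" where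
  "hom_bar s n = (if n \<ge> 0 then alt_hom s s (nat n + 1) else {0})"

definition nr_comp :: "('k::field \<Rightarrow> 'v::ab_group_add \<Rightarrow> 'v) \<Rightarrow> nat \<Rightarrow> nat \<Rightarrow>
    ('v list \<Rightarrow> 'v) \<Rightarrow> ('v list \<Rightarrow> 'v) \<Rightarrow> 'v list \<Rightarrow> 'v" where
  "nr_comp s p q f g xs = (\<Sum>\<sigma>\<in>shuffles_perm (q + 1) p. s (of_int (sign \<sigma>))
     (f (g (take (q + 1) (permute_list \<sigma> xs)) # drop (q + 1) (permute_list \<sigma> xs))))"

text \<open>The bilinear extension of the bracket from homogeneous elements: on a list of length \<open>n\<close>, the
  components of degrees \<open>p\<close> and \<open>q\<close> of \<open>f\<close> and \<open>g\<close> (their restrictions to lists of lengths \<open>p + 1\<close>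
  and \<open>q + 1\<close>) contribute if \<open>p + q + 1 = n\<close>.\<close>

definition nr_bracket :: "('k::field \<Rightarrow> 'v::ab_group_add \<Rightarrow> 'v) \<Rightarrow>
    ('v list \<Rightarrow> 'v) \<Rightarrow> ('v list \<Rightarrow> 'v) \<Rightarrow> 'v list \<Rightarrow> 'v" where
  "nr_bracket s f g xs = (\<Sum>(p, q)\<in>{(p, q). p + q + 1 = length xs}.
     nr_comp s p q f g xs - s ((-1) ^ (p * q)) (nr_comp s q p g f xs))"

section \<open>The decomposition of \<open>Hom(\<wedge>(\<gg> \<oplus> \<hh>), \<gg> \<oplus> \<hh>)\<close>\<close>

text \<open>\<open>j\<close> is the inclusion of the target \<open>\<gg>\<close> or \<open>\<hh>\<close> into \<open>\<gg> \<oplus> \<hh>\<close>.\<close>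

definition embed_hom :: "('k::field \<Rightarrow> 'g::ab_group_add \<Rightarrow> 'g) \<Rightarrow> ('k \<Rightarrow> 'h::ab_group_add \<Rightarrow> 'h) \<Rightarrow>
    ('w \<Rightarrow> 'g \<times> 'h) \<Rightarrow> nat \<Rightarrow> nat \<Rightarrow> ('g list \<Rightarrow> 'h list \<Rightarrow> 'w) \<Rightarrow> ('g \<times> 'h) list \<Rightarrow> 'g \<times> 'h" where
  "embed_hom sg sh j k l F xs = (if length xs = k + l then
     (\<Sum>\<sigma>\<in>shuffles_perm k l. module_prod.scale sg sh (of_int (sign \<sigma>))
        (j (F (map fst (take k (permute_list \<sigma> xs))) (map snd (drop k (permute_list \<sigma> xs))))))
     else 0)"

definition summand_g :: "('k::field \<Rightarrow> 'g::ab_group_add \<Rightarrow> 'g) \<Rightarrow> ('k \<Rightarrow> 'h::ab_group_add \<Rightarrow> 'h) \<Rightarrow>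
    nat \<Rightarrow> nat \<Rightarrow> (('g \<times> 'h) list \<Rightarrow> 'g \<times> 'h) set" where
  "summand_g sg sh k l = embed_hom sg sh (\<lambda>x. (x, 0)) k l ` mixed_hom sg sh sg k l"

definition summand_h :: "('k::field \<Rightarrow> 'g::ab_group_add \<Rightarrow> 'g) \<Rightarrow> ('k \<Rightarrow> 'h::ab_group_add \<Rightarrow> 'h) \<Rightarrow>
    nat \<Rightarrow> nat \<Rightarrow> (('g \<times> 'h) list \<Rightarrow> 'g \<times> 'h) set" where
  "summand_h sg sh k l = embed_hom sg sh (\<lambda>u. (0, u)) k l ` mixed_hom sg sh sh k l"

abbreviation scale_gh :: "('k::field \<Rightarrow> 'g::ab_group_add \<Rightarrow> 'g) \<Rightarrow> ('k \<Rightarrow> 'h::ab_group_add \<Rightarrow> 'h) \<Rightarrow>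
    'k \<Rightarrow> (('g \<times> 'h) list \<Rightarrow> 'g \<times> 'h) \<Rightarrow> ('g \<times> 'h) list \<Rightarrow> 'g \<times> 'h" where
  "scale_gh sg sh \<equiv> fun_scale (module_prod.scale sg sh)"

definition L' :: "('k::field \<Rightarrow> 'g::ab_group_add \<Rightarrow> 'g) \<Rightarrow> ('k \<Rightarrow> 'h::ab_group_add \<Rightarrow> 'h) \<Rightarrow>
    int \<Rightarrow> (('g \<times> 'h) list \<Rightarrow> 'g \<times> 'h) set" where
  "L' sg sh = hom_bar (module_prod.scale sg sh)"

abbreviation nr_gh :: "('k::field \<Rightarrow> 'g::ab_group_add \<Rightarrow> 'g) \<Rightarrow> ('k \<Rightarrow> 'h::ab_group_add \<Rightarrow> 'h) \<Rightarrow>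
    (('g \<times> 'h) list \<Rightarrow> 'g \<times> 'h) \<Rightarrow> (('g \<times> 'h) list \<Rightarrow> 'g \<times> 'h) \<Rightarrow> ('g \<times> 'h) list \<Rightarrow> 'g \<times> 'h" where
  "nr_gh sg sh \<equiv> nr_bracket (module_prod.scale sg sh)"

text \<open>The span of a union of subspaces is their sum, which is direct here.  The degree of
  \<open>Hom(\<wedge>\<^sup>k \<gg> \<otimes> \<wedge>\<^sup>l \<hh>, -)\<close> is \<open>k + l - 1\<close>.\<close>

definition M' :: "('k::field \<Rightarrow> 'g::ab_group_add \<Rightarrow> 'g) \<Rightarrow> ('k \<Rightarrow> 'h::ab_group_add \<Rightarrow> 'h) \<Rightarrow>
    int \<Rightarrow> (('g \<times> 'h) list \<Rightarrow> 'g \<times> 'h) set" where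
  "M' sg sh n = module.span (scale_gh sg sh)
     (\<Union>{summand_g sg sh k 0 | k. k \<ge> 1 \<and> int k - 1 = n} \<union>
      \<Union>{summand_h sg sh k l | k l. k \<ge> 1 \<and> l \<ge> 1 \<and> int (k + l) - 1 = n} \<union>
      \<Union>{summand_h sg sh 0 l | l. l \<ge> 1 \<and> int l - 1 = n})"

definition A' :: "('k::field \<Rightarrow> 'g::ab_group_add \<Rightarrow> 'g) \<Rightarrow> ('k \<Rightarrow> 'h::ab_group_add \<Rightarrow> 'h) \<Rightarrow>
    int \<Rightarrow> (('g \<times> 'h) list \<Rightarrow> 'g \<times> 'h) set" where
  "A' sg sh n = module.span (scale_gh sg sh) (\<Union>{summand_h sg sh k 0 | k. k \<ge> 1 \<and> int k - 1 = n})"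

text \<open>The projection onto the summand \<open>Hom(\<wedge>\<gg>, \<hh>)\<close>: restrict the arguments to \<open>\<gg>\<close>, take the
  \<open>\<hh>\<close>-component, and regard the result as an element of \<open>Hom(\<wedge>(\<gg> \<oplus> \<hh>), \<gg> \<oplus> \<hh>)\<close> again.  See the
  lemmas below for its values on the summands.\<close>

definition P' :: "(('g::zero \<times> 'h::zero) list \<Rightarrow> 'g \<times> 'h) \<Rightarrow> ('g \<times> 'h) list \<Rightarrow> 'g \<times> 'h" where
  "P' f xs = (0, snd (f (map (\<lambda>v. (fst v, 0)) xs)))"

lemma shuffles_perm_0: "shuffles_perm k 0 = {id}"
proof -
  have "\<sigma> = id" if p: "\<sigma> permutes {..<k}" and m: "strict_mono_on {..<k} \<sigma>" for \<sigma> :: "nat \<Rightarrow> nat"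
  proof (rule permutes_natset_ge[OF p])
    show "\<forall>i\<in>{..<k}. \<sigma> i \<ge> i"
    proof
      fix i assume "i \<in> {..<k}"
      then show "\<sigma> i \<ge> i"
      proof (induction i)
        case (Suc i)
        then have "\<sigma> i < \<sigma> (Suc i)" using m by (auto simp: strict_mono_on_def)
        moreover have "i \<le> \<sigma> i" using Suc by auto
        ultimately show ?case by linarith
      qed auto
    qed
  qed
  then show ?thesis
    by (auto simp: shuffles_perm_def strict_mono_on_def permutes_id)
qed

lemma alt_hom_zero_entry:
  assumes "f \<in> alt_hom sV sW n" "0 \<in> set us" shows "f us = 0"
proof (cases "length us = n")
  case True
  from assms(2) obtain i where i: "i < length us" "us ! i = 0" by (auto simp: in_set_conv_nth)
  with assms(1) True have lin: "Vector_Spaces.linear sV sW (\<lambda>x. f (us[i := x]))"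
    by (auto simp: alt_hom_def)
  interpret Vector_Spaces.linear sV sW "\<lambda>x. f (us[i := x])" by (rule lin)
  have "f (us[i := 0]) = 0" by (rule zero)
  with i show ?thesis by (metis list_update_id)
qed (use assms in \<open>auto simp: alt_hom_def\<close>)

lemma P'_summand_h_0:
  assumes "vector_space sg" "vector_space sh" "f \<in> summand_h sg sh k 0" shows "P' f = f"
proof -
  interpret gh: vector_space_prod sg sh using assms by (simp add: vector_space_prod_def vector_space_pair_def)
  from assms show ?thesis
    by (auto simp: summand_h_def embed_hom_def shuffles_perm_0 P'_def fun_eq_iff gh.scale_def o_def
        sign_id zero_prod_def)
qed

lemma P'_summand_h:
  assumes "vector_space sg" "vector_space sh" "f \<in> summand_h sg sh k l" "l \<ge> 1" shows "P' f = 0"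
proof
  fix xs :: "('b \<times> 'c) list"
  interpret gh: vector_space_prod sg sh using assms by (simp add: vector_space_prod_def vector_space_pair_def)
  from assms(3) obtain F where F: "F \<in> mixed_hom sg sh sh k l" "f = embed_hom sg sh (\<lambda>u. (0, u)) k l F"
    by (auto simp: summand_h_def)
  let ?xs = "map (\<lambda>v. (fst v, 0)) xs :: ('b \<times> 'c) list"
  have "F ys (map snd (drop k (permute_list \<sigma> ?xs))) = 0"
    if "length xs = k + l" "\<sigma> permutes {..<k + l}" for ys \<sigma>
  proof (rule alt_hom_zero_entry)
    show "F ys \<in> alt_hom sh sh l" using F by (auto simp: mixed_hom_def)
    have "map snd (drop k (permute_list \<sigma> ?xs)) = map (\<lambda>_. 0) (drop k xs)"
      using that permutes_in_image[OF that(2)]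
      by (intro nth_equalityI) (auto simp: permute_list_def nth_append)
    then show "0 \<in> set (map snd (drop k (permute_list \<sigma> ?xs)))"
      using that assms(4) by (simp add: map_replicate_const)
  qed
  then have "f ?xs = 0"
    using F(2) by (auto simp: embed_hom_def shuffles_perm_def gh.scale_def zero_prod_def[symmetric] intro!: sum.neutral)
  then show "P' f xs = 0 xs" by (simp add: P'_def zero_prod_def)
qed

lemma P'_summand_g:
  assumes "vector_space sg" "vector_space sh" "f \<in> summand_g sg sh k l" shows "P' f = 0"
proof -
  interpret gh: vector_space_prod sg sh using assms by (simp add: vector_space_prod_def vector_space_pair_def)
  from assms show ?thesis
    by (auto simp: summand_g_def embed_hom_def P'_def fun_eq_iff gh.scale_def zero_prod_def snd_sum)
qed

end

theory Submission
  imports Defs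
begin

text \<open>Both the Nijenhuis-Richardson bracket and the \<open>L\<^sub>\<infinity>\<close> relations are sums over shuffles, that is,
  they come from the unshuffle coproduct of the graded symmetric coalgebra.  Coassociativity and
  cocommutativity of this coproduct give the graded pre-Lie identity for the composition of alternating
  maps, hence the Jacobi identity on \<open>L'\<close>, and also Voronov's derived bracket argument: the iterated
  bracket \<open>[\<dots>[[f, g], \<xi>\<^sub>1], \<dots>]\<close> is a sum over unshuffles of brackets of iterated brackets of \<open>f\<close> and
  \<open>g\<close>, and \<open>P[a, b] = P[Pa, b] + P[a, Pb]\<close> because the kernel of \<open>P\<close> is a subalgebra and \<open>A\<close> is abelian.
  Every term of a relation with two elements of \<open>sM'\<close> and elements of \<open>A'\<close> carries the same power of
    \<open>\<lambda>\<close>.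
  Finally, \<open>M'\<close> and \<open>A'\<close> are cut out of \<open>L'\<close> by vanishing conditions on arguments from \<open>\<gg>\<close> and \<open>\<hh>\<close>
  that are preserved by composition.\<close>

section \<open>Signed sums over unshuffles\<close>

text \<open>Sums over shuffle permutations are traded for a recursion on lists: the first entry
  joins the left or the right part, in the second case with the sign for passing the left part.
  Alternating maps are the case in which every entry has degree 1, so one calculus serves both the
  bracket and the relations.

  The form of the operations comes from a conflict: multilinearity concerns arbitrary elements of
  the graded space, while Koszul signs refer to degrees, which an element does not determine (0 has
  every degree). Hence the operations are defined on all pairs by means of a linear even-part
  operator, and for homogeneous entries they are compared with signed sums over lists of elements
  paired with degrees.

  As to the power of \<lambda>: since M' lies in the kernel of P', l_1 = 0. In a relation on n
  entries, an inner operation l_i with value in A' contributes the exponent (i - 2) + (n - i - 1) =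
  n - 3; an inner bracket of two elements of M' contributes 0 and the outer operation, of arity n -
  1, contributes n - 3.\<close>

definition msign :: "int \<Rightarrow> 'v::ab_group_add \<Rightarrow> 'v" where
  "msign m x = (if even m then x else - x)"

lemma msign_add: "msign m (x + y) = msign m x + msign m y"
  by (simp add: msign_def)

lemma msign_simps [simp]: "msign m 0 = 0" "msign 0 x = x"
  by (simp_all add: msign_def)

lemma msign_msign: "msign m (msign n x) = msign (m + n) x"
  by (simp add: msign_def)

definition degs :: "('a \<Rightarrow> int) \<Rightarrow> 'a list \<Rightarrow> int" where
  "degs d u = sum_list (map d u)"

lemma degs_simps [simp]:
  "degs d [] = 0" "degs d (x # u) = d x + degs d u" "degs d (u @ v) = degs d u + degs d v"
  by (simp_all add: degs_def)

lemma degs_mset: "mset u = mset v \<Longrightarrow> degs d u = degs d v"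
  unfolding degs_def by (metis mset_map sum_mset_sum_list)

lemma degs_split: "mset u + mset v = mset w \<Longrightarrow> degs d w = degs d u + degs d v"
  using degs_mset[of w "u @ v" d] by simp

lemma degs_one: "degs (\<lambda>_. 1) u = int (length u)"
  by (induction u) simp_all

text \<open>The sum over all splittings of a list into complementary subsequences \<open>u\<close>, \<open>v\<close>, with the
  Koszul sign of the corresponding shuffle.\<close>

fun usum :: "('a \<Rightarrow> int) \<Rightarrow> ('a list \<Rightarrow> 'a list \<Rightarrow> 'v::ab_group_add) \<Rightarrow> 'a list \<Rightarrow> 'v" where
  "usum d B [] = B [] []"
| "usum d B (x # xs) = usum d (\<lambda>u v. B (x # u) v) xs
     + usum d (\<lambda>u v. msign (d x * degs d u) (B u (x # v))) xs"

text \<open>The multiset equation records what is needed about a splitting: lengths, degrees and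
  membership of the entries.\<close>

lemma usum_cong:
  assumes "\<And>u v. mset u + mset v = mset xs \<Longrightarrow> B u v = B' u v"
  shows "usum d B xs = usum d B' xs"
  using assms
proof (induction xs arbitrary: B B')
  case (Cons x xs)
  have "usum d (\<lambda>u v. B (x # u) v) xs = usum d (\<lambda>u v. B' (x # u) v) xs"
    by (rule Cons.IH) (simp add: Cons.prems)
  moreover have "usum d (\<lambda>u v. msign (d x * degs d u) (B u (x # v))) xs
      = usum d (\<lambda>u v. msign (d x * degs d u) (B' u (x # v))) xs"
    by (rule Cons.IH) (simp add: Cons.prems)
  ultimately show ?case by simp
qed simp

lemma usum_zero [simp]: "usum d (\<lambda>u v. 0) xs = 0"
  by (induction xs) simp_all

lemma usum_eq_zero:
  assumes "\<And>u v. mset u + mset v = mset xs \<Longrightarrow> B u v = 0"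
  shows "usum d B xs = 0"
  using usum_cong[of xs B "\<lambda>u v. 0" d] assms by simp

lemma usum_add: "usum d (\<lambda>u v. B u v + B' u v) xs = usum d B xs + usum d B' xs"
  by (induction xs arbitrary: B B') (simp_all add: msign_add ac_simps)

lemma usum_closed:
  assumes "\<And>u v. mset u + mset v = mset xs \<Longrightarrow> B u v \<in> S"
    and "\<And>x y. x \<in> S \<Longrightarrow> y \<in> S \<Longrightarrow> x + y \<in> S" "\<And>x. x \<in> S \<Longrightarrow> - x \<in> S"
  shows "usum d B xs \<in> S"
  using assms(1)
proof (induction xs arbitrary: B)
  case (Cons x xs)
  have "usum d (\<lambda>u v. B (x # u) v) xs \<in> S"
    by (rule Cons.IH) (simp add: Cons.prems)
  moreover have "usum d (\<lambda>u v. msign (d x * degs d u) (B u (x # v))) xs \<in> S"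
    by (rule Cons.IH) (simp add: Cons.prems msign_def assms)
  ultimately show ?case by (simp add: assms)
qed simp

text \<open>Additivity is asked only on a set \<open>S\<close> closed under sums and negatives,
  because projections and brackets are linear on the graded space and not on the ambient
  one.\<close>

lemma usum_additive_on:
  assumes "\<And>u v. mset u + mset v = mset xs \<Longrightarrow> B u v \<in> S"
    and S: "\<And>x y. x \<in> S \<Longrightarrow> y \<in> S \<Longrightarrow> x + y \<in> S" "\<And>x. x \<in> S \<Longrightarrow> - x \<in> S"
    and h: "\<And>x y. x \<in> S \<Longrightarrow> y \<in> S \<Longrightarrow> h (x + y) = h x + h y"
  shows "h (usum d B xs) = usum d (\<lambda>u v. h (B u v)) xs"
  using assms(1)
proof (induction xs arbitrary: B)
  case (Cons x xs)
  have hm: "h (- y) = - h y" if "y \<in> S" for y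
  proof -
    have "0 \<in> S" using S(1)[of y "- y"] S(2) that by simp
    then have "h 0 = 0" using h[of 0 0] by simp
    then show ?thesis using h[of y "- y"] S(2) that by (simp add: eq_neg_iff_add_eq_0 add.commute)
  qed
  have 1: "B (x # u) v \<in> S" "msign (d x * degs d u) (B u (x # v)) \<in> S"
    if "mset u + mset v = mset xs" for u v
    using that by (auto simp: Cons.prems msign_def S)
  have "h (usum d B (x # xs)) = h (usum d (\<lambda>u v. B (x # u) v) xs)
      + h (usum d (\<lambda>u v. msign (d x * degs d u) (B u (x # v))) xs)"
    unfolding usum.simps by (intro h usum_closed 1 S) 
  also have "\<dots> = usum d (\<lambda>u v. h (B (x # u) v)) xs
      + usum d (\<lambda>u v. h (msign (d x * degs d u) (B u (x # v)))) xs"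
    by (simp add: Cons.IH 1)
  also have "usum d (\<lambda>u v. h (msign (d x * degs d u) (B u (x # v)))) xs
     = usum d (\<lambda>u v. msign (d x * degs d u) (h (B u (x # v)))) xs"
    by (rule usum_cong) (auto simp: msign_def hm Cons.prems)
  finally show ?case by simp
qed simp

lemma usum_additive:
  assumes "\<And>x y. h (x + y) = h x + h y"
  shows "h (usum d B xs) = usum d (\<lambda>u v. h (B u v)) xs"
  by (rule usum_additive_on[where S = UNIV]) (auto simp: assms)

lemma msign_usum: "msign m (usum d B xs) = usum d (\<lambda>u v. msign m (B u v)) xs"
  by (rule usum_additive) (rule msign_add)

lemma usum_uminus: "usum d (\<lambda>u v. - B u v) xs = - usum d B xs"
  using msign_usum[of 1 d B xs] by (simp add: msign_def)

lemma usum_sum: "(\<Sum>i\<in>I. usum d (B i) xs) = usum d (\<lambda>u v. \<Sum>i\<in>I. B i u v) xs"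
  by (induction I rule: infinite_finite_induct) (simp_all add: usum_add)

text \<open>Cocommutativity. Exchanging the two parts swaps the two summands of the recursion; what
  remains of the exchange sign for the head \<open>x\<close> is the sign that the recursion
  prescribes on the other side.\<close>

lemma usum_commute:
  "usum d (\<lambda>u v. msign (degs d u * degs d v) (B v u)) xs = usum d B xs"
proof (induction xs arbitrary: B)
  case (Cons x xs)
  have "usum d (\<lambda>u v. msign (degs d (x # u) * degs d v) (B v (x # u))) xs
      = usum d (\<lambda>u v. msign (degs d u * degs d v) (msign (d x * degs d v) (B v (x # u)))) xs"
    by (simp add: msign_msign algebra_simps)
  also have "\<dots> = usum d (\<lambda>u v. msign (d x * degs d u) (B u (x # v))) xs"
    by (rule Cons.IH)
  finally have 1: "usum d (\<lambda>u v. msign (degs d (x # u) * degs d v) (B v (x # u))) xs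
      = usum d (\<lambda>u v. msign (d x * degs d u) (B u (x # v))) xs" .
  have "usum d (\<lambda>u v. msign (d x * degs d u) (msign (degs d u * degs d (x # v)) (B (x # v) u))) xs
      = usum d (\<lambda>u v. msign (degs d u * degs d v) (B (x # v) u)) xs"
    by (rule arg_cong[of _ _ "\<lambda>B. usum d B xs"]) (auto simp: msign_def fun_eq_iff)
  also have "\<dots> = usum d (\<lambda>u v. B (x # u) v) xs" by (rule Cons.IH)
  finally show ?case using 1 by (simp add: add.commute)
qed simp

text \<open>Coassociativity: both sides are the signed sum over splittings into three parts, and the
  head joins one of the three. If it joins the last one, it passes \<open>u\<close>, whose degree is
  the sum of the degrees of \<open>a\<close> and \<open>b\<close>.\<close>

lemma usum_assoc:
  "usum d (\<lambda>u w. usum d (\<lambda>a b. B a b w) u) xs = usum d (\<lambda>a v. usum d (\<lambda>b w. B a b w) v) xs"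
proof (induction xs arbitrary: B)
  case (Cons x xs)
  have "usum d (\<lambda>u w. usum d (\<lambda>a b. B a b w) u) (x # xs) =
    usum d (\<lambda>u w. usum d (\<lambda>a b. B (x # a) b w) u) xs +
    usum d (\<lambda>u w. usum d (\<lambda>a b. msign (d x * degs d a) (B a (x # b) w)) u) xs +
    usum d (\<lambda>u w. usum d (\<lambda>a b. msign (d x * degs d u) (B a b (x # w))) u) xs"
    by (simp add: usum_add msign_usum)
  also have "usum d (\<lambda>u w. usum d (\<lambda>a b. msign (d x * degs d u) (B a b (x # w))) u) xs =
     usum d (\<lambda>u w. usum d (\<lambda>a b. msign (d x * degs d a) (msign (d x * degs d b) (B a b (x # w)))) u) xs"
    by (intro usum_cong) (auto simp: msign_msign degs_split algebra_simps)
  finally show ?case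
    by (simp add: Cons.IH usum_add msign_usum msign_add)
qed simp

text \<open>Both sides run over splittings into four parts; the extra sign arises because the two
  middle parts \<open>a\<close> and \<open>e\<close> change places. This is the regrouping behind
  the cancellation in the relations.\<close>

lemma usum_interchange:
  "usum d (\<lambda>u v. usum d (\<lambda>c a. usum d (\<lambda>e b. B c a e b) v) u) xs =
   usum d (\<lambda>u v. usum d (\<lambda>c e. usum d (\<lambda>a b. msign (degs d a * degs d e) (B c a e b)) v) u) xs"
proof -
  have "usum d (\<lambda>u v. usum d (\<lambda>c a. usum d (\<lambda>e b. B c a e b) v) u) xs =
    usum d (\<lambda>c w. usum d (\<lambda>a v. usum d (\<lambda>e b. B c a e b) v) w) xs"
    by (rule usum_assoc)
  also have "\<dots> = usum d (\<lambda>c w. usum d (\<lambda>t b. usum d (\<lambda>a e. B c a e b) t) w) xs"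
    by (subst usum_assoc) (rule refl)
  also have "\<dots> = usum d (\<lambda>c w. usum d (\<lambda>t b. usum d (\<lambda>e a. msign (degs d e * degs d a) (B c a e b))
    t) w) xs"
    by (subst usum_commute[symmetric]) (rule refl)
  also have "\<dots> = usum d (\<lambda>c w. usum d (\<lambda>e t. usum d (\<lambda>a b. msign (degs d e * degs d a) (B c a e b))
    t) w) xs"
    by (subst usum_assoc) (rule refl)
  also have "\<dots> = usum d (\<lambda>u v. usum d (\<lambda>c e. usum d (\<lambda>a b. msign (degs d e * degs d a) (B c a e b))
    v) u) xs"
    by (subst usum_assoc) (rule refl)
  finally show ?thesis by (simp add: mult.commute)
qed

text \<open>No sign occurs, since two different lists are split independently.\<close>

lemma usum_swap:
  "usum d (\<lambda>a b. usum d (\<lambda>c e. B a b c e) u) v = usum d (\<lambda>c e. usum d (\<lambda>a b. B a b c e) v) u"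
  by (induction v arbitrary: B) (simp_all add: usum_add msign_usum)

section \<open>Graded symmetric functions of lists\<close>

definition gsymmetric :: "('a \<Rightarrow> int) \<Rightarrow> 'a set \<Rightarrow> ('a list \<Rightarrow> 'v::ab_group_add) \<Rightarrow> bool" where
  "gsymmetric d S G \<longleftrightarrow> (\<forall>a x y b. set a \<subseteq> S \<longrightarrow> x \<in> S \<longrightarrow> y \<in> S \<longrightarrow> set b \<subseteq> S \<longrightarrow>
     G (a @ x # y # b) = msign (d x * d y) (G (a @ y # x # b)))"

lemma gsymmetricI:
  "(\<And>a x y b. set a \<subseteq> S \<Longrightarrow> x \<in> S \<Longrightarrow> y \<in> S \<Longrightarrow> set b \<subseteq> S \<Longrightarrow>
     G (a @ x # y # b) = msign (d x * d y) (G (a @ y # x # b))) \<Longrightarrow> gsymmetric d S G"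
  unfolding gsymmetric_def by blast

lemma gsymmetricD:
  "gsymmetric d S G \<Longrightarrow> set a \<subseteq> S \<Longrightarrow> x \<in> S \<Longrightarrow> y \<in> S \<Longrightarrow> set b \<subseteq> S \<Longrightarrow>
     G (a @ x # y # b) = msign (d x * d y) (G (a @ y # x # b))"
  unfolding gsymmetric_def by blast

lemma gsymmetric_Cons:
  "gsymmetric d S G \<Longrightarrow> x \<in> S \<Longrightarrow> gsymmetric d S (\<lambda>u. G (x # u))"
proof (rule gsymmetricI)
  fix a y z b assume "gsymmetric d S G" "x \<in> S" "set a \<subseteq> S" "y \<in> S" "z \<in> S" "set b \<subseteq> S"
  then show "G (x # a @ y # z # b) = msign (d y * d z) (G (x # a @ z # y # b))"
    using gsymmetricD[of d S G "x # a" y z b] by simp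
qed

lemma gsymmetric_const_msign:
  assumes "gsymmetric d S G"
  shows "gsymmetric d S (\<lambda>u. msign m (G u))"
proof (rule gsymmetricI)
  fix a x y b assume "set a \<subseteq> S" "x \<in> S" "y \<in> S" "set b \<subseteq> S"
  from gsymmetricD[OF assms this]
  show "msign m (G (a @ x # y # b)) = msign (d x * d y) (msign m (G (a @ y # x # b)))"
    by (simp only: msign_msign add.commute)
qed

lemma gsymmetric_msign:
  assumes "gsymmetric d S G"
  shows "gsymmetric d S (\<lambda>u. msign (m * degs d u) (G u))"
proof (rule gsymmetricI)
  fix a x y b assume "set a \<subseteq> S" "x \<in> S" "y \<in> S" "set b \<subseteq> S"
  from gsymmetricD[OF assms this]
  show "msign (m * degs d (a @ x # y # b)) (G (a @ x # y # b)) =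
    msign (d x * d y) (msign (m * degs d (a @ y # x # b)) (G (a @ y # x # b)))"
    by (simp only: msign_msign) (simp add: algebra_simps)
qed

text \<open>A convolution of graded symmetric functions is graded symmetric. If two neighbours land
  in the same part, the symmetry of \<open>B\<close> in that part applies; if they are separated,
  two of the four placements are exchanged, and the signs of the recursion account for the
  factor.\<close>

lemma gsymmetric_usum:
  assumes "\<And>v. set v \<subseteq> S \<Longrightarrow> gsymmetric d S (\<lambda>u. B u v)"
    and "\<And>u. set u \<subseteq> S \<Longrightarrow> gsymmetric d S (B u)"
  shows "gsymmetric d S (usum d B)"
proof (rule gsymmetricI)
  fix a x y b assume "set a \<subseteq> S" and xyb: "x \<in> S" "y \<in> S" "set b \<subseteq> S"
  from this(1) assms show "usum d B (a @ x # y # b) = msign (d x * d y) (usum d B (a @ y # x # b))"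
  proof (induction a arbitrary: B)
    case Nil
    have "usum d B (x # y # b) = usum d (\<lambda>u v. B (x # y # u) v + msign (d y * degs d u) (B (x # u)
      (y # v))
        + (msign (d x * (d y + degs d u)) (B (y # u) (x # v))
        + msign (d y * degs d u) (msign (d x * degs d u) (B u (x # y # v))))) b"
      by (simp add: usum_add)
    also have "\<dots> = usum d (\<lambda>u v. msign (d x * d y) (B (y # x # u) v + msign (d x * degs d u) (B (y #
      u) (x # v))
        + (msign (d y * (d x + degs d u)) (B (x # u) (y # v))
        + msign (d x * degs d u) (msign (d y * degs d u) (B u (y # x # v)))))) b"
    proof (rule usum_cong)
      fix u v assume uv: "mset u + mset v = mset b"
      then have S: "set u \<subseteq> S" "set v \<subseteq> S"
        using xyb(3) by (metis Un_subset_iff set_mset_mset set_mset_union)+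
      have 1: "B (x # y # u) v = msign (d x * d y) (B (y # x # u) v)"
        using gsymmetricD[OF Nil(2)[OF S(2)], of "[]" x y u] xyb S by simp
      have 2: "B u (x # y # v) = msign (d x * d y) (B u (y # x # v))"
        using gsymmetricD[OF Nil(3)[OF S(1)], of "[]" x y v] xyb S by simp
      show "B (x # y # u) v + msign (d y * degs d u) (B (x # u) (y # v))
        + (msign (d x * (d y + degs d u)) (B (y # u) (x # v))
        + msign (d y * degs d u) (msign (d x * degs d u) (B u (x # y # v))))
       = msign (d x * d y) (B (y # x # u) v + msign (d x * degs d u) (B (y # u) (x # v))
        + (msign (d y * (d x + degs d u)) (B (x # u) (y # v))
        + msign (d x * degs d u) (msign (d y * degs d u) (B u (y # x # v)))))"
        unfolding 1 2 by (simp add: msign_def)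
    qed
    also have "\<dots> = msign (d x * d y) (usum d B (y # x # b))"
      by (simp add: usum_add msign_usum[symmetric])
    finally show ?case by simp
  next
    case (Cons z a)
    have z: "z \<in> S" "set a \<subseteq> S" using Cons.prems by auto
    have "usum d (\<lambda>u v. B (z # u) v) (a @ x # y # b) = msign (d x * d y) (usum d (\<lambda>u v. B (z # u) v)
      (a @ y # x # b))"
      using Cons.prems z by (intro Cons.IH gsymmetric_Cons[where x = z]) auto
    moreover have "usum d (\<lambda>u v. msign (d z * degs d u) (B u (z # v))) (a @ x # y # b) =
       msign (d x * d y) (usum d (\<lambda>u v. msign (d z * degs d u) (B u (z # v))) (a @ y # x # b))"
    proof (rule Cons.IH)
      show "gsymmetric d S (\<lambda>u. msign (d z * degs d u) (B u (z # v)))" if "set v \<subseteq> S" for v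
        using that z by (intro gsymmetric_msign Cons.prems) auto
      show "gsymmetric d S (\<lambda>v. msign (d z * degs d u) (B u (z # v)))" if "set u \<subseteq> S" for u
        by (intro gsymmetric_const_msign gsymmetric_Cons Cons.prems that z)
    qed fact
    ultimately show ?case by (simp add: msign_add)
  qed
qed

lemma usum_length_zero:
  "usum d (\<lambda>u v. if u = [] then C v else 0) xs = (C xs :: 'v::ab_group_add)"
proof (induction xs arbitrary: C)
  case (Cons x xs)
  have "usum d (\<lambda>u v. msign (d x * degs d u) (if u = [] then C (x # v) else 0)) xs
      = usum d (\<lambda>u v. if u = [] then C (x # v) else 0) xs"
    by (rule usum_cong) (simp add: msign_def)
  then show ?case by (simp add: Cons.IH)
qed simp

text \<open>Taking out a single entry leaves one term for each position, with the sign for moving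
  that entry to the front. In this way a sum over positions becomes an unshuffle sum.\<close>

lemma usum_length_one:
  fixes B :: "'a \<Rightarrow> 'a list \<Rightarrow> 'v::ab_group_add"
  shows
  "usum d (\<lambda>u v. if length u = 1 then B (hd u) v else 0) xs =
   (\<Sum>i<length xs. msign (d (xs ! i) * degs d (take i xs)) (B (xs ! i) (take i xs @ drop (Suc i) xs)))"
proof (induction xs arbitrary: B)
  case (Cons x xs)
  have "usum d (\<lambda>u v. if length (x # u) = 1 then B (hd (x # u)) v else 0) xs = B x xs"
    using usum_length_zero[of d "B x" xs] by (simp cong: if_cong)
  moreover have "usum d (\<lambda>u v. msign (d x * degs d u) (if length u = 1 then B (hd u) (x # v) else
    0)) xs =
    usum d (\<lambda>u v. if length u = 1 then (\<lambda>y v. msign (d x * d y) (B y (x # v))) (hd u) v else 0) xs"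
    by (rule usum_cong) (auto simp: length_Suc_conv)
  ultimately show ?case
    unfolding length_Cons sum.lessThan_Suc_shift
    by (subst usum.simps, subst (asm) Cons.IH) (simp add: msign_msign algebra_simps)
qed simp

section \<open>Shuffles and Koszul signs\<close>

definition inversions :: "nat \<Rightarrow> (nat \<Rightarrow> nat) \<Rightarrow> (nat \<times> nat) set" where
  "inversions n \<sigma> = {(i, j). i < j \<and> j < n \<and> \<sigma> j < \<sigma> i}"

lemma finite_inversions: "finite (inversions n \<sigma>)"
  by (rule finite_subset[of _ "{..<n} \<times> {..<n}"]) (auto simp: inversions_def)

lemma koszul_sign_inversions:
  "koszul_sign \<sigma> ds = (\<Prod>(i, j)\<in>inversions (length ds) \<sigma>. (-1) powi (ds ! \<sigma> i * ds ! \<sigma> j))"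
  by (simp add: koszul_sign_def inversions_def)

lemma inj_on_map_prod: "inj f \<Longrightarrow> inj_on (map_prod f f) A"
  by (auto simp: inj_on_def)

text \<open>The transposition \<open>t\<close> preserves the order of every pair except
  \<open>(j, Suc j)\<close>; at an ascent it therefore creates exactly this inversion and only
  relabels the others.\<close>

lemma inversions_transpose:
  assumes \<sigma>: "\<sigma> permutes {..<n}" and j: "Suc j < n" and less: "\<sigma> j < \<sigma> (Suc j)"
  defines "t \<equiv> transpose j (Suc j)"
  shows "inversions n (\<sigma> \<circ> t) = insert (j, Suc j) (map_prod t t ` inversions n \<sigma>)"
    and "(j, Suc j) \<notin> map_prod t t ` inversions n \<sigma>"
proof -
  have t: "t i = (if i = j then Suc j else if i = Suc j then j else i)" for i
    by (simp add: t_def transpose_def)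
  have inj: "\<sigma> a = \<sigma> b \<longleftrightarrow> a = b" for a b
    using permutes_inj[OF \<sigma>] by (auto dest: injD)
  have tt: "t (t i) = i" for i by (simp add: t)
  have mono: "t a < t b" if "a < b" "(a, b) \<noteq> (j, Suc j)" for a b
    using that by (auto simp: t)
  have tn: "t a < n" if "a < n" for a using that j by (auto simp: t)
  show "inversions n (\<sigma> \<circ> t) = insert (j, Suc j) (map_prod t t ` inversions n \<sigma>)"
  proof (intro equalityI subsetI)
    fix p assume p: "p \<in> inversions n (\<sigma> \<circ> t)"
    obtain a b where ab: "p = (a, b)" by force
    show "p \<in> insert (j, Suc j) (map_prod t t ` inversions n \<sigma>)"
    proof (cases "(a, b) = (j, Suc j)")
      case False
      then have "(t a, t b) \<in> inversions n \<sigma>"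
        using p ab mono tn by (auto simp: inversions_def)
      then have "map_prod t t (t a, t b) \<in> map_prod t t ` inversions n \<sigma>" by (rule imageI)
      then show ?thesis by (simp add: ab tt)
    qed (simp add: ab)
  next
    fix p assume "p \<in> insert (j, Suc j) (map_prod t t ` inversions n \<sigma>)"
    then show "p \<in> inversions n (\<sigma> \<circ> t)"
    proof
      assume "p = (j, Suc j)"
      then show ?thesis using less j by (simp add: inversions_def t)
    next
      assume "p \<in> map_prod t t ` inversions n \<sigma>"
      then obtain a b where p: "p = (t a, t b)" "a < b" "b < n" "\<sigma> b < \<sigma> a"
        by (auto simp: inversions_def)
      then have "(a, b) \<noteq> (j, Suc j)" using less by auto
      with p mono tn show ?thesis by (auto simp: inversions_def tt)
    qed
  qed
  show "(j, Suc j) \<notin> map_prod t t ` inversions n \<sigma>"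
  proof
    assume "(j, Suc j) \<in> map_prod t t ` inversions n \<sigma>"
    then obtain a b where "t a = j" "t b = Suc j" "a < b" by (auto simp: inversions_def)
    then show False by (auto simp: t split: if_splits)
  qed
qed

text \<open>Induction on the number of inversions: a permutation with a descent arises by an
  adjacent transposition at an ascent of a permutation with one inversion fewer.\<close>

lemma permutes_adjacent_induct [consumes 1, case_names id transpose]:
  assumes "\<sigma> permutes {..<n}" and "P id"
    and step: "\<And>\<sigma> j. \<sigma> permutes {..<n} \<Longrightarrow> Suc j < n \<Longrightarrow> \<sigma> j < \<sigma> (Suc j) \<Longrightarrow> P \<sigma> \<Longrightarrow>
      P (\<sigma> \<circ> transpose j (Suc j))"
  shows "P \<sigma>"
  using assms(1)
proof (induction "card (inversions n \<sigma>)" arbitrary: \<sigma> rule: less_induct)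
  case less
  show ?case
  proof (cases "\<exists>j. Suc j < n \<and> \<sigma> (Suc j) < \<sigma> j")
    case False
    then have step: "\<sigma> j < \<sigma> (Suc j)" if "Suc j < n" for j
      using that permutes_inj[OF less.prems] by (metis injD n_not_Suc_n nat_neq_iff)
    have "\<sigma> i < \<sigma> j" if "i < j" "j < n" for i j
      using that
    proof (induction j)
      case (Suc j)
      then show ?case using step[of j] by (cases "i = j") auto
    qed simp
    \<comment> \<open>Without descents the permutation is increasing, that is, a shuffle with empty
      second block, and hence the identity.\<close>
    then have "\<sigma> \<in> shuffles_perm n 0"
      using less.prems by (auto simp: shuffles_perm_def strict_mono_on_def)
    then show ?thesis using \<open>P id\<close> by (simp add: shuffles_perm_0)
  next
    case True
    then obtain j where j: "Suc j < n" "\<sigma> (Suc j) < \<sigma> j" by blast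
    define t where "t = transpose j (Suc j)"
    have t: "t permutes {..<n}" unfolding t_def using j by (intro permutes_swap_id) auto
    have tt: "t \<circ> t = id" by (simp add: t_def fun_eq_iff)
    have p: "\<sigma> \<circ> t permutes {..<n}" using permutes_compose[OF t less.prems] .
    have l: "(\<sigma> \<circ> t) j < (\<sigma> \<circ> t) (Suc j)" using j by (simp add: t_def)
    have \<sigma>: "\<sigma> \<circ> t \<circ> t = \<sigma>" by (simp add: comp_assoc tt)
    have "card (inversions n \<sigma>) = Suc (card (map_prod t t ` inversions n (\<sigma> \<circ> t)))"
      using inversions_transpose[OF p j(1) l] finite_inversions[of n "\<sigma> \<circ> t"]
      unfolding t_def[symmetric] \<sigma> by (simp add: comp_def)
    also have "card (map_prod t t ` inversions n (\<sigma> \<circ> t)) = card (inversions n (\<sigma> \<circ> t))"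
      by (intro card_image inj_on_map_prod) (simp add: t_def)
    finally have "P (\<sigma> \<circ> t)" by (intro less.hyps p) simp
    then have "P (\<sigma> \<circ> t \<circ> t)" unfolding t_def by (rule step[OF p j(1) l, unfolded t_def])
    then show ?thesis by (simp add: \<sigma>)
  qed
qed

lemma koszul_sign_id [simp]: "koszul_sign (\<lambda>a. a) ds = 1" "koszul_sign id ds = 1"
proof -
  have "inversions (length ds) id = {}" by (auto simp: inversions_def)
  then show "koszul_sign id ds = 1" by (simp add: koszul_sign_inversions)
  then show "koszul_sign (\<lambda>a. a) ds = 1" by (simp add: id_def)
qed

lemma koszul_sign_transpose:
  assumes \<sigma>: "\<sigma> permutes {..<length ds}" and j: "Suc j < length ds" and less: "\<sigma> j < \<sigma> (Suc j)"
  shows "koszul_sign (\<sigma> \<circ> transpose j (Suc j)) ds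
    = (-1) powi (ds ! \<sigma> j * ds ! \<sigma> (Suc j)) * koszul_sign \<sigma> ds"
proof -
  define t where "t = transpose j (Suc j)"
  let ?I = "inversions (length ds)" and ?f = "\<lambda>\<sigma> (i, j). (-1) powi (ds ! \<sigma> i * ds ! \<sigma> j) :: 'a"
  have inj: "inj_on (map_prod t t) (?I \<sigma>)"
    by (simp add: inj_on_map_prod t_def)
  have "koszul_sign (\<sigma> \<circ> t) ds = prod (?f (\<sigma> \<circ> t)) (insert (j, Suc j) (map_prod t t ` ?I \<sigma>))"
    unfolding koszul_sign_inversions t_def inversions_transpose(1)[OF assms] ..
  also have "\<dots> = ?f (\<sigma> \<circ> t) (j, Suc j) * prod (?f (\<sigma> \<circ> t)) (map_prod t t ` ?I \<sigma>)"
    by (intro prod.insert finite_imageI finite_inversions inversions_transpose(2)[OF assms, folded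
      t_def])
  also have "prod (?f (\<sigma> \<circ> t)) (map_prod t t ` ?I \<sigma>) = prod (?f \<sigma>) (?I \<sigma>)"
    by (subst prod.reindex[OF inj]) (simp add: t_def comp_def case_prod_beta)
  finally have "koszul_sign (\<sigma> \<circ> t) ds = ?f (\<sigma> \<circ> t) (j, Suc j) * koszul_sign \<sigma> ds"
    unfolding koszul_sign_inversions[of \<sigma> ds] .
  then show ?thesis by (simp add: t_def mult.commute)
qed

text \<open>In odd degrees Koszul signs are ordinary signs, so an alternating map is a graded
  symmetric function of entries of degree 1.\<close>

lemma sign_eq_koszul_sign:
  assumes "\<sigma> permutes {..<n}"
  shows "of_int (sign \<sigma>) = (koszul_sign \<sigma> (replicate n 1) :: 'k::field)"
  using assms
proof (induction rule: permutes_adjacent_induct)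
  case (transpose \<sigma> j)
  have "of_int (sign (\<sigma> \<circ> transpose j (Suc j))) = - (of_int (sign \<sigma>) :: 'k)"
    using permutes_imp_permutation[OF _ transpose(1)]
    by (subst sign_compose) (auto simp: permutation_swap_id sign_swap_id)
  moreover have "\<sigma> j < n" "\<sigma> (Suc j) < n"
    using permutes_in_image[OF transpose(1)] transpose(2) by simp_all
  ultimately show ?case
    using transpose koszul_sign_transpose[of \<sigma> "replicate n 1" j, where ?'a = 'k]
    by (simp add: comp_def)
qed simp

lemma permute_list_transpose:
  assumes "Suc j < length xs"
  obtains a x y b where "xs = a @ x # y # b" "length a = j" "xs ! j = x" "xs ! Suc j = y"
    "permute_list (transpose j (Suc j)) xs = a @ y # x # b"
proof
  show "xs = take j xs @ xs ! j # xs ! Suc j # drop (Suc (Suc j)) xs"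
    using assms id_take_nth_drop[of j xs] Cons_nth_drop_Suc[of "Suc j" xs] by simp
  show "permute_list (transpose j (Suc j)) xs = take j xs @ xs ! Suc j # xs ! j # drop (Suc (Suc j)) xs"
  proof (rule nth_equalityI)
    fix i assume "i < length (permute_list (transpose j (Suc j)) xs)"
    then have i: "i < length xs" by simp
    then show "permute_list (transpose j (Suc j)) xs ! i = (take j xs @ xs ! Suc j # xs ! j # drop
      (Suc (Suc j)) xs) ! i"
    proof (cases "i \<le> Suc j")
      case False
      then have "i = Suc (Suc j) + (i - Suc (Suc j))" by simp
      then obtain m where "i = Suc (Suc j) + m" by blast
      then show ?thesis using assms i by (simp add: permute_list_def nth_append transpose_def)
    qed (use assms i in \<open>auto simp: permute_list_def nth_append transpose_def nth_Cons'\<close>)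
  qed (use assms in auto)
qed (use assms in auto)

lemma powi_minus_one: "((-1 :: 'k::field) powi m) = (if even m then 1 else -1)"
  by (simp add: power_int_minus_left)

lemma (in vector_space) scale_msign: "scale ((-1) powi m) x = msign m x"
  by (simp add: msign_def powi_minus_one)

text \<open>Graded symmetry is stated for neighbours only. Induction over adjacent transpositions
  extends it to all permutations, each step contributing the same factor to both sides.\<close>

lemma (in vector_space) gsymmetric_permute_list:
  assumes G: "gsymmetric d S G" and S: "set xs \<subseteq> S" and \<sigma>: "\<sigma> permutes {..<length xs}"
  shows "G (permute_list \<sigma> xs) = scale (koszul_sign \<sigma> (map d xs)) (G xs)"
  using \<sigma>
proof (induction rule: permutes_adjacent_induct)
  case (transpose \<sigma> j)
  let ?t = "transpose j (Suc j)"
  have t: "?t permutes {..<length xs}" using transpose by (intro permutes_swap_id) auto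
  have j: "\<sigma> j < length xs" "\<sigma> (Suc j) < length xs"
    using permutes_in_image[OF transpose(1)] transpose(2) by simp_all
  obtain a x y b where ab: "permute_list \<sigma> xs = a @ x # y # b" "length a = j"
    "permute_list \<sigma> xs ! j = x" "permute_list \<sigma> xs ! Suc j = y"
    "permute_list ?t (permute_list \<sigma> xs) = a @ y # x # b"
    by (rule permute_list_transpose[of j "permute_list \<sigma> xs"]) (use transpose in auto)
  have xy: "x = xs ! \<sigma> j" "y = xs ! \<sigma> (Suc j)"
    using ab(3,4) transpose(2) by (simp_all add: permute_list_def)
  have "set (permute_list \<sigma> xs) \<subseteq> S" using S transpose(1) by simp
  then have "G (a @ y # x # b) = msign (d y * d x) (G (a @ x # y # b))"
    unfolding ab by (intro gsymmetricD[OF G]) auto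
  moreover have "permute_list (\<sigma> \<circ> ?t) xs = permute_list ?t (permute_list \<sigma> xs)"
    using permute_list_compose[OF t] by simp
  moreover have "koszul_sign (\<sigma> \<circ> ?t) (map d xs) = (-1 :: 'a) powi (d y * d x) * koszul_sign \<sigma> (map
    d xs)"
    using koszul_sign_transpose[of \<sigma> "map d xs" j] transpose j by (simp add: xy mult.commute)
  ultimately show ?case
    using transpose(4) ab by (simp flip: scale_msign add: comp_def)
qed simp

section \<open>Recursion for shuffles\<close>

definition cons_left :: "(nat \<Rightarrow> nat) \<Rightarrow> nat \<Rightarrow> nat" where
  "cons_left \<sigma> = (\<lambda>a. case a of 0 \<Rightarrow> 0 | Suc b \<Rightarrow> Suc (\<sigma> b))"

text \<open>Both blocks of a shuffle are increasing, so the value 0 sits at position 0 or at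
  position \<open>k\<close>. \<open>cons_left\<close> and \<open>cons_right\<close> insert it there
  and raise all other values by one.\<close>

definition cons_right :: "nat \<Rightarrow> (nat \<Rightarrow> nat) \<Rightarrow> nat \<Rightarrow> nat" where
  "cons_right k \<sigma> = (\<lambda>a. if a < k then Suc (\<sigma> a) else if a = k then 0 else Suc (\<sigma> (a - 1)))"

lemma finite_shuffles_perm: "finite (shuffles_perm k l)"
  by (rule finite_subset[OF _ finite_permutations[of "{..<k + l}"]]) (auto simp: shuffles_perm_def)

lemma cons_left_mem:
  assumes "\<sigma> \<in> shuffles_perm k l"
  shows "cons_left \<sigma> \<in> shuffles_perm (Suc k) l"
proof -
  from assms have p: "\<sigma> permutes {..<k + l}"
    and m: "\<And>a b. a < b \<Longrightarrow> b < k \<Longrightarrow> \<sigma> a < \<sigma> b"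
    "\<And>a b. k \<le> a \<Longrightarrow> a < b \<Longrightarrow> b < k + l \<Longrightarrow> \<sigma> a < \<sigma> b"
    by (auto simp: shuffles_perm_def strict_mono_on_def)
  have inj: "\<sigma> a = \<sigma> b \<longleftrightarrow> a = b" for a b
    using permutes_inj[OF p] by (auto dest: injD)
  have "cons_left \<sigma> permutes {..<Suc k + l}"
  proof (rule inj_imp_permutes)
    show "inj_on (cons_left \<sigma>) {..<Suc k + l}"
      by (auto simp: inj_on_def cons_left_def inj split: nat.splits)
    show "cons_left \<sigma> a \<in> {..<Suc k + l}" if "a \<in> {..<Suc k + l}" for a
      using that permutes_in_image[OF p] by (auto simp: cons_left_def split: nat.splits)
    show "cons_left \<sigma> a = a" if "a \<notin> {..<Suc k + l}" for a
      using that permutes_not_in[OF p] by (auto simp: cons_left_def split: nat.splits)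
  qed auto
  then show ?thesis
    by (auto simp: shuffles_perm_def strict_mono_on_def cons_left_def m split: nat.splits)
qed

lemma cons_right_mem:
  assumes "\<sigma> \<in> shuffles_perm k l"
  shows "cons_right k \<sigma> \<in> shuffles_perm k (Suc l)"
proof -
  from assms have p: "\<sigma> permutes {..<k + l}"
    and m: "\<And>a b. a < b \<Longrightarrow> b < k \<Longrightarrow> \<sigma> a < \<sigma> b"
    "\<And>a b. k \<le> a \<Longrightarrow> a < b \<Longrightarrow> b < k + l \<Longrightarrow> \<sigma> a < \<sigma> b"
    by (auto simp: shuffles_perm_def strict_mono_on_def)
  have inj: "\<sigma> a = \<sigma> b \<longleftrightarrow> a = b" for a b
    using permutes_inj[OF p] by (auto dest: injD)
  have "cons_right k \<sigma> permutes {..<k + Suc l}"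
  proof (rule inj_imp_permutes)
    show "inj_on (cons_right k \<sigma>) {..<k + Suc l}"
      by (auto simp: inj_on_def cons_right_def inj split: if_splits)
    show "cons_right k \<sigma> a \<in> {..<k + Suc l}" if "a \<in> {..<k + Suc l}" for a
      using that permutes_in_image[OF p, of a] permutes_in_image[OF p, of "a - 1"]
      by (auto simp: cons_right_def)
    show "cons_right k \<sigma> a = a" if "a \<notin> {..<k + Suc l}" for a
      using that permutes_not_in[OF p, of "a - 1"] by (auto simp: cons_right_def)
  qed auto
  then show ?thesis
    by (auto simp: shuffles_perm_def strict_mono_on_def cons_right_def m)
qed

lemma inj_cons_left: "inj cons_left"
proof (rule injI, rule ext)
  fix \<sigma> \<tau> b assume "cons_left \<sigma> = cons_left \<tau>"
  from fun_cong[OF this, of "Suc b"] show "\<sigma> b = \<tau> b" by (simp add: cons_left_def)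
qed

lemma inj_cons_right: "inj (cons_right k)"
proof (rule injI, rule ext)
  fix \<sigma> \<tau> b assume "cons_right k \<sigma> = cons_right k \<tau>"
  from fun_cong[OF this, of "if b < k then b else Suc b"]
  show "\<sigma> b = \<tau> b" by (cases "b < k") (simp_all add: cons_right_def)
qed

lemma shuffles_perm_surj_left:
  assumes \<sigma>: "\<sigma> \<in> shuffles_perm (Suc k) l" and 0: "\<sigma> 0 = 0"
  shows "\<sigma> \<in> cons_left ` shuffles_perm k l"
proof -
  from \<sigma> have p: "\<sigma> permutes {..<Suc k + l}"
    and m: "\<And>a b. a < b \<Longrightarrow> b < Suc k \<Longrightarrow> \<sigma> a < \<sigma> b"
    "\<And>a b. Suc k \<le> a \<Longrightarrow> a < b \<Longrightarrow> b < Suc k + l \<Longrightarrow> \<sigma> a < \<sigma> b"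
    by (auto simp: shuffles_perm_def strict_mono_on_def)
  define \<tau> where "\<tau> b = \<sigma> (Suc b) - 1" for b
  have pos: "\<sigma> (Suc b) > 0" for b
    using permutes_inj[OF p] 0 by (metis injD gr0I nat.simps(3))
  have \<sigma>\<tau>: "\<sigma> (Suc b) = Suc (\<tau> b)" for b using pos[of b] by (simp add: \<tau>_def)
  have "\<tau> permutes {..<k + l}"
  proof (rule inj_imp_permutes)
    show "inj_on \<tau> {..<k + l}"
    proof (rule inj_onI)
      fix a b assume "\<tau> a = \<tau> b"
      then have "\<sigma> (Suc a) = \<sigma> (Suc b)" by (simp add: \<sigma>\<tau>)
      then show "a = b" using permutes_inj[OF p] by (auto dest: injD)
    qed
    show "\<tau> a \<in> {..<k + l}" if "a \<in> {..<k + l}" for a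
      using that permutes_in_image[OF p, of "Suc a"] by (simp add: \<sigma>\<tau>)
    show "\<tau> a = a" if "a \<notin> {..<k + l}" for a
      using that permutes_not_in[OF p, of "Suc a"] by (simp add: \<sigma>\<tau>)
  qed auto
  moreover have "\<tau> a < \<tau> b" if "a < b" "b < k \<or> k \<le> a \<and> b < k + l" for a b
    using that m[of "Suc a" "Suc b"] by (auto simp: \<sigma>\<tau>)
  ultimately have "\<tau> \<in> shuffles_perm k l"
    by (auto simp: shuffles_perm_def strict_mono_on_def)
  moreover have "\<sigma> = cons_left \<tau>"
    by (auto simp: fun_eq_iff cons_left_def 0 \<sigma>\<tau> split: nat.splits)
  ultimately show ?thesis by blast
qed

lemma shuffles_perm_surj_right:
  assumes \<sigma>: "\<sigma> \<in> shuffles_perm k (Suc l)" and k: "\<sigma> k = 0"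
  shows "\<sigma> \<in> cons_right k ` shuffles_perm k l"
proof -
  from \<sigma> have p: "\<sigma> permutes {..<k + Suc l}"
    and m: "\<And>a b. a < b \<Longrightarrow> b < k \<Longrightarrow> \<sigma> a < \<sigma> b"
    "\<And>a b. k \<le> a \<Longrightarrow> a < b \<Longrightarrow> b < k + Suc l \<Longrightarrow> \<sigma> a < \<sigma> b"
    by (auto simp: shuffles_perm_def strict_mono_on_def)
  \<comment> \<open>\<open>\<delta>\<close> skips position \<open>k\<close>, where the value 0 sits;
    subtracting 1 in \<open>\<tau>\<close> then closes the gap among the values.\<close>
  define \<delta> where "\<delta> b = (if b < k then b else Suc b)" for b
  define \<tau> where "\<tau> b = \<sigma> (\<delta> b) - 1" for b
  have pos: "\<sigma> a > 0" if "a \<noteq> k" for a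
    using permutes_inj[OF p] k that by (metis injD gr0I)
  have \<sigma>\<tau>: "\<sigma> (\<delta> b) = Suc (\<tau> b)" for b using pos[of "\<delta> b"] by (simp add: \<tau>_def \<delta>_def)
  have "\<tau> permutes {..<k + l}"
  proof (rule inj_imp_permutes)
    show "inj_on \<tau> {..<k + l}"
    proof (rule inj_onI)
      fix a b assume "\<tau> a = \<tau> b"
      then have "\<sigma> (\<delta> a) = \<sigma> (\<delta> b)" by (simp add: \<sigma>\<tau>)
      then have "\<delta> a = \<delta> b" using permutes_inj[OF p] by (auto dest: injD)
      then show "a = b" by (auto simp: \<delta>_def split: if_splits)
    qed
    show "\<tau> a \<in> {..<k + l}" if "a \<in> {..<k + l}" for a
      using that permutes_in_image[OF p, of "\<delta> a"] by (simp add: \<sigma>\<tau>) (simp add: \<delta>_def split: if_splits)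
    show "\<tau> a = a" if "a \<notin> {..<k + l}" for a
      using that permutes_not_in[OF p, of "\<delta> a"] by (simp add: \<sigma>\<tau>) (simp add: \<delta>_def split: if_splits)
  qed auto
  moreover have "\<tau> a < \<tau> b" if "a < b" "b < k \<or> k \<le> a \<and> b < k + l" for a b
  proof -
    have "\<sigma> (\<delta> a) < \<sigma> (\<delta> b)"
      using that m(1)[of a b] m(2)[of "Suc a" "Suc b"] by (auto simp: \<delta>_def)
    then show ?thesis by (simp add: \<sigma>\<tau>)
  qed
  ultimately have "\<tau> \<in> shuffles_perm k l"
    by (auto simp: shuffles_perm_def strict_mono_on_def)
  moreover have "\<sigma> a = cons_right k \<tau> a" for a
    using \<sigma>\<tau>[of a] \<sigma>\<tau>[of "a - 1"] by (auto simp: cons_right_def \<delta>_def k split: if_splits)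
  then have "\<sigma> = cons_right k \<tau>" by auto
  ultimately show ?thesis by blast
qed

text \<open>The counterpart of the recursion of \<open>usum\<close>. The two families are told apart
  by the position of the value 0 and exhaust all shuffles because each block is increasing. The
  guards for \<open>k = 0\<close> and \<open>l = 0\<close> exclude truncated subtraction.\<close>

lemma sum_shuffles_perm_Suc:
  assumes "k + l = Suc n"
  shows "sum f (shuffles_perm k l) =
    (if k = 0 then 0 else \<Sum>\<sigma>\<in>shuffles_perm (k - 1) l. f (cons_left \<sigma>)) +
    (if l = 0 then 0 else \<Sum>\<sigma>\<in>shuffles_perm k (l - 1). f (cons_right k \<sigma>))"
proof -
  define X where "X = (if k = 0 then {} else cons_left ` shuffles_perm (k - 1) l)"
  define Y where "Y = (if l = 0 then {} else cons_right k ` shuffles_perm k (l - 1))"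
  have "shuffles_perm k l = X \<union> Y"
  proof (intro equalityI subsetI)
    fix \<sigma> assume \<sigma>: "\<sigma> \<in> shuffles_perm k l"
    then have p: "\<sigma> permutes {..<k + l}" by (simp add: shuffles_perm_def)
    have "0 \<in> \<sigma> ` {..<k + l}" using permutes_image[OF p] assms by auto
    then obtain a where a: "a < k + l" "\<sigma> a = 0" by auto
    show "\<sigma> \<in> X \<union> Y"
    proof (cases "a < k")
      case True
      then have "\<sigma> 0 < \<sigma> a" if "0 < a"
        using \<sigma> that \<open>a < k\<close> by (intro strict_mono_onD[of "{..<k}" \<sigma>]) (auto simp: shuffles_perm_def)
      then have "\<not> 0 < a" using a by auto
      then show ?thesis
        using shuffles_perm_surj_left[of \<sigma> "k - 1" l] True a \<sigma> by (auto simp: X_def)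
    next
      case False
      then have "\<sigma> k < \<sigma> a" if "k < a"
        using \<sigma> that a by (intro strict_mono_onD[of "{k..<k + l}" \<sigma>]) (auto simp: shuffles_perm_def)
      then have "\<not> k < a" using a by auto
      then show ?thesis
        using shuffles_perm_surj_right[of \<sigma> k "l - 1"] False a \<sigma> by (auto simp: Y_def)
    qed
  next
    fix \<sigma> assume "\<sigma> \<in> X \<union> Y"
    then show "\<sigma> \<in> shuffles_perm k l"
      using cons_left_mem[of _ "k - 1" l] cons_right_mem[of _ k "l - 1"]
      by (auto simp: X_def Y_def split: if_splits)
  qed
  moreover have "X \<inter> Y = {}"
  proof -
    have "\<sigma> 0 = 0" "k \<noteq> 0" if "\<sigma> \<in> X" for \<sigma>
      using that by (auto simp: X_def cons_left_def split: if_splits)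
    moreover have "\<sigma> 0 \<noteq> 0" if "\<sigma> \<in> Y" "k \<noteq> 0" for \<sigma>
      using that by (auto simp: Y_def cons_right_def split: if_splits)
    ultimately show ?thesis by blast
  qed
  moreover have "finite X" "finite Y" by (simp_all add: X_def Y_def finite_shuffles_perm)
  ultimately have "sum f (shuffles_perm k l) = sum f X + sum f Y" by (simp add: sum.union_disjoint)
  then show ?thesis
    by (simp add: X_def Y_def sum.reindex inj_on_subset[OF inj_cons_left]
        inj_on_subset[OF inj_cons_right])
qed

lemma koszul_sign_cons_left:
  assumes "\<sigma> permutes {..<length ds}"
  shows "koszul_sign (cons_left \<sigma>) (c # ds) = koszul_sign \<sigma> ds"
proof -
  have "inversions (length (c # ds)) (cons_left \<sigma>) = map_prod Suc Suc ` inversions (length ds) \<sigma>"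
    by (force simp: inversions_def cons_left_def image_iff split: nat.splits
        elim: less_natE)
  then show ?thesis
    by (simp add: koszul_sign_inversions prod.reindex inj_on_map_prod
        case_prod_beta comp_def) (simp add: cons_left_def)
qed

text \<open>The new inversions pair position \<open>k\<close>, which receives the entry
  \<open>c\<close>, with each position of the left block; the old ones are transported along the
  increasing map \<open>\<delta>\<close> that skips \<open>k\<close>.\<close>

lemma koszul_sign_cons_right:
  assumes \<sigma>: "\<sigma> permutes {..<length ds}" and k: "k \<le> length ds"
  shows "koszul_sign (cons_right k \<sigma>) (c # ds)
    = (-1) powi (c * (\<Sum>i<k. ds ! \<sigma> i)) * koszul_sign \<sigma> ds"
proof -
  define \<delta> where "\<delta> b = (if b < k then b else Suc b)" for b
  let ?s = "cons_right k \<sigma>"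
  have \<delta>: "?s (\<delta> b) = Suc (\<sigma> b)" for b by (simp add: \<delta>_def cons_right_def)
  have sk: "?s k = 0" by (simp add: cons_right_def)
  have \<delta>_less: "\<delta> a < \<delta> b \<longleftrightarrow> a < b" "\<delta> a \<noteq> k" "\<delta> a < Suc (length ds) \<longleftrightarrow> a < length ds" for a b
    using k by (auto simp: \<delta>_def)
  then have inj: "inj \<delta>" by (metis injI nat_neq_iff)
  have \<delta>_surj: "\<exists>b. a = \<delta> b" if "a \<noteq> k" for a
    using that by (intro exI[of _ "if a < k then a else a - 1"]) (auto simp: \<delta>_def)
  define U where "U = (\<lambda>i. (i, k)) ` {..<k}"
  define V where "V = map_prod \<delta> \<delta> ` inversions (length ds) \<sigma>"
  have "inversions (length (c # ds)) ?s = U \<union> V"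
  proof (intro equalityI subsetI)
    fix p assume p: "p \<in> inversions (length (c # ds)) ?s"
    obtain a b where ab: "p = (a, b)" by force
    have "a \<noteq> k" using p by (auto simp: ab inversions_def sk)
    then obtain a' where a': "a = \<delta> a'" using \<delta>_surj by blast
    show "p \<in> U \<union> V"
    proof (cases "b = k")
      case True
      then show ?thesis using p by (auto simp: ab U_def inversions_def)
    next
      case False
      then obtain b' where "b = \<delta> b'" using \<delta>_surj by blast
      then have "(a', b') \<in> inversions (length ds) \<sigma>"
        using p a' by (simp add: ab inversions_def \<delta> \<delta>_less)
      then show ?thesis using a' \<open>b = \<delta> b'\<close> by (auto simp: ab V_def)
    qed
  next
    fix p assume "p \<in> U \<union> V"
    then show "p \<in> inversions (length (c # ds)) ?s"
      using k by (auto simp: U_def V_def inversions_def \<delta> \<delta>_less sk) (simp add: cons_right_def)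
  qed
  moreover have "U \<inter> V = {}" using \<delta>_less(2) by (auto simp: U_def V_def)
  moreover have "finite U" "finite V" by (auto simp: U_def V_def finite_inversions)
  ultimately have "koszul_sign ?s (c # ds) =
    (\<Prod>(i, j)\<in>U. (-1) powi ((c # ds) ! ?s i * (c # ds) ! ?s j)) *
    (\<Prod>(i, j)\<in>V. (-1) powi ((c # ds) ! ?s i * (c # ds) ! ?s j) :: 'a)"
    by (simp add: koszul_sign_inversions prod.union_disjoint)
  also have "(\<Prod>(i, j)\<in>V. (-1) powi ((c # ds) ! ?s i * (c # ds) ! ?s j) :: 'a) = koszul_sign \<sigma> ds"
    using inj by (simp add: V_def koszul_sign_inversions prod.reindex inj_on_map_prod case_prod_beta
      comp_def \<delta>)
  also have "(\<Prod>(i, j)\<in>U. (-1) powi ((c # ds) ! ?s i * (c # ds) ! ?s j) :: 'a)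
    = (\<Prod>i<k. (-1) powi (c * ds ! \<sigma> i))"
    by (simp add: U_def prod.reindex inj_on_def comp_def sk)
       (simp add: cons_right_def mult.commute)
  also have "\<dots> = (-1) powi (c * (\<Sum>i<k. ds ! \<sigma> i))"
    by (induction k) (simp_all add: power_int_add distrib_left mult.commute)
  finally show ?thesis .
qed

lemma permute_list_cons_left:
  assumes "\<sigma> permutes {..<length xs}"
  shows "permute_list (cons_left \<sigma>) (x # xs) = x # permute_list \<sigma> xs"
  by (simp add: permute_list_def upt_conv_Cons map_Suc_upt[symmetric] cons_left_def comp_def
      del: upt_Suc)

lemma permute_list_cons_right:
  assumes k: "k \<le> length xs"
  shows "take k (permute_list (cons_right k \<sigma>) (x # xs)) = take k (permute_list \<sigma> xs)"
    and "drop k (permute_list (cons_right k \<sigma>) (x # xs)) = x # drop k (permute_list \<sigma> xs)"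
  using k by (auto intro!: nth_equalityI simp: permute_list_def cons_right_def nth_Cons' simp del:
    upt_Suc)

text \<open>The bridge from sums over permutations to unshuffle sums. It serves both ordinary signs,
  with all degrees 1, and genuine Koszul signs.\<close>

lemma (in vector_space) sum_shuffles_perm:
  assumes "length xs = k + l"
  shows "(\<Sum>\<sigma>\<in>shuffles_perm k l. scale (koszul_sign \<sigma> (map d xs))
      (B (take k (permute_list \<sigma> xs)) (drop k (permute_list \<sigma> xs)))) =
    usum d (\<lambda>u v. if length u = k then B u v else 0) xs"
  using assms
proof (induction xs arbitrary: B k l)
  case Nil
  then show ?case by (simp add: shuffles_perm_0)
next
  case (Cons x xs)
  let ?f = "\<lambda>k B \<sigma> xs. scale (koszul_sign \<sigma> (map d xs)) (B (take k (permute_list \<sigma> xs)) (drop k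
    (permute_list \<sigma> xs)))"
  have perm: "\<sigma> permutes {..<length xs}" if "\<sigma> \<in> shuffles_perm k' l'" "k' + l' = length xs" for \<sigma> k' l'
    using that by (simp add: shuffles_perm_def)
  have "(if k = 0 then 0 else \<Sum>\<sigma>\<in>shuffles_perm (k - 1) l. ?f k B (cons_left \<sigma>) (x # xs)) =
     usum d (\<lambda>u v. if length (x # u) = k then B (x # u) v else 0) xs"
  proof (cases k)
    case (Suc k')
    then have len: "length xs = k' + l" using Cons.prems by simp
    have "(\<Sum>\<sigma>\<in>shuffles_perm k' l. ?f k B (cons_left \<sigma>) (x # xs)) =
      (\<Sum>\<sigma>\<in>shuffles_perm k' l. ?f k' (\<lambda>u. B (x # u)) \<sigma> xs)"
      using perm[of _ k' l] len
      by (intro sum.cong) (auto simp: Suc koszul_sign_cons_left permute_list_cons_left)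
    then show ?thesis using Cons.IH[OF len, of "\<lambda>u. B (x # u)"] Suc by simp
  qed simp
  moreover have "(if l = 0 then 0 else \<Sum>\<sigma>\<in>shuffles_perm k (l - 1). ?f k B (cons_right k \<sigma>) (x # xs)) =
     usum d (\<lambda>u v. msign (d x * degs d u) (if length u = k then B u (x # v) else 0)) xs"
  proof (cases l)
    case 0
    \<comment> \<open>For \<open>l = 0\<close> the tail \<open>xs\<close> has fewer than
      \<open>k\<close> entries, so the second summand of the recursion vanishes as well.\<close>
    have "length u < k" if "mset u + mset v = mset xs" for u v
      using arg_cong[OF that, of size] Cons.prems 0 by simp
    then show ?thesis using 0 by (subst usum_eq_zero) fastforce+
  next
    case (Suc l')
    then have len: "length xs = k + l'" using Cons.prems by simp
    have "?f k B (cons_right k \<sigma>) (x # xs) =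
       ?f k (\<lambda>u v. msign (d x * degs d u) (B u (x # v))) \<sigma> xs"
      if "\<sigma> \<in> shuffles_perm k l'" for \<sigma>
    proof -
      have p: "\<sigma> permutes {..<length xs}" using perm[OF that] len by simp
      have "degs d (take k (permute_list \<sigma> xs)) = (\<Sum>i<k. map d xs ! \<sigma> i)"
        using permutes_in_image[OF p] len
        by (simp add: degs_def permute_list_def take_map sum_list_sum_nth atLeast0LessThan)
      then show ?thesis
        using p len
        by (simp add: koszul_sign_cons_right permute_list_cons_right
            scale_msign[symmetric] scale_scale mult.commute)
    qed
    then have "(\<Sum>\<sigma>\<in>shuffles_perm k l'. ?f k B (cons_right k \<sigma>) (x # xs)) =
      (\<Sum>\<sigma>\<in>shuffles_perm k l'. ?f k (\<lambda>u v. msign (d x * degs d u) (B u (x # v))) \<sigma> xs)"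
      by (intro sum.cong) auto
    also have "\<dots> = usum d (\<lambda>u v. if length u = k then msign (d x * degs d u) (B u (x # v)) else 0) xs"
      by (rule Cons.IH[OF len])
    also have "\<dots> = usum d (\<lambda>u v. msign (d x * degs d u) (if length u = k then B u (x # v) else 0)) xs"
      by (rule usum_cong) simp
    finally show ?thesis by (simp add: Suc)
  qed
  ultimately show ?case
    using Cons.prems by (subst sum_shuffles_perm_Suc[of k l "length xs"]) (simp_all only: usum.simps
      length_Cons)
qed

section \<open>The Nijenhuis-Richardson graded Lie algebra\<close>

definition multilinear :: "('k::field \<Rightarrow> 'v::ab_group_add \<Rightarrow> 'v) \<Rightarrow>
    ('k \<Rightarrow> 'w::ab_group_add \<Rightarrow> 'w) \<Rightarrow> ('v list \<Rightarrow> 'w) \<Rightarrow> bool" where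
  "multilinear s1 s2 f \<longleftrightarrow> (\<forall>a b. Vector_Spaces.linear s1 s2 (\<lambda>x. f (a @ x # b)))"

lemma multilinearD:
  assumes "multilinear s1 s2 f"
  shows "f (a @ (x + y) # b) = f (a @ x # b) + f (a @ y # b)"
    and "f (a @ s1 c x # b) = s2 c (f (a @ x # b))"
    and "f (a @ 0 # b) = 0" and "f (a @ (- x) # b) = - f (a @ x # b)"
proof -
  interpret Vector_Spaces.linear s1 s2 "\<lambda>x. f (a @ x # b)"
    using assms by (simp add: multilinear_def)
  show "f (a @ (x + y) # b) = f (a @ x # b) + f (a @ y # b)" by (rule add)
  show "f (a @ s1 c x # b) = s2 c (f (a @ x # b))" by (rule scale)
  show "f (a @ 0 # b) = 0" by (rule zero)
  show "f (a @ (- x) # b) = - f (a @ x # b)" by (rule neg)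
qed

lemmas multilinear_Cons = multilinearD[where a = "[]", simplified]

lemma multilinearI:
  assumes "vector_space s1" "vector_space s2"
    and "\<And>a b x y. f (a @ (x + y) # b) = f (a @ x # b) + f (a @ y # b)"
    and "\<And>a b c x. f (a @ s1 c x # b) = s2 c (f (a @ x # b))"
  shows "multilinear s1 s2 f"
  using assms by (simp add: multilinear_def Vector_Spaces.linear_iff)

lemma multilinear_shift:
  assumes "multilinear s1 s2 f"
  shows "multilinear s1 s2 (\<lambda>u. f (z # u))"
  unfolding multilinear_def
proof (intro allI)
  fix a b show "Vector_Spaces.linear s1 s2 (\<lambda>x. f (z # a @ x # b))"
    using assms[unfolded multilinear_def, rule_format, of "z # a" b] by simp
qed

text \<open>With a constant degree the signs depend only on lengths, so replacing an entry by a sum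
  or a multiple leaves them unchanged, and linearity passes from each term to the sum.\<close>

lemma multilinear_usum:
  assumes vs: "vector_space s1" "vector_space s2"
    and "\<And>v. multilinear s1 s2 (\<lambda>u. B u v)" "\<And>u. multilinear s1 s2 (B u)"
  shows "multilinear s1 s2 (usum (\<lambda>_. k) B)"
proof -
  interpret s2: vector_space s2 by fact
  have deg: "degs (\<lambda>_. k) (u @ x # v) = degs (\<lambda>_. k) (u @ y # v)" for u v and x y :: 'b by simp
  have ms: "msign m (s2 c x) = s2 c (msign m x)" for m c x by (simp add: msign_def)
  have "usum (\<lambda>_. k) B (a @ (x + y) # b) = usum (\<lambda>_. k) B (a @ x # b) + usum (\<lambda>_. k) B (a @ y # b)
      \<and> usum (\<lambda>_. k) B (a @ s1 c x # b) = s2 c (usum (\<lambda>_. k) B (a @ x # b))" for a b x y c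
    using assms(3,4)
  proof (induction a arbitrary: B)
    case Nil
    note [simp] = multilinear_Cons(1,2)[OF Nil(1)] multilinear_Cons(1,2)[OF Nil(2)]
    have "usum (\<lambda>_. k) (\<lambda>u. B ((x + y) # u)) b = usum (\<lambda>_. k) (\<lambda>u v. B (x # u) v + B (y # u) v) b"
      "usum (\<lambda>_. k) (\<lambda>u. B (s1 c x # u)) b = usum (\<lambda>_. k) (\<lambda>u v. s2 c (B (x # u) v)) b"
      by (rule usum_cong; simp)+
    then show ?case
      by (simp add: usum_add msign_add s2.scale_right_distrib ms
          usum_additive[of "s2 c", OF s2.scale_right_distrib])
  next
    case (Cons z a)
    have *: "multilinear s1 s2 (\<lambda>u. B (z # u) v)" for v
      using Cons.prems(1)[of v] by (rule multilinear_shift)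
    have **: "multilinear s1 s2 (\<lambda>v. msign m (B u (z # v)))" for m u
    proof (rule multilinearI[OF vs])
      fix a b x y c
      show "msign m (B u (z # a @ (x + y) # b)) = msign m (B u (z # a @ x # b)) + msign m (B u (z #
        a @ y # b))"
        using multilinearD(1)[OF Cons.prems(2)[of u], of "z # a"] by (simp add: msign_add)
      show "msign m (B u (z # a @ s1 c x # b)) = s2 c (msign m (B u (z # a @ x # b)))"
        using multilinearD(2)[OF Cons.prems(2)[of u], of "z # a"] by (simp add: ms)
    qed
    have ***: "multilinear s1 s2 (\<lambda>u. msign (k * degs (\<lambda>_. k) u) (B u (z # v)))" for v
      by (rule multilinearI[OF vs])
         (simp_all add: multilinearD[OF Cons.prems(1)] msign_add ms)
    show ?case
      using Cons.IH[OF * Cons.prems(2)] Cons.IH[OF *** **] by (simp add: s2.scale_right_distrib)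
  qed
  then show ?thesis by (intro multilinearI vs) auto
qed

text \<open>The characteristic enters here, through the invertibility of 2.\<close>

lemma double_eq_zeroD:
  fixes s :: "'k::field_char_0 \<Rightarrow> 'w::ab_group_add \<Rightarrow> 'w"
  assumes "vector_space s" "x = - (x :: 'w)"
  shows "x = 0"
proof -
  interpret vector_space s by fact
  have "s 2 x = s 1 x + s 1 x" using scale_left_distrib[of 1 1 x] by (simp only: one_add_one)
  also have "\<dots> = 0" using assms(2) by (simp add: eq_neg_iff_add_eq_0)
  finally show ?thesis by simp
qed

text \<open>Antisymmetry in neighbours is the form that unshuffle sums preserve. As 2 is invertible,
  it is equivalent to vanishing on repeated entries.\<close>

lemma alt_hom_iff:
  fixes sV :: "'k::field_char_0 \<Rightarrow> 'v::ab_group_add \<Rightarrow> 'v"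
  assumes "vector_space sV" "vector_space sW"
  shows "f \<in> alt_hom sV sW n \<longleftrightarrow> (\<forall>xs. length xs \<noteq> n \<longrightarrow> f xs = 0) \<and>
    multilinear sV sW f \<and> gsymmetric (\<lambda>_. 1) UNIV f"
proof
  interpret V: vector_space sV by fact
  interpret W: vector_space sW by fact
  assume f: "f \<in> alt_hom sV sW n"
  then have off: "\<forall>xs. length xs \<noteq> n \<longrightarrow> f xs = 0" by (simp add: alt_hom_def)
  have lin: "Vector_Spaces.linear sV sW (\<lambda>x. f (a @ x # b))" for a b
  proof (cases "length (a @ 0 # b) = n")
    case True
    have "\<forall>xs i. length xs = n \<and> i < n \<longrightarrow> Vector_Spaces.linear sV sW (\<lambda>x. f (xs[i := x]))"
      using f by (simp add: alt_hom_def)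
    from this[rule_format, of "a @ 0 # b" "length a"] True show ?thesis by simp
  next
    case False
    then have "(\<lambda>x. f (a @ x # b)) = (\<lambda>x. 0)" using off by auto
    then show ?thesis using assms by (simp add: Vector_Spaces.linear_iff)
  qed
  then have ml: "multilinear sV sW f" by (simp add: multilinear_def)
  have alt: "f (a @ x # x # b) = 0" for a x b
  proof (cases "length (a @ x # x # b) = n")
    case True
    have "\<forall>xs i j. length xs = n \<and> i < j \<and> j < n \<and> xs ! i = xs ! j \<longrightarrow> f xs = 0"
      using f by (simp add: alt_hom_def)
    from this[rule_format, of "a @ x # x # b" "length a" "Suc (length a)"] True
    show ?thesis by (simp add: nth_append)
  qed (use off in blast)
  \<comment> \<open>Polarisation: \<open>f\<close> is expanded at two neighbouring entries
    \<open>x + y\<close>.\<close>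
  have anti: "f (a @ x # y # b) = - f (a @ y # x # b)" for a x y b
  proof -
    have "f (a @ x # x # b) + f (a @ x # y # b) + (f (a @ y # x # b) + f (a @ y # y # b)) = 0"
      using alt[of a "x + y" b] multilinearD(1)[OF ml, of a x y "(x + y) # b"]
        multilinearD(1)[OF ml, of "a @ [x]" x y b]
        multilinearD(1)[OF ml, of "a @ [y]" x y b] by simp
    then show ?thesis using alt by (simp add: eq_neg_iff_add_eq_0 add.commute)
  qed
  have "gsymmetric (\<lambda>_. 1) UNIV f"
  proof (rule gsymmetricI)
    fix a x y b show "f (a @ x # y # b) = msign (1 * 1) (f (a @ y # x # b))"
      using anti[of a x y b] by (simp add: msign_def)
  qed
  with off ml show "(\<forall>xs. length xs \<noteq> n \<longrightarrow> f xs = 0) \<and>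
    multilinear sV sW f \<and> gsymmetric (\<lambda>_. 1) UNIV f" by blast
next
  assume f: "(\<forall>xs. length xs \<noteq> n \<longrightarrow> f xs = 0) \<and>
    multilinear sV sW f \<and> gsymmetric (\<lambda>_. 1) UNIV f"
  then have anti: "f (a @ x # y # b) = - f (a @ y # x # b)" for a x y b
    using gsymmetricD[of "\<lambda>_. 1" UNIV f a x y b] by (simp add: msign_def)
  \<comment> \<open>The first of the equal entries is moved past \<open>m\<close> to its twin; for
    equal neighbours the value is its own negative.\<close>
  have rep: "f (a @ x # m @ x # b) = 0" for a x m b
  proof (induction m arbitrary: a)
    case Nil
    then show ?case using anti[of a x x b] by (intro double_eq_zeroD[OF assms(2)]) simp
  next
    case (Cons y m)
    have "f (a @ x # y # m @ x # b) = - f ((a @ [y]) @ x # m @ x # b)" by (subst anti) simp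
    then show ?case using Cons.IH[of "a @ [y]"] by simp
  qed
  have "f xs = 0" if ij: "i < j" "j < length xs" "xs ! i = xs ! j" for xs i j
  proof -
    have "xs = take i xs @ xs ! i # drop (Suc i) xs" using ij by (intro id_take_nth_drop) simp
    moreover have "drop (Suc i) xs = take (j - Suc i) (drop (Suc i) xs) @ xs ! j # drop (Suc j) xs"
      using ij id_take_nth_drop[of "j - Suc i" "drop (Suc i) xs"] by (simp add: drop_drop)
    ultimately show ?thesis using rep ij(3) by metis
  qed
  moreover have "Vector_Spaces.linear sV sW (\<lambda>x. f (xs[i := x]))" if "i < length xs" for xs i
    using f that by (simp add: multilinear_def upd_conv_take_nth_drop)
  ultimately show "f \<in> alt_hom sV sW n" using f by (auto simp: alt_hom_def)
qed

lemma vector_space_fun_scale: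
  assumes "vector_space s" shows "vector_space (fun_scale s)"
proof -
  interpret vector_space s by fact
  show ?thesis
    by unfold_locales (simp_all add: fun_scale_def fun_eq_iff scale_right_distrib scale_left_distrib)
qed

lemma subspace_alt_hom:
  fixes sV :: "'k::field_char_0 \<Rightarrow> 'v::ab_group_add \<Rightarrow> 'v"
  assumes "vector_space sV" "vector_space sW"
  shows "module.subspace (fun_scale sW) (alt_hom sV sW n)"
proof -
  interpret W: vector_space sW by fact
  interpret F: vector_space "fun_scale sW" by (rule vector_space_fun_scale) fact
  note iff = alt_hom_iff[OF assms]
  have [simp]: "0 \<in> alt_hom sV sW n"
    unfolding iff by (intro conjI multilinearI assms gsymmetricI) simp_all
  moreover have "f + g \<in> alt_hom sV sW n" if f: "f \<in> alt_hom sV sW n" and g: "g \<in> alt_hom sV sW n"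
    for f g
    unfolding iff
  proof (intro conjI multilinearI assms gsymmetricI)
    note ml = conjunct1[OF conjunct2[OF f[unfolded iff]]] conjunct1[OF conjunct2[OF g[unfolded iff]]]
    show "(f + g) (a @ (x + y) # b) = (f + g) (a @ x # b) + (f + g) (a @ y # b)" for a x y b
      by (simp add: multilinearD(1)[OF ml(1)] multilinearD(1)[OF ml(2)])
    show "(f + g) (a @ sV c x # b) = sW c ((f + g) (a @ x # b))" for a c x b
      by (simp add: multilinearD(2)[OF ml(1)] multilinearD(2)[OF ml(2)] W.scale_right_distrib)
    show "(f + g) (a @ x # y # b) = msign (1 * 1) ((f + g) (a @ y # x # b))" for a x y b
      using f g unfolding iff plus_fun_apply msign_add by (metis gsymmetricD UNIV_I subset_UNIV)
  qed (use f g in \<open>simp add: alt_hom_def\<close>)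
  moreover have "fun_scale sW c f \<in> alt_hom sV sW n" if f: "f \<in> alt_hom sV sW n" for c f
    unfolding iff
  proof (intro conjI multilinearI assms gsymmetricI)
    note ml = conjunct1[OF conjunct2[OF f[unfolded iff]]]
    note sym = conjunct2[OF conjunct2[OF f[unfolded iff]]]
    show "fun_scale sW c f (a @ (x + y) # b) = fun_scale sW c f (a @ x # b) + fun_scale sW c f (a @
      y # b)" for a x y b
      by (simp add: fun_scale_def multilinearD(1)[OF ml] W.scale_right_distrib)
    show "fun_scale sW c f (a @ sV k x # b) = sW k (fun_scale sW c f (a @ x # b))" for a k x b
      by (simp add: fun_scale_def multilinearD(2)[OF ml] mult.commute)
    show "fun_scale sW c f (a @ x # y # b) = msign (1 * 1) (fun_scale sW c f (a @ y # x # b))" for a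
      x y b
      using gsymmetricD[OF sym, of a x y b] by (simp add: fun_scale_def msign_def)
  qed (use f in \<open>simp add: alt_hom_def fun_scale_def\<close>)
  ultimately show ?thesis unfolding F.subspace_def by blast
qed

lemma sum_apply_fun: "(\<Sum>i\<in>I. f i) x = (\<Sum>i\<in>I. f i x)"
  by (induction I rule: infinite_finite_induct) simp_all

text \<open>No block lengths are prescribed. For alternating maps, extended by zero, only the
  splittings with the correct lengths contribute.\<close>

definition nr_circ :: "('v list \<Rightarrow> 'v) \<Rightarrow> ('v list \<Rightarrow> 'v) \<Rightarrow> 'v list \<Rightarrow> 'v::ab_group_add" where
  "nr_circ f g = usum (\<lambda>_. 1) (\<lambda>u v. f (g u # v))"

lemma msign_fun: "msign m f x = msign m (f x)"
  by (simp add: msign_def)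

lemma nr_circ_left:
  "nr_circ (f + f') g = nr_circ f g + nr_circ f' g" "nr_circ (f - f') g = nr_circ f g - nr_circ f' g"
  "nr_circ (- f) g = - nr_circ f g" "nr_circ (msign m f) g = msign m (nr_circ f g)"
proof -
  show 1: "nr_circ (f + f') g = nr_circ f g + nr_circ f' g" for f f' by (simp add: nr_circ_def
    fun_eq_iff usum_add)
  show 2: "nr_circ (- f) g = - nr_circ f g" for f by (simp add: nr_circ_def fun_eq_iff usum_uminus)
  show "nr_circ (f - f') g = nr_circ f g - nr_circ f' g" using 1[of f "- f'"] 2[of f'] by simp
  show "nr_circ (msign m f) g = msign m (nr_circ f g)" by (simp add: msign_def 2)
qed

section \<open>Composition of alternating maps and its pre-Lie identity\<close>

locale vector_space_char_0 = vector_space scale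
  for scale :: "'a::field_char_0 \<Rightarrow> 'b::ab_group_add \<Rightarrow> 'b" (infixr "*s" 75)
begin

abbreviation H :: "nat \<Rightarrow> ('b list \<Rightarrow> 'b) set" where
  "H p \<equiv> alt_hom scale scale (p + 1)"

lemma H_off: "f \<in> H p \<Longrightarrow> length xs \<noteq> p + 1 \<Longrightarrow> f xs = 0"
  by (simp add: alt_hom_def)

lemma H_multilinear: "f \<in> H p \<Longrightarrow> multilinear scale scale f"
  using alt_hom_iff[OF vector_space_axioms vector_space_axioms] by blast

lemma H_antisym: "f \<in> H p \<Longrightarrow> f (a @ x # y # b) = - f (a @ y # x # b)"
  using alt_hom_iff[OF vector_space_axioms vector_space_axioms, of f]
    gsymmetricD[of "\<lambda>_. 1" UNIV f a x y b] by (simp add: msign_def)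

lemma H_Cons:
  assumes "f \<in> H p"
  shows "f ((x + y) # b) = f (x # b) + f (y # b)" "f (0 # b) = 0" "f ((- x) # b) = - f (x # b)"
    "f ((c *s x) # b) = c *s f (x # b)" "f ((x - y) # b) = f (x # b) - f (y # b)" 
    "f (msign m x # b) = msign m (f (x # b))"
proof -
  note * = multilinear_Cons[OF H_multilinear[OF assms]]
  show 1: "f ((x + y) # b) = f (x # b) + f (y # b)" "f (0 # b) = 0" "f ((- x) # b) = - f (x # b)"
    "f ((c *s x) # b) = c *s f (x # b)" for x y by (rule *)+
  show "f ((x - y) # b) = f (x # b) - f (y # b)" using 1(1)[of x "- y"] 1(3) by simp
  show "f (msign m x # b) = msign m (f (x # b))" by (simp add: msign_def 1)
qed

lemma nr_circ_right:
  assumes "f \<in> H p"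
  shows "nr_circ f (g + g') = nr_circ f g + nr_circ f g'" "nr_circ f (g - g') = nr_circ f g -
    nr_circ f g'"
  "nr_circ f (msign m g) = msign m (nr_circ f g)" "nr_circ f 0 = 0"
proof -
  show 1: "nr_circ f (g + g') = nr_circ f g + nr_circ f g'" for g g'
    by (simp add: nr_circ_def fun_eq_iff usum_add H_Cons[OF assms])
  have 2: "nr_circ f (- g) = - nr_circ f g" for g
    by (simp add: nr_circ_def fun_eq_iff usum_uminus H_Cons[OF assms])
  show "nr_circ f (g - g') = nr_circ f g - nr_circ f g'" using 1[of g "- g'"] 2[of g'] by simp
  show "nr_circ f (msign m g) = msign m (nr_circ f g)" by (simp add: msign_def 2)
  show "nr_circ f 0 = 0" using 1[of 0 0] by simp
qed

lemma nr_circ_mem: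
  assumes f: "f \<in> H p" and g: "g \<in> H q"
  shows "nr_circ f g \<in> H (p + q)"
  unfolding alt_hom_iff[OF vector_space_axioms vector_space_axioms]
proof (intro conjI allI impI)
  fix xs :: "'b list" assume xs: "length xs \<noteq> p + q + 1"
  have "f (g u # v) = 0" if "mset u + mset v = mset xs" for u v
  proof (cases "length u = q + 1")
    case True
    have "length u + length v = length xs" using arg_cong[OF that, of size] by simp
    then show ?thesis using True xs H_off[OF f] by simp
  qed (simp add: H_off[OF g] H_Cons[OF f])
  then show "nr_circ f g xs = 0" unfolding nr_circ_def by (rule usum_eq_zero)
next
  note f' = multilinearD[OF H_multilinear[OF f]] and g' = multilinearD[OF H_multilinear[OF g]]
  show "multilinear scale scale (nr_circ f g)"
    unfolding nr_circ_def
  proof (rule multilinear_usum[OF vector_space_axioms vector_space_axioms])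
    show "multilinear scale scale (\<lambda>u. f (g u # v))" for v
      by (rule multilinearI) (simp_all add: g' H_Cons[OF f] vector_space_axioms)
    show "multilinear scale scale (\<lambda>v. f (g u # v))" for u
      using f'(1,2)[of "g u # _"] by (intro multilinearI) (simp_all add: vector_space_axioms)
  qed
  have "gsymmetric (\<lambda>_. 1) UNIV (usum (\<lambda>_. 1) (\<lambda>u v. f (g u # v)))"
  proof (rule gsymmetric_usum)
    show "gsymmetric (\<lambda>_. 1) UNIV (\<lambda>u. f (g u # v))" for v
    proof (rule gsymmetricI)
      fix a x y b show "f (g (a @ x # y # b) # v) = msign (1 * 1) (f (g (a @ y # x # b) # v))"
        by (subst H_antisym[OF g]) (simp add: H_Cons[OF f] msign_def)
    qed
    show "gsymmetric (\<lambda>_. 1) UNIV (\<lambda>v. f (g u # v))" for u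
    proof (rule gsymmetricI)
      fix a x y b show "f (g u # a @ x # y # b) = msign (1 * 1) (f (g u # a @ y # x # b))"
        using H_antisym[OF f, of "g u # a" x y b] by (simp add: msign_def)
    qed
  qed
  then show "gsymmetric (\<lambda>_. 1) UNIV (nr_circ f g)" by (simp add: nr_circ_def)
qed

text \<open>The associator of \<open>nr_circ\<close>: \<open>g\<close> and \<open>h\<close> are inserted into two different arguments of \<open>f\<close>,
  so that it is graded symmetric in \<open>g\<close> and \<open>h\<close>.\<close>

definition insert_two :: "('b list \<Rightarrow> 'b) \<Rightarrow> ('b list \<Rightarrow> 'b) \<Rightarrow> ('b list \<Rightarrow> 'b) \<Rightarrow> 'b list \<Rightarrow> 'b" where
  "insert_two f g h = usum (\<lambda>_. 1) (\<lambda>u v. usum (\<lambda>_. 1) (\<lambda>a b. msign (int (length a)) (f (g a # h u #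
    b))) v)"

text \<open>In the list \<open>h u # v\<close> the head either becomes an argument of
  \<open>g\<close>, which gives the iterated composition by coassociativity, or it remains a direct
  argument of \<open>f\<close>, with the sign for passing \<open>a\<close>.\<close>

lemma nr_circ_associator:
  assumes f: "f \<in> H p"
  shows "nr_circ (nr_circ f g) h = nr_circ f (nr_circ g h) + insert_two f g h"
proof
  fix xs
  let ?U = "usum (\<lambda>_. 1 :: int)"
  have "nr_circ (nr_circ f g) h xs = ?U (\<lambda>u v. ?U (\<lambda>a b. f (g (h u # a) # b)) v) xs + insert_two f g
    h xs"
    by (simp add: nr_circ_def insert_two_def usum_add degs_one)
  also have "?U (\<lambda>u v. ?U (\<lambda>a b. f (g (h u # a) # b)) v) xs = ?U (\<lambda>w b. ?U (\<lambda>u a. f (g (h u # a) #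
    b)) w) xs"
    by (rule usum_assoc[symmetric])
  also have "\<dots> = nr_circ f (nr_circ g h) xs"
    unfolding nr_circ_def
    by (intro usum_cong usum_additive[symmetric, of "\<lambda>x. f (x # _)"] H_Cons[OF f])
  finally show "nr_circ (nr_circ f g) h xs = (nr_circ f (nr_circ g h) + insert_two f g h) xs" by simp
qed

lemma insert_two_commute:
  assumes f: "f \<in> H p" and g: "g \<in> H q" and h: "h \<in> H r"
  shows "insert_two f h g = msign (int q * int r) (insert_two f g h)"
proof
  fix xs
  let ?U = "usum (\<lambda>_. 1 :: int)"
  have "insert_two f h g xs = ?U (\<lambda>w b. ?U (\<lambda>u a. msign (int (length a)) (f (h a # g u # b))) w) xs"
    unfolding insert_two_def by (rule usum_assoc[symmetric])
  also have "\<dots> = ?U (\<lambda>w b. ?U (\<lambda>u a. msign (int (length u) * int (length a))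
      (msign (int (length u)) (f (h u # g a # b)))) w) xs"
    by (subst usum_commute[symmetric]) (simp add: degs_one)
  also have "\<dots> = ?U (\<lambda>w b. ?U (\<lambda>u a. msign (int q * int r) (msign (int (length a)) (f (g a # h u #
    b)))) w) xs"
  \<comment> \<open>Swapping the first two arguments of \<open>f\<close> costs one sign. With
    \<open>length u = r + 1\<close> and \<open>length a = q + 1\<close> the exponents (r + 1)(q + 1)
    + (r + 1) + 1 and q r + (q + 1) have the same parity; for other lengths both sides
    vanish.\<close>
  proof (intro usum_cong)
    fix u a b
    show "msign (int (length u) * int (length a)) (msign (int (length u)) (f (h u # g a # b)))
      = msign (int q * int r) (msign (int (length a)) (f (g a # h u # b)))"
    proof (cases "length u = r + 1 \<and> length a = q + 1")
      case True
      then show ?thesis using H_antisym[OF f, of "[]" "h u" "g a" b] by (simp add: msign_def)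
    next
      case False
      then have "h u = 0 \<or> g a = 0" using H_off[OF g] H_off[OF h] by blast
      then show ?thesis
        using multilinearD(3)[OF H_multilinear[OF f], of "[_]"] H_Cons[OF f] by auto
    qed
  qed
  also have "\<dots> = ?U (\<lambda>u v. ?U (\<lambda>a b. msign (int q * int r) (msign (int (length a)) (f (g a # h u #
    b)))) v) xs"
    by (rule usum_assoc)
  also have "\<dots> = msign (int q * int r) (insert_two f g h) xs"
    by (simp add: insert_two_def msign_usum msign_fun)
  finally show "insert_two f h g xs = msign (int q * int r) (insert_two f g h) xs" .
qed

lemma nr_comp_usum:
  assumes "length xs = p + q + 1"
  shows "nr_comp scale p q f g xs = usum (\<lambda>_. 1) (\<lambda>u v. if length u = q + 1 then f (g u # v) else 0) xs"
proof -
  have xs: "map (\<lambda>_. 1 :: int) xs = replicate (q + 1 + p) 1"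
    using assms by (simp add: map_replicate_const add.commute)
  have "nr_comp scale p q f g xs = (\<Sum>\<sigma>\<in>shuffles_perm (q + 1) p. koszul_sign \<sigma> (map (\<lambda>_. 1) xs) *s
     f (g (take (q + 1) (permute_list \<sigma> xs)) # drop (q + 1) (permute_list \<sigma> xs)))"
    unfolding nr_comp_def xs
    by (intro sum.cong refl arg_cong2[of _ _ _ _ scale] sign_eq_koszul_sign) (auto simp:
      shuffles_perm_def)
  also have "\<dots> = usum (\<lambda>_. 1) (\<lambda>u v. if length u = q + 1 then f (g u # v) else 0) xs"
    using assms by (intro sum_shuffles_perm[where B = "\<lambda>u v. f (g u # v)"]) simp
  finally show ?thesis .
qed

text \<open>A nonzero term forces the left block to have length \<open>q' + 1\<close> and the right
  one length \<open>p'\<close>, so the prescribed degrees can only be those of \<open>f\<close> and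
  \<open>g\<close>.\<close>

lemma nr_comp_H:
  assumes f: "f \<in> H p'" and g: "g \<in> H q'" and xs: "length xs = p + q + 1"
  shows "nr_comp scale p q f g xs = (if p = p' \<and> q = q' then nr_circ f g xs else 0)"
proof -
  have "(if length u = q + 1 then f (g u # v) else 0) = (if p = p' \<and> q = q' then f (g u # v) else 0)"
    if "mset u + mset v = mset xs" for u v
  proof -
    have "length u + length v = length xs" using arg_cong[OF that, of size] by simp
    moreover have "g u = 0 \<or> length u = q' + 1" using H_off[OF g] by blast
    moreover have "f (g u # v) = 0 \<or> length v = p'" using H_off[OF f, of "g u # v"] by auto
    ultimately show ?thesis using xs by (auto simp: H_Cons[OF f])
  qed
  then show ?thesis unfolding nr_comp_usum[OF xs] nr_circ_def by (subst usum_cong) auto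
qed

lemma nr_bracket_H:
  assumes f: "f \<in> H p" and g: "g \<in> H q"
  shows "nr_bracket scale f g = nr_circ f g - msign (int p * int q) (nr_circ g f)"
proof
  fix xs :: "'b list"
  let ?I = "{(p', q'). p' + q' + 1 = length xs}"
  let ?T = "nr_circ f g xs - msign (int p * int q) (nr_circ g f xs)"
  have fin: "finite ?I" by (rule finite_subset[of _ "{..length xs} \<times> {..length xs}"]) auto
  have sg: "(-1) ^ (p * q) *s x = msign (int p * int q) x" for x
    by (auto simp: msign_def)
  have "nr_bracket scale f g xs = (\<Sum>pq\<in>?I. if pq = (p, q) then ?T else 0)"
    unfolding nr_bracket_def
  proof (rule sum.cong)
    fix pq assume "pq \<in> ?I"
    then obtain p' q' where pq: "pq = (p', q')" "length xs = p' + q' + 1" "length xs = q' + p' + 1"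
      by auto
    show "(case pq of (p, q) \<Rightarrow> nr_comp (*s) p q f g xs - (-1) ^ (p * q) *s nr_comp (*s) q p g f xs)
        = (if pq = (p, q) then ?T else 0)"
      unfolding pq(1) prod.case nr_comp_H[OF f g pq(2)] nr_comp_H[OF g f pq(3)]
      by (cases "p' = p \<and> q' = q") (simp_all add: sg, auto)
  qed simp
  also have "\<dots> = (if (p, q) \<in> ?I then ?T else 0)" using fin by (simp add: sum.delta)
  \<comment> \<open>On lists of a length other than \<open>p + q + 1\<close> both compositions
    vanish, which removes the case distinction.\<close>
  also have "\<dots> = ?T"
    using H_off[OF nr_circ_mem[OF f g], of xs] H_off[OF nr_circ_mem[OF g f], of xs] by auto
  finally show "nr_bracket scale f g xs = (nr_circ f g - msign (int p * int q) (nr_circ g f)) xs"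
    by (simp add: msign_fun)
qed

lemma H_subspace: "f \<in> H p \<Longrightarrow> g \<in> H p \<Longrightarrow> f + g \<in> H p"
  "f \<in> H p \<Longrightarrow> g \<in> H p \<Longrightarrow> f - g \<in> H p" "f \<in> H p \<Longrightarrow> msign m f \<in> H p" "0 \<in> H p"
proof -
  interpret F: vector_space "fun_scale scale" by (rule vector_space_fun_scale[OF vector_space_axioms])
  note S = subspace_alt_hom[OF vector_space_axioms vector_space_axioms, of "p + 1"]
  show "f \<in> H p \<Longrightarrow> g \<in> H p \<Longrightarrow> f + g \<in> H p" "f \<in> H p \<Longrightarrow> g \<in> H p \<Longrightarrow> f - g \<in> H p"
    "f \<in> H p \<Longrightarrow> msign m f \<in> H p" "0 \<in> H p"
    using F.subspace_add[OF S] F.subspace_diff[OF S] F.subspace_neg[OF S] F.subspace_0[OF S]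
    by (auto simp: msign_def)
qed

lemma nr_bracket_mem:
  assumes f: "f \<in> H p" and g: "g \<in> H q"
  shows "nr_bracket scale f g \<in> H (p + q)"
  using nr_circ_mem[OF f g] nr_circ_mem[OF g f] unfolding nr_bracket_H[OF f g] add.commute[of q p]
  by (intro H_subspace)

text \<open>The commutator of a graded right pre-Lie product satisfies the Jacobi identity: after
  expansion the double compositions cancel directly and the associators cancel by their symmetry in
  the last two arguments. Only parities of the degrees remain to be checked.\<close>

lemma nr_bracket_jacobi:
  assumes f: "f \<in> H p" and g: "g \<in> H q" and h: "h \<in> H r"
  shows "nr_bracket scale f (nr_bracket scale g h) = nr_bracket scale (nr_bracket scale f g) h
    + msign (int p * int q) (nr_bracket scale g (nr_bracket scale f h))"
  unfolding nr_bracket_H[OF f g] nr_bracket_H[OF f h] nr_bracket_H[OF g h]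
    nr_bracket_H[OF f nr_bracket_mem[OF g h], unfolded nr_bracket_H[OF g h]]
    nr_bracket_H[OF nr_bracket_mem[OF f g] h, unfolded nr_bracket_H[OF f g]]
    nr_bracket_H[OF g nr_bracket_mem[OF f h], unfolded nr_bracket_H[OF f h]]
    nr_circ_left nr_circ_right[OF f] nr_circ_right[OF g] nr_circ_right[OF h]
    nr_circ_associator[OF f] nr_circ_associator[OF g] nr_circ_associator[OF h]
    insert_two_commute[OF f h g] insert_two_commute[OF g h f] insert_two_commute[OF h f g]
  by (cases "even p"; cases "even q"; cases "even r"; simp add: msign_def)

section \<open>The graded Lie algebra axioms\<close>

lemma hom_bar_cases:
  assumes "x \<in> hom_bar scale n"
  obtains "x = 0" "n < 0" | p where "n = int p" "x \<in> H p"
  using assms by (cases "n \<ge> 0") (auto simp: hom_bar_def elim: nonneg_int_cases)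

lemma hom_bar_int [simp]: "hom_bar scale (int p) = H p"
  by (simp add: hom_bar_def)

lemma nr_bracket_hom_bar: "f \<in> H p \<Longrightarrow> g \<in> H q \<Longrightarrow> nr_bracket scale f g \<in> hom_bar scale (int p + int q)"
  unfolding of_nat_add[symmetric] hom_bar_int by (rule nr_bracket_mem)

lemma zero_mem_hom_bar: "0 \<in> hom_bar scale n"
  by (simp add: hom_bar_def subspace_alt_hom H_subspace(4)[simplified])

text \<open>Bilinearity is required for inhomogeneous elements too. It is read off from the
  definition of the bracket once the outer map is linear in its first entry, without any
  decomposition into homogeneous components.\<close>

lemma nr_bracket_linear_aux:
  assumes "\<And>v. Vector_Spaces.linear scale scale (\<lambda>x. y (x # v))"
  shows "nr_bracket scale (x + x') y = nr_bracket scale x y + nr_bracket scale x' y"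
    "nr_bracket scale y (x + x') = nr_bracket scale y x + nr_bracket scale y x'"
    "nr_bracket scale (fun_scale scale c x) y = fun_scale scale c (nr_bracket scale x y)"
    "nr_bracket scale y (fun_scale scale c x) = fun_scale scale c (nr_bracket scale y x)"
proof -
  have y: "y ((a + b) # v) = y (a # v) + y (b # v)" "y ((c *s a) # v) = c *s y (a # v)" for a b c v
    using assms[of v] by (simp_all add: Vector_Spaces.linear_iff)
  have l: "nr_comp scale p q (x + x') z xs = nr_comp scale p q x z xs + nr_comp scale p q x' z xs"
    "nr_comp scale p q (fun_scale scale c x) z xs = c *s nr_comp scale p q x z xs" for p q x x' z xs c
    by (simp_all add: nr_comp_def fun_scale_def scale_right_distrib sum.distrib scale_sum_right
      scale_left_commute
        del: scale_scale)
  have r: "nr_comp scale p q y (x + x') xs = nr_comp scale p q y x xs + nr_comp scale p q y x' xs"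
    "nr_comp scale p q y (fun_scale scale c x) xs = c *s nr_comp scale p q y x xs" for p q x x' xs c
    by (simp_all add: nr_comp_def fun_scale_def y scale_right_distrib sum.distrib scale_sum_right
        scale_left_commute del: scale_scale)
  show "nr_bracket scale (x + x') y = nr_bracket scale x y + nr_bracket scale x' y"
    "nr_bracket scale y (x + x') = nr_bracket scale y x + nr_bracket scale y x'"
    by (simp_all add: fun_eq_iff nr_bracket_def l r scale_right_distrib case_prod_beta
        flip: sum.distrib) (simp_all add: algebra_simps)
  show "nr_bracket scale (fun_scale scale c x) y = fun_scale scale c (nr_bracket scale x y)"
    "nr_bracket scale y (fun_scale scale c x) = fun_scale scale c (nr_bracket scale y x)"
    by (simp_all add: fun_eq_iff nr_bracket_def l r scale_right_diff_distrib case_prod_beta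
        fun_scale_def[of _ _ "nr_bracket _ _ _"] scale_sum_right scale_left_commute del: scale_scale)
qed

lemma gtotal_hom_bar_linear:
  assumes "y \<in> gtotal (fun_scale scale) (hom_bar scale)"
  shows "Vector_Spaces.linear scale scale (\<lambda>x. y (x # v))"
proof -
  interpret F: vector_space "fun_scale scale" by (rule vector_space_fun_scale[OF vector_space_axioms])
  let ?W = "{f. \<forall>v. Vector_Spaces.linear scale scale (\<lambda>x. f (x # v))}"
  have "F.subspace ?W"
    by (auto simp: F.subspace_def Vector_Spaces.linear_iff vector_space_axioms fun_scale_def
      scale_right_distrib
        scale_left_commute simp del: scale_scale)
  moreover have "hom_bar scale n \<subseteq> ?W" for n
  proof
    fix x assume "x \<in> hom_bar scale n"
    then show "x \<in> ?W"
      by (cases rule: hom_bar_cases) (auto simp: Vector_Spaces.linear_iff vector_space_axioms H_Cons)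
  qed
  ultimately have "gtotal (fun_scale scale) (hom_bar scale) \<subseteq> ?W"
    unfolding gtotal_def by (intro F.span_minimal) auto
  then show ?thesis using assms by blast
qed

lemma nr_bracket_zero:
  assumes "y \<in> gtotal (fun_scale scale) (hom_bar scale)"
  shows "nr_bracket scale 0 y = 0" "nr_bracket scale y 0 = 0"
  using nr_bracket_linear_aux(1,2)[OF gtotal_hom_bar_linear[OF assms], of 0 0] by simp_all

lemma graded_lie_algebra_nr:
  "graded_lie_algebra (fun_scale scale) (hom_bar scale) (nr_bracket scale)"
proof -
  interpret F: vector_space "fun_scale scale" by (rule vector_space_fun_scale[OF vector_space_axioms])
  let ?L = "hom_bar scale"
  have tot: "x \<in> gtotal (fun_scale scale) ?L" if "x \<in> ?L n" for x n
    using that by (auto simp: gtotal_def intro!: F.span_base)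
  note z = nr_bracket_zero[OF tot]
  show ?thesis
  proof
    show "F.subspace (?L n)" for n
      using subspace_alt_hom[OF vector_space_axioms vector_space_axioms]
      by (auto simp: hom_bar_def F.subspace_0 F.subspace_single_0)
  next
    fix I n and x :: "int \<Rightarrow> _"
    assume I: "finite I" "\<And>n. n \<in> I \<Longrightarrow> x n \<in> ?L n" "(\<Sum>n\<in>I. x n) = 0" and n: "n \<in> I"
    have off: "x m xs = 0" if "m \<in> I" "int (length xs) \<noteq> m + 1" for m xs
      using I(2)[OF that(1)] that(2) by (cases rule: hom_bar_cases) (auto intro: H_off)
    show "x n = 0"
    proof
      fix xs
      show "x n xs = 0 xs"
      proof (cases "int (length xs) = n + 1")
        case True
        \<comment> \<open>A list of length \<open>n + 1\<close> detects only the component of degree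
          \<open>n\<close>.\<close>
        have "0 = (\<Sum>m\<in>I. x m xs)" using fun_cong[OF I(3), of xs] by (simp add: sum_apply_fun)
        also have "\<dots> = (\<Sum>m\<in>I. if m = n then x n xs else 0)"
          using off True by (intro sum.cong) auto
        also have "\<dots> = x n xs" using I(1) n by simp
        finally show ?thesis by simp
      qed (use off[OF n] in simp)
    qed
  next
    fix y assume y: "y \<in> gtotal (fun_scale scale) ?L"
    show "linear_on_set (fun_scale scale) (fun_scale scale) (gtotal (fun_scale scale) ?L) (\<lambda>x.
      nr_bracket scale x y)"
      "linear_on_set (fun_scale scale) (fun_scale scale) (gtotal (fun_scale scale) ?L) (nr_bracket
        scale y)"
      using nr_bracket_linear_aux[OF gtotal_hom_bar_linear[OF y]] by (simp_all add: linear_on_set_def)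
  next
    fix x y m n assume x: "x \<in> ?L m" and y: "y \<in> ?L n"
    show "nr_bracket scale x y \<in> ?L (m + n)"
      using x
    proof (cases rule: hom_bar_cases)
      case 1
      then show ?thesis using z[OF y] by (simp add: zero_mem_hom_bar)
    next
      case (2 p)
      note p = this
      show ?thesis using y
      proof (cases rule: hom_bar_cases)
        case 1
        then show ?thesis using z[OF x] by (simp add: zero_mem_hom_bar)
      next
        case (2 q)
        then show ?thesis using nr_bracket_hom_bar[OF p(2) 2(2)] p by simp
      qed
    qed
    show "nr_bracket scale x y = - fun_scale scale ((-1) powi (m * n)) (nr_bracket scale y x)"
      using x
    proof (cases rule: hom_bar_cases)
      case 1
      then show ?thesis using z[OF y] by simp
    next
      case (2 p)
      note p = this
      show ?thesis using y
      proof (cases rule: hom_bar_cases)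
        case 1
        then show ?thesis using z[OF x] by simp
      next
        case (2 q)
        then show ?thesis
          using nr_bracket_H[OF p(2) 2(2)] nr_bracket_H[OF 2(2) p(2)] p
          by (simp only: F.scale_msign) (simp add: msign_def mult.commute)
      qed
    qed
  next
    fix x y w m n r assume x: "x \<in> ?L m" and y: "y \<in> ?L n" and w: "w \<in> ?L r"
    have tot2: "nr_bracket scale x y \<in> gtotal (fun_scale scale) ?L"
       if "x \<in> H p" "y \<in> H q" for x y p q
      using nr_bracket_hom_bar[OF that] by (rule tot)
    note z' = nr_bracket_zero[OF tot2]
    show "nr_bracket scale x (nr_bracket scale y w) = nr_bracket scale (nr_bracket scale x y) w +
      fun_scale scale ((-1) powi (m * n)) (nr_bracket scale y (nr_bracket scale x w))"
      using x
    proof (cases rule: hom_bar_cases)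
      case 1
      show ?thesis using y w by (cases rule: hom_bar_cases; cases rule: hom_bar_cases[OF w])
          (use 1 z[OF y] z[OF w] z' in auto)
    next
      case (2 p)
      note p = this
      show ?thesis using y
      proof (cases rule: hom_bar_cases)
        case 1
        show ?thesis using w by (cases rule: hom_bar_cases) (use 1 p z[OF x] z[OF w] z' in auto)
      next
        case (2 q)
        note q = this
        show ?thesis using w
        proof (cases rule: hom_bar_cases)
          case 1
          then show ?thesis using z[OF x] z[OF y] z'[OF p(2) q(2)] by simp
        next
          case (2 r)
          then show ?thesis using nr_bracket_jacobi[OF p(2) q(2) 2(2)] p q
            by (simp only: F.scale_msign)
        qed
      qed
    qed
  qed
qed

end

section \<open>Derived brackets\<close>

text \<open>The setting with inclusions as injections and \<Delta> = 0. \<open>M_kernel\<close>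
  makes the unary operation vanish. \<open>even_part\<close> is a linear operator that recognises
  the parity of homogeneous elements, so that signs can be extended linearly to inhomogeneous
  ones.\<close>

locale strict_V_datum = graded_lie_algebra s L br
  for s :: "'k::field \<Rightarrow> 'v::ab_group_add \<Rightarrow> 'v" and L :: "int \<Rightarrow> 'v set" and br +
  fixes M A :: "int \<Rightarrow> 'v set" and P even_part :: "'v \<Rightarrow> 'v" and lam :: 'k
  assumes M_sub: "graded_lie_subalgebra s L br M"
    and A_sub: "graded_lie_subalgebra s L br A"
    and A_abelian: "\<And>a b m n. a \<in> A m \<Longrightarrow> b \<in> A n \<Longrightarrow> br a b = 0"
    and P_linear: "graded_linear s L s A P"
    and P_retraction: "\<And>a n. a \<in> A n \<Longrightarrow> P a = a"
    and P_kernel: "graded_lie_subalgebra s L br (\<lambda>n. {x \<in> L n. P x = 0})"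
    and M_kernel: "\<And>x n. x \<in> M n \<Longrightarrow> P x = 0"
    and even_part_linear: "linear_on_set s s (gtotal s L) even_part"
    and even_part: "\<And>x n. x \<in> L n \<Longrightarrow> even_part x = (if even n then x else 0)"
begin

section \<open>Bracket, projection and even part on the total space\<close>

abbreviation tot :: "'v set" where "tot \<equiv> gtotal s L"

lemma subspace_tot: "subspace tot"
  unfolding gtotal_def by (rule subspace_span)

lemma tot_closed:
  "x \<in> tot \<Longrightarrow> y \<in> tot \<Longrightarrow> x + y \<in> tot" "x \<in> tot \<Longrightarrow> y \<in> tot \<Longrightarrow> x - y \<in> tot"
  "x \<in> tot \<Longrightarrow> - x \<in> tot" "0 \<in> tot" "x \<in> tot \<Longrightarrow> s c x \<in> tot" "x \<in> tot \<Longrightarrow> msign m x \<in> tot"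
  using subspace_tot by (auto simp: subspace_add subspace_diff subspace_neg subspace_0
    subspace_scale msign_def)

lemma tot_subset: "subspace S \<Longrightarrow> (\<And>n. L n \<subseteq> S) \<Longrightarrow> tot \<subseteq> S"
  unfolding gtotal_def by (rule span_minimal) auto

lemma L_tot: "x \<in> L n \<Longrightarrow> x \<in> tot"
  by (auto simp: gtotal_def intro!: span_base)

lemma M_L: "x \<in> M n \<Longrightarrow> x \<in> L n" and A_L: "x \<in> A n \<Longrightarrow> x \<in> L n"
  using M_sub A_sub by (auto simp: graded_lie_subalgebra_def)

lemma M_br: "x \<in> M m \<Longrightarrow> y \<in> M n \<Longrightarrow> br x y \<in> M (m + n)"
  using M_sub by (auto simp: graded_lie_subalgebra_def)

lemma subspace_M: "subspace (M n)" and subspace_A: "subspace (A n)"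
  using M_sub A_sub by (auto simp: graded_lie_subalgebra_def)

lemma br_linear:
  assumes "x \<in> tot" "y \<in> tot" "z \<in> tot"
  shows "br (x + y) z = br x z + br y z" "br z (x + y) = br z x + br z y"
    "br (s c x) z = s c (br x z)" "br z (s c x) = s c (br z x)"
  using linear_left[OF assms(3)] linear_right[OF assms(3)] assms(1,2) by (auto simp: linear_on_set_def)

lemma br_zero: "z \<in> tot \<Longrightarrow> br 0 z = 0" "z \<in> tot \<Longrightarrow> br z 0 = 0"
  using br_linear(1,2)[of 0 0 z] by (simp_all add: tot_closed)

lemma br_msign:
  assumes "x \<in> tot" "y \<in> tot"
  shows "br (msign m x) y = msign m (br x y)" "br x (msign m y) = msign m (br x y)"
proof -
  have "br (- x) y = - br x y" "br x (- y) = - br x y"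
    using br_linear(3)[of x x y "-1"] br_linear(4)[of y y x "-1"] assms by simp_all
  then show "br (msign m x) y = msign m (br x y)" "br x (msign m y) = msign m (br x y)"
    by (simp_all add: msign_def)
qed

lemma br_tot:
  assumes "x \<in> tot" "y \<in> tot"
  shows "br x y \<in> tot"
proof -
  have 1: "br x y \<in> tot" if y: "y \<in> L n" and x: "x \<in> tot" for x y n
  proof -
    have "subspace {x \<in> tot. br x y \<in> tot}"
      using L_tot[OF y] by (auto simp: subspace_def tot_closed br_linear br_zero)
    then have "tot \<subseteq> {x \<in> tot. br x y \<in> tot}"
      by (rule tot_subset) (use bracket_degree[OF _ y] L_tot in auto)
    then show ?thesis using x by blast
  qed
  have "subspace {y \<in> tot. br x y \<in> tot}"
    using assms(1) by (auto simp: subspace_def tot_closed br_linear br_zero)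
  then have "tot \<subseteq> {y \<in> tot. br x y \<in> tot}"
    by (rule tot_subset) (use 1 assms(1) L_tot in auto)
  then show ?thesis using assms(2) by blast
qed

lemma P_simps:
  "x \<in> tot \<Longrightarrow> y \<in> tot \<Longrightarrow> P (x + y) = P x + P y" "x \<in> tot \<Longrightarrow> P (s c x) = s c (P x)"
  "x \<in> L n \<Longrightarrow> P x \<in> A n"
  using P_linear unfolding graded_linear_def linear_on_set_def by blast+

lemma P_msign: "x \<in> tot \<Longrightarrow> P (msign m x) = msign m (P x)"
  using P_simps(2)[of x "-1"] by (auto simp: msign_def)

lemma P_zero: "P 0 = 0"
  using P_simps(1)[of 0 0] by (simp add: tot_closed)

lemma P_tot:
  assumes "x \<in> tot" shows "P x \<in> tot"
proof -
  have "subspace {x \<in> tot. P x \<in> tot}"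
    by (auto simp: subspace_def tot_closed P_simps P_zero)
  then have "tot \<subseteq> {x \<in> tot. P x \<in> tot}"
    by (rule tot_subset) (use L_tot L_tot[OF A_L[OF P_simps(3)]] in auto)
  then show ?thesis using assms by blast
qed

lemma even_part_simps:
  "x \<in> tot \<Longrightarrow> y \<in> tot \<Longrightarrow> even_part (x + y) = even_part x + even_part y" "x \<in> tot \<Longrightarrow> even_part (s c x) =
    s c (even_part x)"
  using even_part_linear by (auto simp: linear_on_set_def)

lemma even_part_tot:
  assumes "x \<in> tot" shows "even_part x \<in> tot"
proof -
  have "even_part 0 = 0" using even_part_simps(1)[of 0 0] by (simp add: tot_closed)
  then have "subspace {x \<in> tot. even_part x \<in> tot}"
    by (auto simp: subspace_def tot_closed even_part_simps)
  then have "tot \<subseteq> {x \<in> tot. even_part x \<in> tot}"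
    by (rule tot_subset) (use even_part L_tot tot_closed(4) in auto)
  then show ?thesis using assms by blast
qed

text \<open>The elements \<open>x - P x\<close> and \<open>y - P y\<close> lie in the kernel of
  \<open>P\<close>, hence so does their bracket; in its expansion \<open>br (P x) (P y)\<close>
  vanishes because \<open>A\<close> is abelian.\<close>

lemma P_br:
  assumes "x \<in> L m" "y \<in> L n"
  shows "P (br x y) = P (br (P x) y) + P (br x (P y))"
proof -
  have Px: "P x \<in> A m" "P x \<in> L m" "P y \<in> A n" "P y \<in> L n" using assms P_simps(3) A_L by blast+
  note t = L_tot[OF assms(1)] L_tot[OF assms(2)] L_tot[OF Px(2)] L_tot[OF Px(4)]
  \<comment> \<open>The difference is written with the scalar -1 so that additivity and homogeneity
    of the bracket suffice for the expansion.\<close>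
  define x' where "x' = x + s (-1) (P x)"
  define y' where "y' = y + s (-1) (P y)"
  have "x' \<in> L m" "y' \<in> L n"
    using assms Px subspace_component by (auto simp: x'_def y'_def intro: subspace_diff)
  moreover have "P x' = 0" "P y' = 0"
    using t Px unfolding x'_def y'_def by (simp_all add: P_simps(1,2) tot_closed P_retraction del:
      scale_minus_left scale_one)
      (simp_all)
  ultimately have "P (br x' y') = 0" using P_kernel by (auto simp: graded_lie_subalgebra_def)
  moreover have "br x' y' = (br x y + s (-1) (br (P x) y)) + s (-1) (br x (P y) + s (-1) (br (P x)
    (P y)))"
    unfolding x'_def y'_def using t by (simp only: br_linear tot_closed br_tot)
  moreover have "br (P x) (P y) = 0" using A_abelian Px by blast
  ultimately have "P (br x y) + s (-1) (P (br (P x) y)) + s (-1) (P (br x (P y))) = 0"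
    using t by (simp add: P_simps(1,2) tot_closed br_tot del: scale_minus_left scale_one)
  then show ?thesis by (simp add: algebra_simps)
qed

section \<open>The operations on arbitrary elements\<close>

definition odd_part :: "'v \<Rightarrow> 'v" where "odd_part x = x - even_part x"
definition parity_op :: "'v \<Rightarrow> 'v" where "parity_op x = even_part x - odd_part x"

lemma parity_op: "x \<in> L n \<Longrightarrow> parity_op x = msign n x"
  by (simp add: parity_op_def odd_part_def even_part msign_def)

text \<open>The Koszul sign for moving \<open>f\<close> to the front is \<open>1\<close> if \<open>f\<close> is odd (then \<open>sf\<close> is even) and the
  parity of the arguments to its left otherwise; splitting \<open>f\<close> into its even and odd part extends
  this sign to inhomogeneous elements.\<close>

definition higher_term :: "('v \<times> 'v) list \<Rightarrow> nat \<Rightarrow> 'v" where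
  "higher_term xs i =
     P (foldl br (odd_part (fst (xs ! i))) (map snd (take i xs) @ map snd (drop (Suc i) xs)) +
        foldl br (even_part (fst (xs ! i))) (map (\<lambda>x. parity_op (snd x)) (take i xs) @ map snd (drop
          (Suc i) xs)))"

text \<open>\<open>parity_op\<close> realises the sign (-1)^|f| linearly. Summing over the position
  of the argument taken from \<open>M\<close> builds in graded symmetry. For \<open>n = 1\<close>
  the exponent truncates to 0, harmlessly, because \<open>P\<close> vanishes on
  \<open>M\<close>.\<close>

definition higher_br :: "nat \<Rightarrow> ('v \<times> 'v) list \<Rightarrow> 'v \<times> 'v" where
  "higher_br n xs = (if n = 2 then br (parity_op (fst (xs ! 0))) (fst (xs ! 1)) else 0,
     s (lam ^ (n - 2)) (\<Sum>i<n. higher_term xs i))"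

lemma foldl_br_tot: "f \<in> tot \<Longrightarrow> set v \<subseteq> tot \<Longrightarrow> foldl br f v \<in> tot"
  by (induction v arbitrary: f) (auto simp: br_tot)

text \<open>Preservation of \<open>tot\<close> belongs to the notion because brackets and
  \<open>P\<close> are known to be linear only there, and such maps are to be composed.\<close>

definition tot_linear :: "('v \<times> 'v \<Rightarrow> 'v) \<Rightarrow> bool" where
  "tot_linear \<phi> \<longleftrightarrow> \<phi> ` (tot \<times> tot) \<subseteq> tot \<and> linear_on_set (module_prod.scale s s) s (tot \<times> tot) \<phi>"

sublocale prod: vector_space_prod s s by unfold_locales

lemma tot_linear_iff: "tot_linear \<phi> \<longleftrightarrow> (\<forall>x\<in>tot. \<forall>y\<in>tot. \<phi> (x, y) \<in> tot \<and>
   (\<forall>x'\<in>tot. \<forall>y'\<in>tot. \<phi> (x + x', y + y') = \<phi> (x, y) + \<phi> (x', y')) \<and> (\<forall>c. \<phi> (s c x, s c y) = s c (\<phi>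
     (x, y))))"
  by (auto simp: tot_linear_def linear_on_set_def prod.scale_def)

lemma tot_linear_fst: "tot_linear fst" and tot_linear_snd: "tot_linear snd" and tot_linear_zero:
  "tot_linear (\<lambda>x. 0)"
  by (auto simp: tot_linear_iff tot_closed)

lemma tot_linear_add: "tot_linear \<phi> \<Longrightarrow> tot_linear \<psi> \<Longrightarrow> tot_linear (\<lambda>x. \<phi> x + \<psi> x)"
  by (auto simp: tot_linear_iff tot_closed scale_right_distrib)

lemma tot_linear_diff: "tot_linear \<phi> \<Longrightarrow> tot_linear \<psi> \<Longrightarrow> tot_linear (\<lambda>x. \<phi> x - \<psi> x)"
  by (auto simp: tot_linear_iff tot_closed scale_right_diff_distrib)

lemma tot_linear_scale: "tot_linear \<phi> \<Longrightarrow> tot_linear (\<lambda>x. s c (\<phi> x))"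
  by (auto simp: tot_linear_iff tot_closed scale_right_distrib mult.commute)

lemma tot_linear_sum: "(\<And>i. i \<in> I \<Longrightarrow> tot_linear (\<phi> i)) \<Longrightarrow> tot_linear (\<lambda>x. \<Sum>i\<in>I. \<phi> i x)"
  by (induction I rule: infinite_finite_induct) (auto simp: tot_linear_zero tot_linear_add)

lemma tot_linear_P: "tot_linear \<phi> \<Longrightarrow> tot_linear (\<lambda>x. P (\<phi> x))"
  by (auto simp: tot_linear_iff P_tot P_simps)

lemma tot_linear_even_part: "tot_linear \<phi> \<Longrightarrow> tot_linear (\<lambda>x. even_part (\<phi> x))"
  by (auto simp: tot_linear_iff even_part_tot even_part_simps)

lemma tot_linear_odd_part: "tot_linear \<phi> \<Longrightarrow> tot_linear (\<lambda>x. odd_part (\<phi> x))" and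
  tot_linear_parity_op: "tot_linear \<phi> \<Longrightarrow> tot_linear (\<lambda>x. parity_op (\<phi> x))"
  unfolding parity_op_def odd_part_def by (intro tot_linear_diff tot_linear_even_part; assumption)+

lemma tot_linear_br: "tot_linear \<phi> \<Longrightarrow> c \<in> tot \<Longrightarrow> tot_linear (\<lambda>x. br (\<phi> x) c)" "tot_linear \<phi> \<Longrightarrow> c \<in> tot
  \<Longrightarrow> tot_linear (\<lambda>x. br c (\<phi> x))"
  by (auto simp: tot_linear_iff br_tot br_linear)

lemma tot_linear_foldl_br: "tot_linear \<phi> \<Longrightarrow> set v \<subseteq> tot \<Longrightarrow> tot_linear (\<lambda>x. foldl br (\<phi> x) v)"
  by (induction v arbitrary: \<phi>) (auto simp: tot_linear_br)

lemma tot_linear_foldl_br_arg: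
  "tot_linear \<phi> \<Longrightarrow> c \<in> tot \<Longrightarrow> set a \<subseteq> tot \<Longrightarrow> set b \<subseteq> tot \<Longrightarrow> tot_linear (\<lambda>x. foldl br c (a @ \<phi> x # b))"
  by (simp add: tot_linear_foldl_br tot_linear_br foldl_br_tot)

lemma parity_op_odp_tot: "x \<in> tot \<Longrightarrow> parity_op x \<in> tot" "x \<in> tot \<Longrightarrow> odd_part x \<in> tot"
  by (simp_all add: parity_op_def odd_part_def tot_closed even_part_tot)

text \<open>The \<open>i\<close>-th term uses the entry at position \<open>j\<close> only through
  its component in \<open>M\<close> if \<open>i = j\<close>, and only through its component in
  \<open>A\<close> otherwise; hence it is linear in every entry.\<close>

lemma tot_linear_higher_term:
  assumes xs: "set xs \<subseteq> tot \<times> tot" and i: "i < length xs" and j: "j < length xs"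
  shows "tot_linear (\<lambda>x. higher_term (xs[j := x]) i)"
proof -
  have mem: "fst x \<in> tot" "snd x \<in> tot" if "x \<in> set xs" for x using that xs by auto
  note sub = mem in_set_takeD in_set_dropD nth_mem parity_op_odp_tot even_part_tot
  consider "i = j" | "j < i" | "i < j" by linarith
  then show ?thesis
  proof cases
    case 1
    have "tot_linear (\<lambda>x. P (foldl br (odd_part (fst x)) (map snd (take i xs) @ map snd (drop (Suc
      i) xs)) +
        foldl br (even_part (fst x)) (map (\<lambda>x. parity_op (snd x)) (take i xs) @ map snd (drop (Suc
          i) xs))))"
      by (intro tot_linear_P tot_linear_add tot_linear_foldl_br tot_linear_odd_part
        tot_linear_even_part tot_linear_fst) (auto dest: sub intro: sub)
    then show ?thesis using 1 i by (simp add: higher_term_def)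
  next
    case 2
    have t: "take i (xs[j := x]) = take j xs @ x # drop (Suc j) (take i xs)" for x
      using 2 i unfolding take_update_swap by (subst upd_conv_take_nth_drop) (auto simp: min_def)
    have "tot_linear (\<lambda>x. P (foldl br (odd_part (fst (xs ! i))) (map snd (take j xs) @ snd x # (map
      snd (drop (Suc j) (take i xs)) @ map snd (drop (Suc i) xs))) +
        foldl br (even_part (fst (xs ! i))) (map (\<lambda>x. parity_op (snd x)) (take j xs) @ parity_op
          (snd x) # (map (\<lambda>x. parity_op (snd x)) (drop (Suc j) (take i xs)) @ map snd (drop (Suc i)
          xs)))))"
      by (intro tot_linear_P tot_linear_add tot_linear_foldl_br_arg tot_linear_parity_op
        tot_linear_snd) (use i in \<open>auto dest: sub intro: sub\<close>)
    then show ?thesis using 2 i by (simp add: higher_term_def t)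
  next
    case 3
    define r where "r = drop (Suc i) xs"
    define k where "k = j - Suc i"
    have t: "drop (Suc i) (xs[j := x]) = take k r @ x # drop (Suc k) r" for x
      using 3 j by (simp add: drop_update_swap upd_conv_take_nth_drop r_def k_def drop_take)
    have r: "x \<in> set xs" if "x \<in> set r" for x using that by (auto simp: r_def dest: in_set_dropD)
    have "tot_linear (\<lambda>x. P (foldl br (odd_part (fst (xs ! i))) ((map snd (take i xs) @ map snd
      (take k r)) @ snd x # map snd (drop (Suc k) r)) +
        foldl br (even_part (fst (xs ! i))) ((map (\<lambda>x. parity_op (snd x)) (take i xs) @ map snd
          (take k r)) @ snd x # map snd (drop (Suc k) r))))"
      by (intro tot_linear_P tot_linear_add tot_linear_foldl_br_arg tot_linear_snd) (use i in \<open>auto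
        dest: sub r intro: sub\<close>)
    then show ?thesis using 3 i by (simp add: higher_term_def t)
  qed
qed

lemma higher_br_multilinear:
  assumes xs: "set xs \<subseteq> tot \<times> tot" and n: "length xs = n" and j: "j < n"
  shows "linear_on_set (module_prod.scale s s) (module_prod.scale s s) (tot \<times> tot) (\<lambda>x. higher_br n
    (xs[j := x]))"
proof -
  have 1: "tot_linear (\<lambda>x. if n = 2 then br (parity_op (fst (xs[j := x] ! 0))) (fst (xs[j := x] !
    1)) else 0)"
  proof (cases "n = 2")
    case True
    then have "xs ! 0 \<in> set xs" "xs ! 1 \<in> set xs" using n by (auto intro: nth_mem)
    then have "fst (xs ! 0) \<in> tot" "fst (xs ! 1) \<in> tot" using xs by auto
    then show ?thesis using True n j
      by (cases j) (auto simp: less_Suc_eq intro!: tot_linear_br tot_linear_parity_op tot_linear_fst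
        parity_op_odp_tot)
  qed (simp add: tot_linear_zero)
  have 2: "tot_linear (\<lambda>x. s (lam ^ (n - 2)) (\<Sum>i<n. higher_term (xs[j := x]) i))"
    using xs n j by (intro tot_linear_scale tot_linear_sum tot_linear_higher_term) auto
  show ?thesis
    using 1 2 unfolding higher_br_def tot_linear_def linear_on_set_def
    by (auto simp: prod.scale_def)
qed

text \<open>Pairs \<open>((f, \<xi>), d)\<close> with \<open>(f, \<xi>)\<close> of degree \<open>d\<close> in \<open>sM \<oplus> A\<close>; carrying the degree along
  makes the Koszul sign a function of the list.\<close>

definition tagged :: "(('v \<times> 'v) \<times> int) set" where
  "tagged = {((f, \<xi>), d) | f \<xi> d. f \<in> M (d + 1) \<and> \<xi> \<in> A d}"

abbreviation M_of :: "('v \<times> 'v) \<times> int \<Rightarrow> 'v" where "M_of z \<equiv> fst (fst z)"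
abbreviation A_of :: "('v \<times> 'v) \<times> int \<Rightarrow> 'v" where "A_of z \<equiv> snd (fst z)"

section \<open>Iterated brackets with elements of A\<close>

definition iter :: "'v \<Rightarrow> (('v \<times> 'v) \<times> int) list \<Rightarrow> 'v" where
  "iter f v = foldl br f (map A_of v)"

lemma iter_simps [simp]: "iter f [] = f" "iter f (z # v) = iter (br f (A_of z)) v" "iter f (v @ w) =
  iter (iter f v) w"
  by (simp_all add: iter_def)

lemma tagged_D:
  assumes "z \<in> tagged"
  shows "M_of z \<in> M (snd z + 1)" "M_of z \<in> L (snd z + 1)" "M_of z \<in> tot"
    "A_of z \<in> A (snd z)" "A_of z \<in> L (snd z)" "A_of z \<in> tot"
  using assms by (auto simp: tagged_def intro: M_L A_L L_tot[OF M_L] L_tot[OF A_L])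

lemma iter_L: "f \<in> L n \<Longrightarrow> set v \<subseteq> tagged \<Longrightarrow> iter f v \<in> L (n + degs snd v)"
proof (induction v arbitrary: f n)
  case (Cons z v)
  have "br f (A_of z) \<in> L (n + snd z)" using Cons.prems tagged_D(5) by (intro bracket_degree) auto
  then show ?case using Cons.IH[of "br f (A_of z)" "n + snd z"] Cons.prems by (simp add: add.assoc)
qed simp

lemma iter_linear:
  assumes "set v \<subseteq> tagged"
  shows "f \<in> tot \<Longrightarrow> iter f v \<in> tot" "f \<in> tot \<Longrightarrow> g \<in> tot \<Longrightarrow> iter (f + g) v = iter f v + iter g v"
    "f \<in> tot \<Longrightarrow> iter (s c f) v = s c (iter f v)" "f \<in> tot \<Longrightarrow> iter (msign m f) v = msign m (iter f v)"
      "iter 0 v = 0"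
  using assms
  by (induction v arbitrary: f g) (auto simp: br_linear br_msign br_tot br_zero tagged_D)

lemma jacobi_msign:
  "x \<in> L m \<Longrightarrow> y \<in> L n \<Longrightarrow> z \<in> L r \<Longrightarrow> br x (br y z) = br (br x y) z + msign (m * n) (br y (br x z))"
  using jacobi[of x m y n z r] by (simp only: scale_msign)

lemma antisym_msign: "x \<in> L m \<Longrightarrow> y \<in> L n \<Longrightarrow> br x y = - msign (m * n) (br y x)"
  using antisymmetry[of x m y n] by (simp only: scale_msign)

text \<open>The Jacobi identity, read as the graded derivation property of bracketing on the right
  with \<open>z\<close>; antisymmetry brings \<open>br y (br x z)\<close> into left-nested
  form.\<close>

lemma br_leibniz:
  assumes x: "x \<in> L m" and y: "y \<in> L n" and z: "z \<in> L r"
  shows "br (br x y) z = br x (br y z) + msign (n * r) (br (br x z) y)"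
proof -
  have "br y (br x z) = - msign (n * (m + r)) (br (br x z) y)"
    using bracket_degree[OF x z] by (rule antisym_msign[OF y])
  then show ?thesis using jacobi_msign[OF x y z] by (simp add: msign_def split: if_splits)
qed

text \<open>Bracketing with \<open>b\<close> is a derivation and \<open>br a b = 0\<close>, so
  brackets with elements of \<open>A\<close> commute up to the Koszul sign.\<close>

lemma br_swap:
  assumes x: "x \<in> L m" and a: "a \<in> A d" and b: "b \<in> A e"
  shows "br (br x a) b = msign (d * e) (br (br x b) a)"
  using br_leibniz[OF x A_L[OF a] A_L[OF b]] A_abelian[OF a b] br_zero L_tot[OF x] by simp

text \<open>Iterating the derivation property distributes the entries of \<open>v\<close> over
  \<open>f\<close> and \<open>g\<close>; those that act on \<open>f\<close> have to pass
  \<open>g\<close>, which has degree \<open>n\<close>.\<close>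

lemma iter_br:
  assumes "f \<in> L m" "g \<in> L n" "set v \<subseteq> tagged"
  shows "iter (br f g) v = usum snd (\<lambda>a b. msign (n * degs snd a) (br (iter f a) (iter g b))) v"
  using assms
proof (induction v arbitrary: f g m n)
  case (Cons z v)
  note f = Cons.prems(1) and g = Cons.prems(2)
  from Cons.prems have z: "A_of z \<in> L (snd z)" and v: "set v \<subseteq> tagged" by (auto simp: tagged_D)
  note fz = bracket_degree[OF f z] and gz = bracket_degree[OF g z]
  note t = L_tot[OF bracket_degree[OF f gz]] L_tot[OF bracket_degree[OF fz g]]
  have "iter (br f g) (z # v) = iter (br f (br g (A_of z))) v + msign (n * snd z) (iter (br (br f
    (A_of z)) g) v)"
    using t by (simp add: br_leibniz[OF f g z] iter_linear[OF v] tot_closed)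
  also have "iter (br f (br g (A_of z))) v =
      usum snd (\<lambda>a b. msign (snd z * degs snd a) (msign (n * degs snd a) (br (iter f a) (iter g (z #
        b))))) v"
    by (simp add: Cons.IH[OF f gz v] msign_msign algebra_simps)
  also have "msign (n * snd z) (iter (br (br f (A_of z)) g) v) =
      usum snd (\<lambda>a b. msign (n * degs snd (z # a)) (br (iter f (z # a)) (iter g b))) v"
    by (simp add: Cons.IH[OF fz g v] msign_msign msign_usum algebra_simps)
  finally show ?case by (simp add: add.commute)
qed simp

text \<open>Repeated use of \<open>br_swap\<close> moves \<open>\<alpha>\<close> behind all entries
  of \<open>v\<close>.\<close>

lemma iter_br_A:
  assumes "g \<in> L n" "\<alpha> \<in> A e" "set v \<subseteq> tagged"
  shows "iter (br g \<alpha>) v = msign (e * degs snd v) (br (iter g v) \<alpha>)"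
  using assms
proof (induction v arbitrary: g n)
  case (Cons z v)
  from Cons.prems have z: "A_of z \<in> A (snd z)" "A_of z \<in> L (snd z)" and v: "set v \<subseteq> tagged" by (auto
    simp: tagged_D)
  note gz = bracket_degree[OF Cons.prems(1) z(2)]
  have "iter (br g \<alpha>) (z # v) = msign (e * snd z) (iter (br (br g (A_of z)) \<alpha>) v)"
    using br_swap[OF Cons.prems(1,2) z(1)] L_tot[OF bracket_degree[OF gz A_L[OF Cons.prems(2)]]]
    by (simp add: iter_linear[OF v])
  also have "iter (br (br g (A_of z)) \<alpha>) v = msign (e * degs snd v) (br (iter g (z # v)) \<alpha>)"
    using Cons.IH[OF gz Cons.prems(2) v] by simp
  finally show ?case by (simp add: msign_msign algebra_simps)
qed simp

lemma gsymmetric_iter: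
  assumes "f \<in> L n"
  shows "gsymmetric snd tagged (iter f)"
proof (rule gsymmetricI)
  fix a x y b assume a: "set a \<subseteq> tagged" and x: "x \<in> tagged" and y: "y \<in> tagged" and b: "set b \<subseteq> tagged"
  note h = iter_L[OF assms a]
  have "br (br (iter f a) (A_of y)) (A_of x) \<in> tot" by (intro br_tot L_tot[OF h] tagged_D(6) x y)
  then show "iter f (a @ x # y # b) = msign (snd x * snd y) (iter f (a @ y # x # b))"
    using br_swap[OF h tagged_D(4)[OF x] tagged_D(4)[OF y]] by (simp add: iter_linear[OF b])
qed

section \<open>The operations on homogeneous elements\<close>

definition higher_sum :: "(('v \<times> 'v) \<times> int) list \<Rightarrow> 'v" where
  "higher_sum = usum snd (\<lambda>u v. if length u = 1 then P (iter (M_of (hd u)) v) else 0)"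

text \<open>An entry sf carries the tag |f| - 1, hence the \<open>+ 1\<close> in the exponent of
  (-1)^|f|.\<close>

definition binary_br :: "(('v \<times> 'v) \<times> int) list \<Rightarrow> 'v" where
  "binary_br zs = (if length zs = 2 then msign (snd (zs ! 0) + 1) (br (M_of (zs ! 0)) (M_of (zs !
    1))) else 0)"

lemma mset_tagged:
  assumes "mset u + mset v = mset w" "set w \<subseteq> tagged"
  shows "set u \<subseteq> tagged" "set v \<subseteq> tagged"
  using assms by (metis Un_subset_iff set_mset_mset set_mset_union)+

lemma higher_sum_A:
  assumes "set zs \<subseteq> tagged" shows "higher_sum zs \<in> A (degs snd zs + 1)"
  unfolding higher_sum_def
proof (rule usum_closed)
  fix u v assume uv: "mset u + mset v = mset zs"
  note tagged = mset_tagged[OF uv assms]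
  show "(if length u = 1 then P (iter (M_of (hd u)) v) else 0) \<in> A (degs snd zs + 1)"
  proof (cases "length u = 1")
    case True
    then obtain z where u: "u = [z]" by (cases u) auto
    then have "iter (M_of z) v \<in> L (snd z + 1 + degs snd v)" using tagged by (intro iter_L tagged_D)
      auto
    then show ?thesis using P_simps(3) degs_split[OF uv, of snd] u by (simp add: ac_simps)
  qed (simp add: subspace_0 subspace_A)
qed (auto simp: subspace_A subspace_add subspace_neg)

lemma binary_br_M:
  assumes "set zs \<subseteq> tagged" shows "binary_br zs \<in> M (degs snd zs + 2)"
proof (cases "length zs = 2")
  case True
  then obtain x y where zs: "zs = [x, y]" by (auto simp: length_Suc_conv numeral_2_eq_2)
  have "br (M_of x) (M_of y) \<in> M ((snd x + 1) + (snd y + 1))"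
    using assms by (intro M_br tagged_D) (auto simp: zs)
  then have "br (M_of x) (M_of y) \<in> M (degs snd zs + 2)" by (simp add: zs add.commute add.left_commute)
  then show ?thesis using subspace_M by (simp add: binary_br_def zs msign_def subspace_neg)
qed (simp add: binary_br_def subspace_0 subspace_M)

text \<open>The source of l_1 = 0: an element of \<open>M\<close> without arguments is annihilated
  by \<open>P\<close>.\<close>

lemma higher_sum_short: "set zs \<subseteq> tagged \<Longrightarrow> length zs \<le> 1 \<Longrightarrow> higher_sum zs = 0"
  by (cases zs) (auto simp: higher_sum_def P_zero intro!: M_kernel tagged_D)

lemma gsymmetric_higher_sum: "gsymmetric snd tagged higher_sum"
  unfolding higher_sum_def
proof (rule gsymmetric_usum)
  show "gsymmetric snd tagged (\<lambda>u. if length u = 1 then P (iter (M_of (hd u)) v) else 0)" for v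
    by (rule gsymmetricI) simp
  show "gsymmetric snd tagged (\<lambda>v. if length u = 1 then P (iter (M_of (hd u)) v) else 0)" if "set u
    \<subseteq> tagged" for u
  proof (rule gsymmetricI)
    fix a x y b assume ab: "set a \<subseteq> tagged" "x \<in> tagged" "y \<in> tagged" "set b \<subseteq> tagged"
    show "(if length u = 1 then P (iter (M_of (hd u)) (a @ x # y # b)) else 0) =
      msign (snd x * snd y) (if length u = 1 then P (iter (M_of (hd u)) (a @ y # x # b)) else 0)"
    proof (cases "length u = 1")
      case True
      then obtain z where u: "u = [z]" by (cases u) auto
      then have z: "M_of z \<in> L (snd z + 1)" using that by (auto simp: tagged_D)
      have "iter (M_of z) (a @ y # x # b) \<in> tot" using L_tot[OF iter_L[OF z, of "a @ y # x # b"]] ab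
        by simp
      then have "P (iter (M_of z) (a @ x # y # b)) = msign (snd x * snd y) (P (iter (M_of z) (a @ y
        # x # b)))"
        by (subst gsymmetricD[OF gsymmetric_iter[OF z] ab]) (rule P_msign)
      then show ?thesis by (simp only: u) simp
    qed simp
  qed
qed

lemma gsymmetric_binary_br: "gsymmetric snd tagged binary_br"
proof (rule gsymmetricI)
  fix a x y b assume ab: "set a \<subseteq> tagged" "x \<in> tagged" "y \<in> tagged" "set b \<subseteq> tagged"
  show "binary_br (a @ x # y # b) = msign (snd x * snd y) (binary_br (a @ y # x # b))"
  proof (cases "a = [] \<and> b = []")
    case True
    \<comment> \<open>Suspension turns antisymmetry into symmetry: for tags m and n, the exponent (m
      + 1)(n + 1) + 1 + (m + 1) + (n + 1) has the parity of m n.\<close>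
    have "br (M_of x) (M_of y) = - msign ((snd x + 1) * (snd y + 1)) (br (M_of y) (M_of x))"
      using ab by (intro antisym_msign tagged_D)
    then show ?thesis using True by (simp add: binary_br_def msign_def)
  qed (auto simp: binary_br_def neq_Nil_conv)
qed

lemma foldl_br_parity_op:
  assumes "f \<in> tot" "set a \<subseteq> tagged" "set b \<subseteq> tagged"
  shows "foldl br f (map (\<lambda>z. parity_op (A_of z)) a @ map A_of b) = msign (degs snd a) (iter f (a @ b))"
  using assms
proof (induction a arbitrary: f)
  case (Cons z a)
  have z: "A_of z \<in> tot" "parity_op (A_of z) = msign (snd z) (A_of z)"
    using Cons.prems by (auto intro: tagged_D parity_op)
  have "foldl br f (map (\<lambda>z. parity_op (A_of z)) (z # a) @ map A_of b) =
    foldl br (msign (snd z) (br f (A_of z))) (map (\<lambda>z. parity_op (A_of z)) a @ map A_of b)"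
    using z Cons.prems by (simp add: br_msign)
  also have "\<dots> = msign (degs snd a) (iter (msign (snd z) (br f (A_of z))) (a @ b))"
    using Cons z by (intro Cons.IH) (auto simp: tot_closed br_tot)
  also have "\<dots> = msign (degs snd a + snd z) (iter (br f (A_of z)) (a @ b))"
    using Cons z by (subst iter_linear) (auto simp: br_tot msign_msign simp del: iter_simps(3))
  finally show ?case by (simp add: add.commute)
qed (simp add: iter_def)

text \<open>An element of \<open>M\<close> of even degree has an odd tag, so the case distinction by
  parity in \<open>higher_term\<close> becomes the Koszul sign with exponent tag times degree of the
  entries to the left.\<close>

lemma higher_br_hom:
  assumes zs: "set zs \<subseteq> tagged" and n: "n = length zs"
  shows "higher_br n (map fst zs) = (binary_br zs, s (lam ^ (n - 2)) (higher_sum zs))"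
proof -
  have "higher_term (map fst zs) i = msign (snd (zs ! i) * degs snd (take i zs))
      (P (iter (M_of (zs ! i)) (take i zs @ drop (Suc i) zs)))" if i: "i < length zs" for i
  proof -
    define z a b where "z = zs ! i" and "a = take i zs" and "b = drop (Suc i) zs"
    have z: "z \<in> tagged" "set a \<subseteq> tagged" "set b \<subseteq> tagged" "set (a @ b) \<subseteq> tagged"
      using zs i by (auto simp: z_def a_def b_def dest: in_set_takeD in_set_dropD)
    have ev: "even_part (M_of z) = (if even (snd z + 1) then M_of z else 0)"
      "odd_part (M_of z) = (if even (snd z + 1) then 0 else M_of z)"
      using even_part[OF tagged_D(2)[OF z(1)]] by (simp_all add: odd_part_def)
    have "higher_term (map fst zs) i = P (foldl br (odd_part (M_of z)) (map A_of a @ map A_of b) +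
        foldl br (even_part (M_of z)) (map (\<lambda>z. parity_op (A_of z)) a @ map A_of b))"
      using i by (simp add: higher_term_def z_def a_def b_def take_map drop_map comp_def)
    also have "\<dots> = P (iter (odd_part (M_of z)) (a @ b) + msign (degs snd a) (iter (even_part (M_of
      z)) (a @ b)))"
      using z tagged_D by (subst foldl_br_parity_op) (auto simp: even_part_tot iter_def)
    also have "\<dots> = P (msign (snd z * degs snd a) (iter (M_of z) (a @ b)))"
      unfolding ev by (auto simp: iter_linear(5)[OF z(4)] msign_def simp del: iter_simps(3))
    also have "\<dots> = msign (snd z * degs snd a) (P (iter (M_of z) (a @ b)))"
      using z tagged_D by (intro P_msign iter_linear) auto
    finally show ?thesis by (simp add: z_def a_def b_def)
  qed
  then have "(\<Sum>i<n. higher_term (map fst zs) i) = higher_sum zs"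
    unfolding higher_sum_def usum_length_one[where B = "\<lambda>z v. P (iter (M_of z) v)"] n by (intro
      sum.cong) auto
  moreover have "(if n = 2 then br (parity_op (fst (map fst zs ! 0))) (fst (map fst zs ! 1)) else 0)
    = binary_br zs"
  proof (cases "n = 2")
    case True
    then obtain x y where xy: "zs = [x, y]" using n by (auto simp: length_Suc_conv numeral_2_eq_2)
    then have "M_of x \<in> L (snd x + 1)" "M_of y \<in> tot" using zs by (auto intro: tagged_D)
    then show ?thesis using True xy by (simp add: binary_br_def parity_op br_msign L_tot)
  qed (simp add: binary_br_def n)
  ultimately show ?thesis by (simp only: higher_br_def)
qed

section \<open>The quadratic relations\<close>

definition nested_br :: "(('v \<times> 'v) \<times> int) list \<Rightarrow> (('v \<times> 'v) \<times> int) list \<Rightarrow>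
    (('v \<times> 'v) \<times> int) list \<Rightarrow> (('v \<times> 'v) \<times> int) list \<Rightarrow> 'v" where
  "nested_br c e a b = (if length c = 1 \<and> length a = 1 then P (br (P (iter (M_of (hd c)) e)) (iter
    (M_of (hd a)) b)) else 0)"

text \<open>The terms whose inner operation has its value in \<open>A\<close> are brought to the
  normal form \<open>nested_br\<close>, in which a projected iterated bracket of one element of
  \<open>M\<close> is bracketed with an iterated bracket of another. The inner value moves to the
  end by \<open>iter_br_A\<close>, is expanded over unshuffles, and antisymmetry puts it in
  front.\<close>

lemma nested_higher:
  assumes u: "set u \<subseteq> tagged" and v: "set v \<subseteq> tagged"
  shows "usum snd (\<lambda>a b. if length a = 1 then msign ((degs snd u + 1) * degs snd a) (P (iter (br
    (M_of (hd a)) (higher_sum u)) b)) else 0) v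
    = usum snd (\<lambda>c e. usum snd (\<lambda>a b. msign (degs snd c + degs snd e) (nested_br c e a b)) v) u"
proof -
  have "(if length a = 1 then msign ((degs snd u + 1) * degs snd a) (P (iter (br (M_of (hd a))
    (higher_sum u)) b)) else 0)
    = usum snd (\<lambda>c e. msign (degs snd c + degs snd e) (nested_br c e a b)) u"
    if ab: "mset a + mset b = mset v" for a b
  proof (cases "length a = 1")
    case True
    then obtain y where y: "a = [y]" by (cases a) auto
    note abHZ = mset_tagged[OF ab v]
    have g: "M_of y \<in> L (snd y + 1)" using abHZ y by (auto intro: tagged_D)
    note Kg = iter_L[OF g abHZ(2)]
    note \<tau> = higher_sum_A[OF u]
    have "P (iter (br (M_of y) (higher_sum u)) b) = msign ((degs snd u + 1) * degs snd b) (P (br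
      (iter (M_of y) b) (higher_sum u)))"
      using iter_br_A[OF g \<tau> abHZ(2)] L_tot[OF bracket_degree[OF Kg A_L[OF \<tau>]]] by (simp add: P_msign)
    also have "P (br (iter (M_of y) b) (higher_sum u)) =
      usum snd (\<lambda>c e. P (br (iter (M_of y) b) (if length c = 1 then P (iter (M_of (hd c)) e) else
        0))) u"
      unfolding higher_sum_def
    proof (rule usum_additive_on[where S = tot])
      fix c e assume "mset c + mset e = mset u"
      note ce = mset_tagged[OF this u]
      then show "(if length c = 1 then P (iter (M_of (hd c)) e) else 0) \<in> tot"
        by (cases c) (auto intro!: P_tot iter_linear(1) tagged_D tot_closed)
    qed (use L_tot[OF Kg] in \<open>auto simp: tot_closed br_linear P_simps br_tot\<close>)
    also have "msign ((degs snd u + 1) * degs snd a) (msign ((degs snd u + 1) * degs snd b) \<dots>) =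
      usum snd (\<lambda>c e. msign (degs snd c + degs snd e) (nested_br c e a b)) u"
      unfolding msign_usum
    proof (rule usum_cong)
      fix c e assume ce: "mset c + mset e = mset u"
      note ceHZ = mset_tagged[OF ce u]
      show "msign ((degs snd u + 1) * degs snd a) (msign ((degs snd u + 1) * degs snd b)
          (P (br (iter (M_of y) b) (if length c = 1 then P (iter (M_of (hd c)) e) else 0)))) =
        msign (degs snd c + degs snd e) (nested_br c e a b)"
      proof (cases "length c = 1")
        case True
        then obtain x where x: "c = [x]" by (cases c) auto
        have f: "M_of x \<in> L (snd x + 1)" using ceHZ x by (auto intro: tagged_D)
        have PK: "P (iter (M_of x) e) \<in> L (snd x + 1 + degs snd e)"
          using iter_L[OF f ceHZ(2)] P_simps(3) A_L by blast
        have "br (iter (M_of y) b) (P (iter (M_of x) e)) =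
          - msign ((snd y + 1 + degs snd b) * (snd x + 1 + degs snd e)) (br (P (iter (M_of x) e))
          (iter (M_of y) b))"
          by (rule antisym_msign[OF Kg PK])
        then have "P (br (iter (M_of y) b) (P (iter (M_of x) e))) =
          msign ((snd y + 1 + degs snd b) * (snd x + 1 + degs snd e) + 1) (nested_br c e a b)"
          using P_msign[OF L_tot[OF bracket_degree[OF PK Kg]], of "(snd y + 1 + degs snd b) * (snd x
          + 1 + degs snd e) + 1"]
          by (simp add: nested_br_def x y) (simp add: msign_def split: if_splits)
        \<comment> \<open>With U, y, B for the degrees of \<open>u\<close>, \<open>a\<close>,
          \<open>b\<close>, the exponent is (U + 1)(y + B) + (y + B + 1)(U + 1) + 1, which has the
          parity of U.\<close>
        then show ?thesis using degs_split[OF ce, of snd] by (simp add: x y msign_def)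
      qed (use L_tot[OF Kg] in \<open>simp add: nested_br_def br_zero P_zero\<close>)
    qed
    finally show ?thesis by (simp add: y)
  qed (simp add: nested_br_def)
  then show ?thesis unfolding usum_swap[of _ _ v] by (intro usum_cong)
qed

text \<open>The terms whose inner operation is the binary bracket: \<open>iter_br\<close>
  distributes \<open>v\<close> over the two factors, and \<open>P_br\<close> yields two terms, one
  with \<open>P\<close> inside on each factor. They match the two orders in which
  \<open>u = [x, y]\<close> splits into \<open>c\<close> and \<open>a\<close>.\<close>

lemma higher_of_bracket:
  assumes u: "set u \<subseteq> tagged" and v: "set v \<subseteq> tagged"
  shows "P (iter (binary_br u) v) = usum snd (\<lambda>c a. usum snd (\<lambda>e b.
    msign (degs snd c + 1 + (degs snd a + 1) * degs snd e) (nested_br c e a b)) v) u"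
    (is "_ = usum snd (\<lambda>c a. usum snd (\<lambda>e b. ?\<Phi> c e a b) v) u")
proof (cases "length u = 2")
  case True
  then obtain x y where xy: "u = [x, y]" by (auto simp: length_Suc_conv numeral_2_eq_2)
  have fg: "M_of x \<in> L (snd x + 1)" "M_of y \<in> L (snd y + 1)" using u xy by (auto intro: tagged_D)
  have binary_br: "binary_br u = msign (snd x + 1) (br (M_of x) (M_of y))" by (simp add:
    binary_br_def xy)
  \<comment> \<open>\<open>?D\<close> is the term with \<open>P\<close> on the second factor, after
    antisymmetry has moved that factor to the front; the additional sign of antisymmetry cancels the
    1 in the exponent \<open>snd x + 1\<close>.\<close>
  let ?D = "\<lambda>e b. msign (snd x + (snd y + 1) * degs snd e + (snd x + 1 + degs snd e) * (snd y + 1 +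
    degs snd b))
    (nested_br [y] b [x] e)"
  note tb = L_tot[OF bracket_degree]
  have "iter (binary_br u) v = msign (snd x + 1) (usum snd (\<lambda>e b. msign ((snd y + 1) * degs snd e)
    (br (iter (M_of x) e) (iter (M_of y) b))) v)"
    unfolding binary_br using iter_linear[OF v] tb[OF fg] iter_br[OF fg v] by simp
  also have "P \<dots> = usum snd (\<lambda>e b. P (msign (snd x + 1) (msign ((snd y + 1) * degs snd e) (br (iter
    (M_of x) e) (iter (M_of y) b))))) v"
    unfolding msign_usum
  proof (rule usum_additive_on[where S = tot])
    fix e b assume "mset e + mset b = mset v"
    note eb = mset_tagged[OF this v]
    show "msign (snd x + 1) (msign ((snd y + 1) * degs snd e) (br (iter (M_of x) e) (iter (M_of y)
      b))) \<in> tot"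
      using tb[OF iter_L[OF fg(1) eb(1)] iter_L[OF fg(2) eb(2)]] by (simp add: tot_closed)
  qed (auto simp: tot_closed P_simps)
  also have "\<dots> = usum snd (\<lambda>e b. ?\<Phi> [x] e [y] b + ?D e b) v"
  proof (rule usum_cong)
    fix e b assume "mset e + mset b = mset v"
    note eb = mset_tagged[OF this v]
    note Kf = iter_L[OF fg(1) eb(1)] and Kg = iter_L[OF fg(2) eb(2)]
    have PKg: "P (iter (M_of y) b) \<in> L (snd y + 1 + degs snd b)" using Kg P_simps(3) A_L by blast
    define k where "k = (snd x + 1 + degs snd e) * (snd y + 1 + degs snd b)"
    have sg: "msign (snd x + 1 + (snd y + 1) * degs snd e + (k + 1)) w = msign (snd x + (snd y + 1)
      * degs snd e + k) w"
      for w :: 'v by (auto simp: msign_def)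
    have "br (iter (M_of x) e) (P (iter (M_of y) b)) = msign (k + 1) (br (P (iter (M_of y) b)) (iter
      (M_of x) e))"
      using antisym_msign[OF Kf PKg] by (simp add: k_def msign_def)
    then have "P (br (iter (M_of x) e) (iter (M_of y) b)) = nested_br [x] e [y] b + msign (k + 1)
      (nested_br [y] b [x] e)"
      using P_br[OF Kf Kg] tb[OF PKg Kf] by (simp add: nested_br_def P_msign)
    moreover have "P (msign (snd x + 1) (msign ((snd y + 1) * degs snd e) (br (iter (M_of x) e)
      (iter (M_of y) b))))
      = msign (snd x + 1 + (snd y + 1) * degs snd e) (P (br (iter (M_of x) e) (iter (M_of y) b)))"
      unfolding msign_msign by (rule P_msign[OF tb[OF Kf Kg]])
    ultimately show "P (msign (snd x + 1) (msign ((snd y + 1) * degs snd e) (br (iter (M_of x) e)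
      (iter (M_of y) b))))
      = ?\<Phi> [x] e [y] b + ?D e b"
      by (simp only: msign_add msign_msign sg degs_simps add_0_right) (simp only: k_def)
  qed
  also have "\<dots> = usum snd (\<lambda>e b. ?\<Phi> [x] e [y] b) v + usum snd ?D v"
    by (rule usum_add)
  also have "usum snd ?D v = msign (snd x * snd y) (usum snd (\<lambda>e b. ?\<Phi> [y] e [x] b) v)"
    unfolding msign_usum
  \<comment> \<open>Cocommutativity in \<open>v\<close> exchanges \<open>e\<close> and
    \<open>b\<close>, which turns the second term into the first one with \<open>x\<close> and
    \<open>y\<close> interchanged.\<close>
  proof (subst usum_commute[symmetric], rule usum_cong)
    fix e b :: "(('v \<times> 'v) \<times> int) list"
    have "even (degs snd e * degs snd b + (snd x + (snd y + 1) * degs snd b + (snd x + 1 + degs snd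
      b) * (snd y + 1 + degs snd e)))
      \<longleftrightarrow> even (snd x * snd y + (degs snd [y] + 1 + (degs snd [x] + 1) * degs snd e))"
      by (cases "even (snd x)"; cases "even (snd y)"; cases "even (degs snd e)"; cases "even (degs
        snd b)"; simp)
    then show "msign (degs snd e * degs snd b) (?D b e) = msign (snd x * snd y) (?\<Phi> [y] e [x] b)"
      by (simp only: msign_msign) (simp only: msign_def)
  qed
  finally have *: "P (iter (binary_br u) v) = usum snd (\<lambda>e b. ?\<Phi> [x] e [y] b) v
      + msign (snd x * snd y) (usum snd (\<lambda>e b. ?\<Phi> [y] e [x] b) v)" .
  have W0: "nested_br c e a b = 0" if "length c \<noteq> 1 \<or> length a \<noteq> 1" for c e a b
    using that by (auto simp: nested_br_def)
  \<comment> \<open>The splittings of \<open>[x, y]\<close> with an empty part contribute 0.\<close>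
  show ?thesis by (subst *) (simp add: xy W0)
next
  case False
  then have "binary_br u = 0" by (simp add: binary_br_def)
  moreover have "usum snd (\<lambda>c a. usum snd (\<lambda>e b. ?\<Phi> c e a b) v) u = 0"
  proof (rule usum_eq_zero)
    fix c a assume "mset c + mset a = mset u"
    then have "length c + length a = length u" by (metis size_mset size_union)
    then have "nested_br c e a b = 0" for e b using False by (auto simp: nested_br_def)
    then show "usum snd (\<lambda>e b. ?\<Phi> c e a b) v = 0" by simp
  qed
  ultimately show ?thesis by (simp add: iter_linear(5)[OF v] P_zero)
qed

text \<open>The component in \<open>A\<close> of a relation, stripped of its power of
  \<open>lam\<close>. Both kinds of terms are sums of \<open>nested_br\<close>; interchanging the
  middle parts \<open>a\<close> and \<open>e\<close> makes the summations agree.\<close>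

lemma higher_relation:
  assumes zs: "set zs \<subseteq> tagged"
  shows "usum snd (\<lambda>u v. P (iter (binary_br u) v) + usum snd (\<lambda>a b. if length a = 1
    then msign ((degs snd u + 1) * degs snd a) (P (iter (br (M_of (hd a)) (higher_sum u)) b)) else
      0) v) zs = 0"
proof -
  let ?U = "usum snd :: _ \<Rightarrow> (('v \<times> 'v) \<times> int) list \<Rightarrow> 'v"
  have "?U (\<lambda>u v. P (iter (binary_br u) v)) zs = ?U (\<lambda>u v. ?U (\<lambda>c a. ?U (\<lambda>e b.
    msign (degs snd c + 1 + (degs snd a + 1) * degs snd e) (nested_br c e a b)) v) u) zs"
    by (intro usum_cong higher_of_bracket mset_tagged[OF _ zs])
  also have "\<dots> = ?U (\<lambda>u v. ?U (\<lambda>c e. ?U (\<lambda>a b. msign (degs snd a * degs snd e)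
    (msign (degs snd c + 1 + (degs snd a + 1) * degs snd e) (nested_br c e a b))) v) u) zs"
    by (rule usum_interchange)
  \<comment> \<open>The exponent |a| |e| + |c| + 1 + (|a| + 1) |e| has the parity of |c| + |e| + 1,
    so the two kinds of terms are opposite.\<close>
  also have "\<dots> = ?U (\<lambda>u v. ?U (\<lambda>c e. ?U (\<lambda>a b. - msign (degs snd c + degs snd e) (nested_br c e a
    b)) v) u) zs"
    by (intro usum_cong) (simp add: msign_def)
  also have "\<dots> = - ?U (\<lambda>u v. ?U (\<lambda>c e. ?U (\<lambda>a b. msign (degs snd c + degs snd e) (nested_br c e a
    b)) v) u) zs"
    by (simp add: usum_uminus)
  also have "?U (\<lambda>u v. ?U (\<lambda>c e. ?U (\<lambda>a b. msign (degs snd c + degs snd e) (nested_br c e a b)) v)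
    u) zs =
    ?U (\<lambda>u v. ?U (\<lambda>a b. if length a = 1
      then msign ((degs snd u + 1) * degs snd a) (P (iter (br (M_of (hd a)) (higher_sum u)) b)) else
        0) v) zs"
    by (intro usum_cong nested_higher[symmetric] mset_tagged[OF _ zs])
  finally show ?thesis by (simp add: usum_add)
qed

lemma tagged_higher:
  assumes "set u \<subseteq> tagged"
  shows "((binary_br u, s c (higher_sum u)), degs snd u + 1) \<in> tagged"
  using binary_br_M[OF assms] higher_sum_A[OF assms] subspace_A by (simp add: tagged_def
    subspace_scale add.commute)

text \<open>The component in \<open>M\<close> of a relation: the Jacobi identity for three entries,
  and zero terms for other lengths. The values \<open>\<tau> u\<close> are arbitrary because
  \<open>binary_br\<close> sees only components in \<open>M\<close>.\<close>

lemma bracket_relation: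
  assumes zs: "set zs \<subseteq> tagged"
  shows "usum snd (\<lambda>u v. binary_br (((binary_br u, \<tau> u), degs snd u + 1) # v)) zs = 0"
proof (cases "length zs = 3")
  case True
  then obtain x y z where xyz: "zs = [x, y, z]" by (auto simp: length_Suc_conv numeral_3_eq_3)
  have m: "M_of x \<in> L (snd x + 1)" "M_of y \<in> L (snd y + 1)" "M_of z \<in> L (snd z + 1)"
    using zs xyz by (auto intro: tagged_D)
  note t = L_tot[OF m(1)] L_tot[OF m(2)] L_tot[OF m(3)]
  have Q1: "binary_br [a] = 0" "binary_br [] = 0" "binary_br [a, b, c, d] = 0" "binary_br (((0, \<xi>),
    d') # v) = 0" if "length v = 1 \<longrightarrow> M_of (hd v) \<in> tot" for a b c d \<xi> d' v
    using that by (auto simp: binary_br_def length_Suc_conv br_zero)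
  have Q2: "binary_br [((binary_br [a, b], \<xi>), d), c] = msign (d + 1) (msign (snd a + 1) (br (br
    (M_of a) (M_of b)) (M_of c)))"
    if "M_of a \<in> tot" "M_of b \<in> tot" "M_of c \<in> tot" for a b c \<xi> d
    using that by (simp add: binary_br_def br_msign br_tot)
  have "br (br (M_of x) (M_of y)) (M_of z) =
      br (M_of x) (br (M_of y) (M_of z)) + msign ((snd y + 1) * (snd z + 1)) (br (br (M_of x) (M_of
        z)) (M_of y))"
    by (rule br_leibniz[OF m])
  moreover have "br (M_of x) (br (M_of y) (M_of z)) =
      - msign ((snd x + 1) * (snd y + 1 + (snd z + 1))) (br (br (M_of y) (M_of z)) (M_of x))"
    by (rule antisym_msign[OF m(1) bracket_degree[OF m(2,3)]])
  ultimately show ?thesis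
    unfolding xyz
    by (simp add: Q2 t msign_add msign_msign) (simp add: binary_br_def br_zero t msign_def)
next
  case False
  have "binary_br (((binary_br u, \<tau> u), degs snd u + 1) # v) = 0" if uv: "mset u + mset v = mset zs"
    for u v
  proof (cases "length v = 1")
    case True
    then obtain w where w: "v = [w]" by (cases v) auto
    have "length u + length v = length zs" using uv by (metis size_mset size_union)
    then have "binary_br u = 0" using False w by (simp add: binary_br_def)
    then show ?thesis using mset_tagged(2)[OF uv zs] w by (simp add: binary_br_def br_zero tagged_D)
  qed (simp add: binary_br_def)
  then show ?thesis by (rule usum_eq_zero)
qed

text \<open>Once every term is shown to carry the factor \<open>lam ^ (n - 3)\<close>, the two
  components reduce to \<open>bracket_relation\<close> and \<open>higher_relation\<close>.\<close>

lemma higher_br_relation: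
  assumes zs: "set zs \<subseteq> tagged"
  shows "usum snd (\<lambda>u v. if u = [] then 0 else
    higher_br (length v + 1) (higher_br (length u) (map fst u) # map fst v)) zs = 0"
proof -
  define n where "n = length zs"
  define y where "y u = ((binary_br u, s (lam ^ (length u - 2)) (higher_sum u)), degs snd u + 1)" for u
  define R where "R u v = P (iter (binary_br u) v) + usum snd (\<lambda>a b. if length a = 1
    then msign ((degs snd u + 1) * degs snd a) (P (iter (br (M_of (hd a)) (higher_sum u)) b)) else
      0) v" for u v
  have main: "(if u = [] then 0 else higher_br (length v + 1) (higher_br (length u) (map fst u) #
    map fst v))
    = (binary_br (y u # v), s (lam ^ (n - 3)) (R u v))" if uv: "mset u + mset v = mset zs" for u v
  proof -
    have len: "length u + length v = n" using uv unfolding n_def by (metis size_mset size_union)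
    have u: "set u \<subseteq> tagged" and v: "set v \<subseteq> tagged" using mset_tagged[OF uv zs] by auto
    have yu: "y u \<in> tagged" unfolding y_def by (rule tagged_higher[OF u])
    \<comment> \<open>A nonzero value requires \<open>length u = 2\<close> and, since
      \<open>P\<close> vanishes on \<open>M\<close>, also a nonempty \<open>v\<close>; then
      \<open>length v - 1 = n - 3\<close>.\<close>
    have h1: "s (lam ^ (length v - 1)) (P (iter (binary_br u) v)) = s (lam ^ (n - 3)) (P (iter
      (binary_br u) v))"
    proof (cases "length u = 2 \<and> v \<noteq> []")
      case True
      then have "length v - 1 = n - 3" using len by (cases v) auto
      then show ?thesis by simp
    next
      case False
      then have "P (iter (binary_br u) v) = 0"
        using M_kernel[OF binary_br_M[OF u]] by (auto simp: binary_br_def iter_linear(5)[OF v] P_zero)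
      then show ?thesis by simp
    qed
    \<comment> \<open>For \<open>length u \<ge> 2\<close> the exponents \<open>length v - 1\<close>
      and \<open>length u - 2\<close> add up to \<open>n - 3\<close>, where \<open>v\<close> is
      nonempty because it contains the entry of \<open>a\<close>. For shorter \<open>u\<close> the
      truncated exponent is harmless, since \<open>higher_sum u = 0\<close>.\<close>
    have h2: "s (lam ^ (length v - 1)) (if length a = 1 then msign ((degs snd u + 1) * degs snd a)
      (P (iter (M_of (hd a)) (y u # b))) else 0)
      = s (lam ^ (n - 3)) (if length a = 1 then msign ((degs snd u + 1) * degs snd a) (P (iter (br
        (M_of (hd a)) (higher_sum u)) b)) else 0)"
      if ab: "mset a + mset b = mset v" for a b
    proof (cases "length a = 1")
      case True
      have "length a + length b = length v" using ab by (metis size_mset size_union)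
      note abHZ = mset_tagged[OF ab v]
      have g: "M_of (hd a) \<in> tot" using True abHZ by (cases a) (auto intro: tagged_D)
      have t: "higher_sum u \<in> tot" using higher_sum_A[OF u] by (intro L_tot A_L)
      have b: "br (M_of (hd a)) (higher_sum u) \<in> tot" by (intro br_tot g t)
      have "iter (M_of (hd a)) (y u # b) = s (lam ^ (length u - 2)) (iter (br (M_of (hd a))
        (higher_sum u)) b)"
        using g t b by (simp add: y_def br_linear iter_linear[OF abHZ(2)])
      then have 1: "P (iter (M_of (hd a)) (y u # b)) = s (lam ^ (length u - 2)) (P (iter (br (M_of
        (hd a)) (higher_sum u)) b))"
        using b by (simp add: P_simps iter_linear[OF abHZ(2)])
      show ?thesis
      proof (cases "length u \<le> 1")
        case True
        then have "iter (br (M_of (hd a)) (higher_sum u)) b = 0"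
          using higher_sum_short[OF u True] g by (simp add: br_zero iter_linear(5)[OF abHZ(2)])
        then show ?thesis using 1 by (simp add: P_zero)
      next
        case False
        then have "length v - 1 + (length u - 2) = n - 3"
          using len \<open>length a = 1\<close> \<open>length a + length b = length v\<close> by linarith
        then have "lam ^ (length v - 1) * lam ^ (length u - 2) = lam ^ (n - 3)" by (simp flip:
          power_add)
        then show ?thesis using 1 \<open>length a = 1\<close> by (simp add: msign_def)
      qed
    qed simp
    \<comment> \<open>The inner value \<open>y u\<close> is either the entry taken out for its
      component in \<open>M\<close> or one of the arguments in \<open>A\<close>; these are the two
      summands of the recursion of \<open>usum\<close>.\<close>
    have "usum snd (\<lambda>a b. if length (y u # a) = 1 then P (iter (M_of (hd (y u # a))) b) else 0) v =
      P (iter (binary_br u) v)"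
      using usum_length_zero[of snd "\<lambda>v. P (iter (binary_br u) v)" v] by (simp add: y_def cong: if_cong)
    moreover have "usum snd (\<lambda>a b. msign (snd (y u) * degs snd a) (if length a = 1 then P (iter
      (M_of (hd a)) (y u # b)) else 0)) v
      = usum snd (\<lambda>a b. if length a = 1 then msign ((degs snd u + 1) * degs snd a) (P (iter (M_of
        (hd a)) (y u # b))) else 0) v"
      by (rule usum_cong) (simp add: y_def)
    ultimately have "s (lam ^ (length v - 1)) (higher_sum (y u # v)) = s (lam ^ (length v - 1)) (P
      (iter (binary_br u) v)) +
      usum snd (\<lambda>a b. s (lam ^ (length v - 1)) (if length a = 1 then msign ((degs snd u + 1) * degs
        snd a) (P (iter (M_of (hd a)) (y u # b))) else 0)) v"
      by (simp only: higher_sum_def usum.simps scale_right_distrib usum_additive[of "s _", OF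
        scale_right_distrib])
    also have "\<dots> = s (lam ^ (n - 3)) (P (iter (binary_br u) v)) +
      usum snd (\<lambda>a b. s (lam ^ (n - 3)) (if length a = 1 then msign ((degs snd u + 1) * degs snd a)
        (P (iter (br (M_of (hd a)) (higher_sum u)) b)) else 0)) v"
      unfolding h1 by (intro arg_cong2[of _ _ _ _ plus] refl usum_cong h2)
    also have "\<dots> = s (lam ^ (n - 3)) (R u v)"
      by (simp only: R_def scale_right_distrib usum_additive[of "s _", OF scale_right_distrib])
    finally have "s (lam ^ (length v - 1)) (higher_sum (y u # v)) = s (lam ^ (n - 3)) (R u v)" .
    moreover have "higher_br (length v + 1) (higher_br (length u) (map fst u) # map fst v)
        = (binary_br (y u # v), s (lam ^ (length v - 1)) (higher_sum (y u # v)))"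
      using higher_br_hom[of "y u # v"] higher_br_hom[OF u refl] yu v by (simp add: y_def)
    \<comment> \<open>The relations have no term with an empty inner argument list; the additional
      splitting in the unshuffle sum contributes nothing.\<close>
    moreover have "binary_br (y u # v) = 0 \<and> R u v = 0" if "u = []"
    proof -
      have "binary_br (y u # v) = 0"
      proof (cases "length v = 1")
        case True
        then obtain w where "v = [w]" by (cases v) auto
        then show ?thesis using v that by (simp add: binary_br_def y_def br_zero tagged_D)
      qed (simp add: binary_br_def)
      moreover have "(if length a = 1 then msign ((degs snd u + 1) * degs snd a) (P (iter (br (M_of
        (hd a)) (higher_sum u)) b)) else 0) = 0"
        if ab: "mset a + mset b = mset v" for a b
      proof (cases "length a = 1")
        case True
        then have "M_of (hd a) \<in> tot" using mset_tagged(1)[OF ab v] by (cases a) (auto intro: tagged_D)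
        then show ?thesis
          using higher_sum_short[of "[]"] \<open>u = []\<close> by (simp add: br_zero P_zero iter_linear(5)[OF
          mset_tagged(2)[OF ab v]])
      qed simp
      then have "R u v = 0" unfolding R_def
        using that by (simp add: usum_eq_zero binary_br_def iter_linear(5)[OF v] P_zero)
      ultimately show ?thesis by simp
    qed
    ultimately show ?thesis by (cases "u = []") (simp_all add: zero_prod_def)
  qed
  have "usum snd (\<lambda>u v. if u = [] then 0 else
    higher_br (length v + 1) (higher_br (length u) (map fst u) # map fst v)) zs =
    usum snd (\<lambda>u v. (binary_br (y u # v), s (lam ^ (n - 3)) (R u v))) zs"
    by (rule usum_cong) (rule main)
  also have "\<dots> = (usum snd (\<lambda>u v. binary_br (y u # v)) zs, s (lam ^ (n - 3)) (usum snd R zs))"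
    by (rule prod_eqI)
       (simp_all add: usum_additive[of fst] usum_additive[of snd] usum_additive[of "s _", OF
         scale_right_distrib])
  also have "\<dots> = 0"
    using bracket_relation[OF zs] higher_relation[OF zs] by (simp add: y_def R_def[abs_def]
      zero_prod_def)
  finally show ?thesis .
qed

section \<open>The structure on the sum of the suspension of M with A\<close>

abbreviation sM_A :: "int \<Rightarrow> ('v \<times> 'v) set" where "sM_A \<equiv> gsum (gshift M) A"

lemma gtotal_sM_A: "gtotal (module_prod.scale s s) sM_A \<subseteq> tot \<times> tot"
  unfolding gtotal_def
proof (rule prod.p.span_minimal)
  show "(\<Union>n. sM_A n) \<subseteq> span (\<Union> (range L)) \<times> span (\<Union> (range L))"
    using L_tot[OF M_L] L_tot[OF A_L] by (auto simp: gsum_def gshift_def gtotal_def)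
  show "prod.p.subspace (span (\<Union> (range L)) \<times> span (\<Union> (range L)))"
    by (auto simp: prod.p.subspace_def prod.scale_def span_zero span_add span_scale zero_prod_def)
qed

lemma graded_space_sM_A: "graded_space (module_prod.scale s s) sM_A"
proof
  show "prod.p.subspace (sM_A n)" for n
    using subspace_M[of "n + 1"] subspace_A[of n]
    by (auto simp: prod.p.subspace_def prod.scale_def subspace_def gsum_def gshift_def zero_prod_def)
next
  fix I n and x :: "int \<Rightarrow> 'v \<times> 'v"
  assume I: "finite I" "\<And>n. n \<in> I \<Longrightarrow> x n \<in> sM_A n" "(\<Sum>n\<in>I. x n) = 0" and n: "n \<in> I"
  have x: "fst (x n) \<in> L (n + 1)" "snd (x n) \<in> L n" if "n \<in> I" for n
    using I(2)[OF that] M_L A_L by (auto simp: gsum_def gshift_def)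
  have "(\<Sum>n\<in>I. snd (x n)) = 0" "(\<Sum>n\<in>I. fst (x n)) = 0"
    using I(3) by (simp_all flip: snd_sum fst_sum)
  then have "snd (x n) = 0"
    using independent_components[of I "\<lambda>n. snd (x n)" n] x n I(1) by blast
  \<comment> \<open>The first components lie in degree \<open>n + 1\<close> of \<open>L\<close>,
    hence the reindexing by the shift.\<close>
  moreover have "fst (x n) = 0"
    using independent_components[of "(\<lambda>n. n + 1) ` I" "\<lambda>n. fst (x (n - 1))" "n + 1"] x(1) n I(1)
      \<open>(\<Sum>n\<in>I. fst (x n)) = 0\<close>
    by (force simp: sum.reindex)
  ultimately show "x n = 0" by (simp add: prod_eq_iff)
qed

lemma zip_tagged:
  assumes "list_all2 (\<lambda>x d. x \<in> sM_A d) xs ds"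
  shows "set (zip xs ds) \<subseteq> tagged" "map fst (zip xs ds) = xs" "map snd (zip xs ds) = ds" "length
    (zip xs ds) = length ds"
  using assms by (auto simp: list_all2_iff tagged_def gsum_def gshift_def)

theorem L_infinity_1_algebra_higher_br:
  "L_infinity_1_algebra (module_prod.scale s s) sM_A higher_br"
proof (intro L_infinity_1_algebra.intro L_infinity_1_algebra_axioms.intro graded_space_sM_A)
  fix xs :: "('v \<times> 'v) list" and n i
  assume xs: "length xs = n" "set xs \<subseteq> gtotal (module_prod.scale s s) sM_A" "i < n"
  then have "set xs \<subseteq> tot \<times> tot" using gtotal_sM_A by blast
  from higher_br_multilinear[OF this xs(1,3)] gtotal_sM_A
  show "linear_on_set (module_prod.scale s s) (module_prod.scale s s)
     (gtotal (module_prod.scale s s) sM_A) (\<lambda>x. higher_br n (xs[i := x]))"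
    unfolding linear_on_set_def by blast
next
  fix n :: nat and ds xs
  assume len: "length ds = n" and xs: "list_all2 (\<lambda>x d. x \<in> sM_A d) xs ds"
  define zs where "zs = zip xs ds"
  note zs = zip_tagged[OF xs, folded zs_def]
  note hb = higher_br_hom[OF zs(1), of n]
  have sum: "degs snd zs = sum_list ds" using zs(3) by (simp add: degs_def)
  have "binary_br zs \<in> M (sum_list ds + 1 + 1)" "s c (higher_sum zs) \<in> A (sum_list ds + 1)" for c
    using binary_br_M[OF zs(1)] higher_sum_A[OF zs(1)] subspace_A by (simp_all add: sum
      subspace_scale add.assoc)
  then show "higher_br n xs \<in> sM_A (sum_list ds + 1)"
    using hb len zs by (simp add: gsum_def gshift_def)
  show "higher_br n (permute_list \<sigma> xs) = module_prod.scale s s (koszul_sign \<sigma> ds) (higher_br n xs)"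
    if \<sigma>: "\<sigma> permutes {..<n}" for \<sigma>
  proof -
    let ?G = "\<lambda>zs. (binary_br zs, s (lam ^ (n - 2)) (higher_sum zs))"
    have "gsymmetric snd tagged ?G"
    proof (rule gsymmetricI)
      fix a x y b assume ab: "set a \<subseteq> tagged" "x \<in> tagged" "y \<in> tagged" "set b \<subseteq> tagged"
      show "?G (a @ x # y # b) = msign (snd x * snd y) (?G (a @ y # x # b))"
        by (simp only: gsymmetricD[OF gsymmetric_binary_br ab] gsymmetricD[OF gsymmetric_higher_sum
          ab]) (simp add: msign_def)
    qed
    then have "?G (permute_list \<sigma> zs) = prod.scale (koszul_sign \<sigma> (map snd zs)) (?G zs)"
      using zs \<sigma> len by (intro prod.p.gsymmetric_permute_list[where S = tagged]) auto
    moreover have "higher_br n (map fst (permute_list \<sigma> zs)) = ?G (permute_list \<sigma> zs)"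
      using zs \<sigma> len by (intro higher_br_hom) auto
    moreover have "map fst (permute_list \<sigma> zs) = permute_list \<sigma> xs"
      using zs \<sigma> len by (metis permute_list_map)
    ultimately show ?thesis using hb zs len by simp
  qed
  assume n: "n \<ge> 1"
  show "(\<Sum>i=1..n. \<Sum>\<sigma>\<in>shuffles_perm i (n - i). module_prod.scale s s (koszul_sign \<sigma> ds)
     (higher_br (n - i + 1) (higher_br i (take i (permute_list \<sigma> xs)) # drop i (permute_list \<sigma>
       xs)))) = 0"
  proof -
    have "(\<Sum>\<sigma>\<in>shuffles_perm i (n - i). prod.scale (koszul_sign \<sigma> ds)
       (higher_br (n - i + 1) (higher_br i (take i (permute_list \<sigma> xs)) # drop i (permute_list \<sigma>
         xs)))) =
       usum snd (\<lambda>u v. if length u = i then higher_br (n - i + 1) (higher_br i (map fst u) # map fst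
         v) else 0) zs"
      if i: "i \<in> {1..n}" for i
    proof -
      have "permute_list \<sigma> xs = map fst (permute_list \<sigma> zs)" if "\<sigma> \<in> shuffles_perm i (n - i)" for \<sigma>
        using that zs len i by (metis (no_types, lifting) permute_list_map shuffles_perm_def
          mem_Collect_eq
            atLeastAtMost_iff le_add_diff_inverse)
      then have "(\<Sum>\<sigma>\<in>shuffles_perm i (n - i). prod.scale (koszul_sign \<sigma> ds)
       (higher_br (n - i + 1) (higher_br i (take i (permute_list \<sigma> xs)) # drop i (permute_list \<sigma>
         xs)))) =
       (\<Sum>\<sigma>\<in>shuffles_perm i (n - i). prod.scale (koszul_sign \<sigma> (map snd zs))
       ((\<lambda>u v. higher_br (n - i + 1) (higher_br i (map fst u) # map fst v)) (take i (permute_list \<sigma>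
         zs)) (drop i (permute_list \<sigma> zs))))"
        by (intro sum.cong) (auto simp: zs take_map drop_map)
      also have "\<dots> = usum snd (\<lambda>u v. if length u = i then (\<lambda>u v. higher_br (n - i + 1) (higher_br i
        (map fst u) # map fst v)) u v else 0) zs"
        using i len zs by (intro prod.p.sum_shuffles_perm) simp
      finally show ?thesis .
    qed
    then have "(\<Sum>i=1..n. \<Sum>\<sigma>\<in>shuffles_perm i (n - i). prod.scale (koszul_sign \<sigma> ds)
       (higher_br (n - i + 1) (higher_br i (take i (permute_list \<sigma> xs)) # drop i (permute_list \<sigma>
         xs)))) =
      usum snd (\<lambda>u v. \<Sum>i=1..n. if length u = i then higher_br (n - i + 1) (higher_br i (map fst u) #
        map fst v) else 0) zs"
      by (simp add: usum_sum)
    \<comment> \<open>Each splitting occurs for exactly one \<open>i\<close>, the length of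
      \<open>u\<close>; the range from 1 omits the empty \<open>u\<close>.\<close>
    also have "\<dots> = usum snd (\<lambda>u v. if u = [] then 0 else
        higher_br (length v + 1) (higher_br (length u) (map fst u) # map fst v)) zs"
    proof (rule usum_cong)
      fix u v assume "mset u + mset v = mset zs"
      then have "length u + length v = n" using len zs by (metis size_mset size_union)
      then have "length u \<le> n" "n - length u = length v" by auto
      then show "(\<Sum>i=1..n. if length u = i then higher_br (n - i + 1) (higher_br i (map fst u) # map
        fst v) else 0) =
        (if u = [] then 0 else higher_br (length v + 1) (higher_br (length u) (map fst u) # map fst v))"
        by (cases u) (auto simp: sum.delta')
    qed
    also have "\<dots> = 0" by (rule higher_br_relation[OF zs(1)])
    finally show ?thesis .
  qed
qed

section \<open>Values on elements of the two summands\<close>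

lemma degrees_M:
  assumes "set fs \<subseteq> (\<Union>p. M p)"
  obtains zs where "set zs \<subseteq> tagged" "map fst zs = map (\<lambda>f. (f, 0)) fs"
proof -
  have "\<exists>zs. set zs \<subseteq> tagged \<and> map fst zs = map (\<lambda>f. (f, 0)) fs" using assms
  proof (induction fs)
    case (Cons f fs)
    then obtain p zs where "f \<in> M p" "set zs \<subseteq> tagged" "map fst zs = map (\<lambda>f. (f, 0)) fs" by auto
    then show ?case
      by (intro exI[of _ "((f, 0), p - 1) # zs"]) (auto simp: tagged_def subspace_0 subspace_A)
  qed simp
  then show ?thesis using that by blast
qed

text \<open>Tags are chosen from the degrees of the entries; the zero component fits every
  tag.\<close>

lemma degrees_A:
  assumes "set \<xi>s \<subseteq> (\<Union>q. A q)"
  obtains zs where "set zs \<subseteq> tagged" "map fst zs = map (\<lambda>\<xi>. (0, \<xi>)) \<xi>s"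
proof -
  have "\<exists>zs. set zs \<subseteq> tagged \<and> map fst zs = map (\<lambda>\<xi>. (0, \<xi>)) \<xi>s" using assms
  proof (induction \<xi>s)
    case (Cons \<xi> \<xi>s)
    then obtain q zs where "\<xi> \<in> A q" "set zs \<subseteq> tagged" "map fst zs = map (\<lambda>\<xi>. (0, \<xi>)) \<xi>s" by auto
    then show ?case
      by (intro exI[of _ "((0, \<xi>), q) # zs"]) (auto simp: tagged_def subspace_0 subspace_M)
  qed simp
  then show ?thesis using that by blast
qed

lemma iter_zero_arg:
  assumes "f \<in> tot" "set v \<subseteq> tagged" "z \<in> set v" "A_of z = 0"
  shows "iter f v = 0"
proof -
  obtain a b where v: "v = a @ z # b" using split_list[OF assms(3)] by blast
  then have "iter f a \<in> tot" "set b \<subseteq> tagged" using assms iter_linear(1)[of a f] by auto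
  then show ?thesis using assms(4) by (simp add: v br_zero iter_linear(5))
qed

lemma higher_sum_eq_zero:
  assumes zs: "set zs \<subseteq> tagged"
    and "\<And>z v. mset zs = add_mset z (mset v) \<Longrightarrow> P (iter (M_of z) v) = 0"
  shows "higher_sum zs = 0"
  unfolding higher_sum_def
proof (rule usum_eq_zero)
  fix u v assume uv: "mset u + mset v = mset zs"
  show "(if length u = 1 then P (iter (M_of (hd u)) v) else 0) = 0"
    using assms(2)[of "hd u" v] uv by (cases u) auto
qed

lemma higher_br_MM:
  assumes f: "f \<in> M p" and g: "g \<in> M q"
  shows "higher_br 2 [(f, 0), (g, 0)] = (s ((-1) powi p) (br f g), 0)"
proof -
  let ?zs = "[((f, 0), p - 1), ((g, 0), q - 1)]"
  have tagged: "set ?zs \<subseteq> tagged" using f g by (simp add: tagged_def subspace_0 subspace_A)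
  have t: "f \<in> tot" "g \<in> tot" using f g by (auto intro: L_tot[OF M_L])
  have "higher_sum ?zs = 0" using t by (simp add: higher_sum_def br_zero P_zero)
  then show ?thesis using higher_br_hom[OF tagged, of 2] by (simp add: binary_br_def scale_msign)
qed

lemma higher_br_MA:
  assumes f: "f \<in> M p" and \<xi>s: "set \<xi>s \<subseteq> (\<Union>q. A q)" and n: "n = length \<xi>s + 1" "n \<ge> 2"
  shows "higher_br n ((f, 0) # map (\<lambda>\<xi>. (0, \<xi>)) \<xi>s) = (0, s (lam ^ (n - 2)) (P (foldl br f \<xi>s)))"
proof -
  obtain v where v: "set v \<subseteq> tagged" "map fst v = map (\<lambda>\<xi>. (0, \<xi>)) \<xi>s" by (rule degrees_A[OF \<xi>s])
  define z where "z = ((f, 0 :: 'v), p - 1)"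
  have tagged: "set (z # v) \<subseteq> tagged" using f v by (auto simp: z_def tagged_def subspace_0 subspace_A)
  have t: "f \<in> tot" using f by (auto intro: L_tot[OF M_L])
  have len: "length v = length \<xi>s" using arg_cong[OF v(2), of length] by simp
  have mz0: "M_of w = 0" if "w \<in> set v" for w
  proof -
    have "fst w \<in> set (map fst v)" using that by simp
    then show ?thesis unfolding v(2) by auto
  qed
  have A_of: "map A_of v = \<xi>s" using arg_cong[OF v(2), of "map snd"] by (simp add: comp_def)
  \<comment> \<open>If \<open>z\<close> is not the entry taken out, the one taken out has component
    0 in \<open>M\<close>.\<close>
  have "usum snd (\<lambda>a b. msign (snd z * degs snd a) (if length a = 1 then P (iter (M_of (hd a)) (z #
    b)) else 0)) v = 0"
  proof (rule usum_eq_zero)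
    fix a b assume ab: "mset a + mset b = mset v"
    have "M_of (hd a) = 0" if "length a = 1"
    proof (rule mz0)
      have "set a \<subseteq> set v" using ab by (metis Un_upper1 set_mset_mset set_mset_union)
      then show "hd a \<in> set v" using that by (cases a) auto
    qed
    then show "msign (snd z * degs snd a) (if length a = 1 then P (iter (M_of (hd a)) (z # b)) else
      0) = 0"
      by (simp add: z_def br_zero tot_closed iter_linear(5)[OF mset_tagged(2)[OF ab v(1)]] P_zero)
  qed
  then have "higher_sum (z # v) = P (iter f v)"
    using usum_length_zero[of snd "\<lambda>v. P (iter f v)" v] by (simp add: higher_sum_def z_def cong:
      if_cong)
  moreover have "iter f v = foldl br f \<xi>s" by (simp add: iter_def A_of)
  moreover have "binary_br (z # v) = 0"
    using mz0 t by (cases v) (auto simp: binary_br_def z_def br_zero)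
  ultimately show ?thesis
    using higher_br_hom[OF tagged, of n] n len v(2) by (simp add: z_def)
qed

text \<open>Without an entry from \<open>M\<close> every iterated bracket starts at 0; with at least
  two, one of them remains among the arguments, where its component in \<open>A\<close> is
  0.\<close>

lemma higher_br_other:
  assumes fs: "set fs \<subseteq> (\<Union>p. M p)" and \<xi>s: "set \<xi>s \<subseteq> (\<Union>q. A q)"
    and "\<not> (length fs = 2 \<and> length \<xi>s = 0)" "\<not> (length fs = 1 \<and> length \<xi>s \<ge> 1)"
  shows "higher_br (length fs + length \<xi>s) (map (\<lambda>f. (f, 0)) fs @ map (\<lambda>\<xi>. (0, \<xi>)) \<xi>s) = 0"
proof -
  obtain a where a: "set a \<subseteq> tagged" "map fst a = map (\<lambda>f. (f, 0)) fs" by (rule degrees_M[OF fs])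
  obtain b where b: "set b \<subseteq> tagged" "map fst b = map (\<lambda>\<xi>. (0, \<xi>)) \<xi>s" by (rule degrees_A[OF \<xi>s])
  have len: "length a = length fs" "length b = length \<xi>s"
    using arg_cong[OF a(2), of length] arg_cong[OF b(2), of length] by simp_all
  have tagged: "set (a @ b) \<subseteq> tagged" using a b by simp
  have az0: "A_of w = 0" if "w \<in> set a" for w
  proof -
    have "fst w \<in> set (map fst a)" using that by simp
    then show ?thesis unfolding a(2) by auto
  qed
  have mz0: "M_of w = 0" if "w \<in> set b" for w
  proof -
    have "fst w \<in> set (map fst b)" using that by simp
    then show ?thesis unfolding b(2) by auto
  qed
  have "binary_br (a @ b) = 0"
  proof (cases "length a = 0 \<and> length b = 2")
    case True
    then obtain x y where "a = []" "b = [x, y]" by (auto simp: length_Suc_conv numeral_2_eq_2)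
    then show ?thesis using mz0 by (simp add: binary_br_def br_zero tot_closed)
  next
    case False
    then have "length a + length b \<noteq> 2" using assms(3,4) unfolding len by arith
    then show ?thesis by (simp add: binary_br_def)
  qed
  moreover have "higher_sum (a @ b) = 0"
  proof (cases "length (a @ b) \<le> 1")
    case False
    show ?thesis
    proof (rule higher_sum_eq_zero[OF tagged])
      fix z v assume zv: "mset (a @ b) = add_mset z (mset v)"
      have zvHZ: "z \<in> tagged" "set v \<subseteq> tagged"
        using mset_tagged[of "[z]" v "a @ b"] tagged zv by auto
      have "z \<in># mset (a @ b)" unfolding zv by simp
      then consider "z \<in> set b" | "z \<in> set a" by auto
      then show "P (iter (M_of z) v) = 0"
      proof cases
        case 1
        then show ?thesis by (simp add: mz0 iter_linear(5)[OF zvHZ(2)] P_zero)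
      next
        case 2
        then have "length a \<noteq> 0" by auto
        moreover have "\<not> length a + length b \<le> 1" using False by simp
        ultimately have "length a \<ge> 2" using assms(4) unfolding len by arith
        \<comment> \<open>Counting: at least two entries have component 0 in \<open>A\<close>, and
          taking out \<open>z\<close> removes at most one of them.\<close>
        have "filter (\<lambda>w. A_of w = 0) a = a" using az0 by (simp add: filter_id_conv)
        then have "length a \<le> size (filter_mset (\<lambda>w. A_of w = 0) (mset (a @ b)))"
          by (simp flip: mset_filter)
        also have "\<dots> \<le> 1 + size (filter_mset (\<lambda>w. A_of w = 0) (mset v))"
          unfolding zv by simp
        finally have "size (filter_mset (\<lambda>w. A_of w = 0) (mset v)) \<noteq> 0" using \<open>length a \<ge> 2\<close> by linarith
        then obtain w where "w \<in># filter_mset (\<lambda>w. A_of w = 0) (mset v)"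
          by (metis multiset_nonemptyE size_empty)
        then have "w \<in> set v" "A_of w = 0" by simp_all
        then show ?thesis using iter_zero_arg[of "M_of z" v w] zvHZ by (simp add: tagged_D P_zero)
      qed
    qed
  qed (use higher_sum_short[OF tagged] in simp)
  ultimately show ?thesis
    using higher_br_hom[OF tagged refl] a b len by (simp add: zero_prod_def)
qed

end

section \<open>Characterisation of the summands\<close>

lemma (in graded_lie_algebra) graded_lie_algebra_subalgebra:
  assumes "graded_lie_subalgebra s L br K"
  shows "graded_lie_algebra s K br"
proof -
  from assms have K: "subspace (K n)" "K n \<subseteq> L n"
    and br: "x \<in> K m \<Longrightarrow> y \<in> K n \<Longrightarrow> br x y \<in> K (m + n)" for m n x y
    by (auto simp: graded_lie_subalgebra_def)
  have tot: "gtotal s K \<subseteq> gtotal s L" unfolding gtotal_def using K(2) by (intro span_mono) blast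
  show ?thesis
  proof
    show "subspace (K n)" for n by (rule K)
    show "x n = 0" if "finite I" "\<And>n. n \<in> I \<Longrightarrow> x n \<in> K n" "(\<Sum>n\<in>I. x n) = 0" "n \<in> I" for I x n
      using that K(2) by (intro independent_components[of I x n]) auto
    show "linear_on_set s s (gtotal s K) (\<lambda>x. br x y)" "linear_on_set s s (gtotal s K) (br y)"
      if "y \<in> gtotal s K" for y
      using that tot linear_left[of y] linear_right[of y] unfolding linear_on_set_def by blast+
    show "br x y \<in> K (m + n)" if "x \<in> K m" "y \<in> K n" for x y m n by (rule br[OF that])
    show "br x y = - s ((-1) powi (m * n)) (br y x)" if "x \<in> K m" "y \<in> K n" for x y m n
      using that K(2) by (intro antisymmetry) auto
    show "br x (br y z) = br (br x y) z + s ((-1) powi (m * n)) (br y (br x z))"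
      if "x \<in> K m" "y \<in> K n" "z \<in> K r" for x y z m n r
      using that K(2) by (intro jacobi) auto
  qed
qed

text \<open>Every entry is split in two and the pieces are sorted, which produces the signs of
  unshuffles. For the two projections of a direct sum this is the decomposition of its exterior
  powers.\<close>

lemma multilinear_expansion:
  assumes "multilinear s1 s2 f" "gsymmetric (\<lambda>_. 1) UNIV f"
    and split: "\<And>x. x = \<alpha> x + \<beta> x"
  shows "f (w @ xs) = usum (\<lambda>_. 1) (\<lambda>u v. f (w @ map \<alpha> u @ map \<beta> v)) xs"
proof (induction xs arbitrary: w)
  case (Cons x xs)
  have move: "f (w @ y # map \<alpha> u @ t) = msign (int (length u)) (f (w @ map \<alpha> u @ y # t))" for w y u t
  proof (induction u arbitrary: w)
    case (Cons a u)
    have "f (w @ y # map \<alpha> (a # u) @ t) = msign 1 (f ((w @ [\<alpha> a]) @ y # map \<alpha> u @ t))"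
      using gsymmetricD[OF assms(2), of w y "\<alpha> a" "map \<alpha> u @ t"] by simp
    also have "\<dots> = msign 1 (msign (int (length u)) (f ((w @ [\<alpha> a]) @ map \<alpha> u @ y # t)))"
      unfolding Cons.IH ..
    finally show ?case by (simp add: msign_msign)
  qed simp
  have "f (w @ x # xs) = f (w @ \<alpha> x # xs) + f (w @ \<beta> x # xs)"
    by (subst split[of x]) (rule multilinearD(1)[OF assms(1)])
  also have "f (w @ \<alpha> x # xs) = usum (\<lambda>_. 1) (\<lambda>u v. f (w @ map \<alpha> (x # u) @ map \<beta> v)) xs"
    using Cons.IH[of "w @ [\<alpha> x]"] by simp
  also have "f (w @ \<beta> x # xs) = usum (\<lambda>_. 1) (\<lambda>u v. msign (1 * degs (\<lambda>_. 1) u) (f (w @ map \<alpha> u @ map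
    \<beta> (x # v)))) xs"
    using Cons.IH[of "w @ [\<beta> x]"] by (simp add: move degs_one)
  finally show ?case by simp
qed simp

section \<open>The summands of L' as vanishing conditions\<close>

locale hom_sum = g: vector_space sg + h: vector_space sh
  for sg :: "'k::field_char_0 \<Rightarrow> 'g::ab_group_add \<Rightarrow> 'g" and sh :: "'k \<Rightarrow> 'h::ab_group_add \<Rightarrow> 'h"
begin

sublocale vector_space_prod sg sh by unfold_locales
sublocale gh: vector_space_char_0 scale by unfold_locales
sublocale F: vector_space "scale_gh sg sh" by (rule vector_space_fun_scale[OF p.vector_space_axioms])

abbreviation H :: "nat \<Rightarrow> (('g \<times> 'h) list \<Rightarrow> 'g \<times> 'h) set" where "H \<equiv> gh.H"

lemma L'_cases:
  assumes "x \<in> L' sg sh n"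
  obtains "x = 0" "n < 0" | p where "n = int p" "x \<in> H p"
  using gh.hom_bar_cases assms unfolding L'_def by blast

lemma L'_int: "L' sg sh (int p) = H p"
  by (simp add: L'_def)

lemma alt_hom_L':
  assumes "f \<in> alt_hom scale scale (k + l)" "int (k + l) - 1 = n" "k + l \<ge> 1"
  shows "f \<in> L' sg sh n"
proof -
  obtain m where m: "k + l = Suc m" using assms(3) by (cases "k + l") auto
  then have "n = int m" using assms(2) by simp
  then show ?thesis using assms(1) by (simp only: m L'_int Suc_eq_plus1)
qed

lemma subspace_L': "F.subspace (L' sg sh n)"
proof -
  interpret graded_lie_algebra "scale_gh sg sh" "hom_bar scale" "nr_bracket scale"
    by (rule gh.graded_lie_algebra_nr)
  show ?thesis unfolding L'_def by (rule subspace_component)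
qed

text \<open>Arguments from \<hh> are those with \<open>fst\<close> equal to 0. The first clause
  removes the maps into \<gg> with an argument from \<hh>, the second those into \<hh> with
  arguments from \<gg> only; what is left in L' is M'. Likewise \<open>A_cond\<close> leaves the
  maps into \<hh> that take arguments from \<gg> only.\<close>

definition M_cond :: "(('g \<times> 'h) list \<Rightarrow> 'g \<times> 'h) set" where
  "M_cond = {f. (\<forall>xs. (\<exists>x\<in>set xs. fst x = 0) \<longrightarrow> fst (f xs) = 0) \<and>
     (\<forall>xs. (\<forall>x\<in>set xs. snd x = 0) \<longrightarrow> snd (f xs) = 0)}"

definition A_cond :: "(('g \<times> 'h) list \<Rightarrow> 'g \<times> 'h) set" where
  "A_cond = {f. (\<forall>xs. fst (f xs) = 0) \<and> (\<forall>xs. (\<exists>x\<in>set xs. fst x = 0) \<longrightarrow> f xs = 0)}"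

lemma subspace_M_cond: "F.subspace M_cond" and subspace_A_cond: "F.subspace A_cond"
  by (auto simp: F.subspace_def M_cond_def A_cond_def fun_scale_def scale_def zero_prod_def)

text \<open>As \<open>F\<close> vanishes on lists of other lengths, no block lengths have to be
  prescribed, and the general facts about \<open>usum\<close> apply to embedded maps.\<close>

lemma embed_hom_usum:
  assumes F: "F \<in> mixed_hom sg sh sW k l" and j: "j 0 = 0"
  shows "embed_hom sg sh j k l F = usum (\<lambda>_. 1) (\<lambda>u v. j (F (map fst u) (map snd v)))"
proof
  fix xs
  have F0: "F us vs = 0" if "length us \<noteq> k \<or> length vs \<noteq> l" for us vs
    using F that by (auto simp: mixed_hom_def alt_hom_def)
  show "embed_hom sg sh j k l F xs = usum (\<lambda>_. 1) (\<lambda>u v. j (F (map fst u) (map snd v))) xs"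
  proof (cases "length xs = k + l")
    case True
    then have "embed_hom sg sh j k l F xs = (\<Sum>\<sigma>\<in>shuffles_perm k l. scale (koszul_sign \<sigma> (map (\<lambda>_. 1)
      xs))
        ((\<lambda>u v. j (F (map fst u) (map snd v))) (take k (permute_list \<sigma> xs)) (drop k (permute_list \<sigma>
          xs))))"
      using sign_eq_koszul_sign[of _ "k + l", where ?'k = 'k]
      by (auto simp: embed_hom_def map_replicate_const shuffles_perm_def intro!: sum.cong)
    also have "\<dots> = usum (\<lambda>_. 1) (\<lambda>u v. if length u = k then (\<lambda>u v. j (F (map fst u) (map snd v))) u
      v else 0) xs"
      by (rule p.sum_shuffles_perm[OF True])
    also have "\<dots> = usum (\<lambda>_. 1) (\<lambda>u v. j (F (map fst u) (map snd v))) xs"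
      by (rule usum_cong) (simp add: F0 j)
    finally show ?thesis .
  next
    case False
    have "usum (\<lambda>_. 1) (\<lambda>u v. j (F (map fst u) (map snd v))) xs = 0"
    proof (rule usum_eq_zero)
      fix u v assume "mset u + mset v = mset xs"
      then have "length u + length v = length xs" by (metis size_mset size_union)
      then show "j (F (map fst u) (map snd v)) = 0" using False by (simp add: F0 j)
    qed
    then show ?thesis using False by (simp add: embed_hom_def)
  qed
qed

lemma embed_hom_alt:
  assumes F: "F \<in> mixed_hom sg sh sW k l" and j: "Vector_Spaces.linear sW scale j"
  shows "embed_hom sg sh j k l F \<in> alt_hom scale scale (k + l)"
proof -
  interpret j: Vector_Spaces.linear sW scale j by (rule j)
  note vs = g.vector_space_axioms h.vector_space_axioms j.vs1.vector_space_axioms p.vector_space_axioms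
  have 1: "(\<lambda>xs. F xs us) \<in> alt_hom sg sW k" and 2: "F xs \<in> alt_hom sh sW l" for xs us
    using F by (auto simp: mixed_hom_def)
  note ml1 = conjunct1[OF conjunct2[OF 1[unfolded alt_hom_iff[OF vs(1,3)]]]]
  note ml2 = conjunct1[OF conjunct2[OF 2[unfolded alt_hom_iff[OF vs(2,3)]]]]
  note sy1 = conjunct2[OF conjunct2[OF 1[unfolded alt_hom_iff[OF vs(1,3)]]]]
  note sy2 = conjunct2[OF conjunct2[OF 2[unfolded alt_hom_iff[OF vs(2,3)]]]]
  have jm: "j (msign m x) = msign m (j x)" for m x by (simp add: msign_def j.neg)
  show ?thesis
    unfolding alt_hom_iff[OF vs(4,4)]
  proof (intro conjI allI impI)
    show "embed_hom sg sh j k l F xs = 0" if "length xs \<noteq> k + l" for xs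
      using that by (simp add: embed_hom_def)
    show "multilinear scale scale (embed_hom sg sh j k l F)"
      unfolding embed_hom_usum[where j = j, OF F j.zero]
      by (intro multilinear_usum multilinearI vs)
        (simp_all add: scale_def multilinearD[OF ml1] multilinearD[OF ml2] j.add j.scale[unfolded
          scale_def])
    show "gsymmetric (\<lambda>_. 1) UNIV (embed_hom sg sh j k l F)"
      unfolding embed_hom_usum[where j = j, OF F j.zero]
    proof (intro gsymmetric_usum gsymmetricI)
      fix a b v u :: "('g \<times> 'h) list" and x y
      show "j (F (map fst (a @ x # y # b)) (map snd v)) = msign (1 * 1) (j (F (map fst (a @ y # x #
        b)) (map snd v)))"
        using gsymmetricD[OF sy1, of "map fst a" "fst x" "fst y" "map fst b"] by (simp add: jm)
      show "j (F (map fst u) (map snd (a @ x # y # b))) = msign (1 * 1) (j (F (map fst u) (map snd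
        (a @ y # x # b))))"
        using gsymmetricD[OF sy2, of "map snd a" "snd x" "snd y" "map snd b"] by (simp add: jm)
    qed
  qed
qed

lemma linear_inclusions:
  "Vector_Spaces.linear sg scale (\<lambda>x. (x, 0))" "Vector_Spaces.linear sh scale (\<lambda>u. (0, u))"
  unfolding Vector_Spaces.linear_iff
  by (simp_all add: g.vector_space_axioms h.vector_space_axioms p.vector_space_axioms scale_def)

lemma summand_alt:
  "f \<in> summand_g sg sh k l \<Longrightarrow> f \<in> alt_hom scale scale (k + l)"
  "f \<in> summand_h sg sh k l \<Longrightarrow> f \<in> alt_hom scale scale (k + l)"
  using embed_hom_alt linear_inclusions by (auto simp: summand_g_def summand_h_def)

lemma fst_summand_h: "f \<in> summand_h sg sh k l \<Longrightarrow> fst (f xs) = 0"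
  by (auto simp: summand_h_def embed_hom_def fst_sum scale_def)

lemma snd_summand_g: "f \<in> summand_g sg sh k l \<Longrightarrow> snd (f xs) = 0"
  by (auto simp: summand_g_def embed_hom_def snd_sum scale_def)

text \<open>If the part \<open>v\<close> is nonempty, \<open>F\<close> vanishes by length; otherwise
  the argument from \<hh> becomes a zero entry of an alternating map.\<close>

lemma embed_hom_zero_arg:
  assumes F: "F \<in> mixed_hom sg sh sW k 0" and j: "j 0 = 0" and x: "x \<in> set xs" "fst x = 0"
  shows "embed_hom sg sh j k 0 F xs = 0"
  unfolding embed_hom_usum[where j = j, OF F j]
proof (rule usum_eq_zero)
  fix u v assume uv: "mset u + mset v = mset xs"
  have "F (map fst u) (map snd v) = 0"
  proof (cases "v = []")
    case True
    then have "x \<in> set u" using uv x by (metis mset.simps(1) add.right_neutral set_mset_mset)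
    then have "0 \<in> set (map fst u)" using x(2) by force
    then show ?thesis using F by (intro alt_hom_zero_entry[of "\<lambda>xs. F xs _" sg sW k]) (auto simp:
      mixed_hom_def)
  next
    case False
    then show ?thesis using F by (auto simp: mixed_hom_def alt_hom_def)
  qed
  then show "j (F (map fst u) (map snd v)) = 0" using j by simp
qed

lemma summand_g_M_cond: "f \<in> summand_g sg sh k 0 \<Longrightarrow> f \<in> M_cond"
  using snd_summand_g[of f k 0] by (auto simp: M_cond_def summand_g_def embed_hom_zero_arg
    zero_prod_def)

lemma summand_h_A_cond: "f \<in> summand_h sg sh k 0 \<Longrightarrow> f \<in> A_cond"
  using fst_summand_h[of f k 0] by (auto simp: A_cond_def summand_h_def embed_hom_zero_arg
    zero_prod_def)

lemma summand_h_M_cond: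
  assumes f: "f \<in> summand_h sg sh k l" and l: "l \<ge> 1"
  shows "f \<in> M_cond"
proof -
  have "snd (f xs) = 0" if "\<forall>x\<in>set xs. snd x = 0" for xs
  proof -
    have "P' f xs = 0" using P'_summand_h[OF g.vector_space_axioms h.vector_space_axioms f l] by simp
    moreover have "map (\<lambda>v. (fst v, 0)) xs = xs" using that by (intro map_idI) (auto simp: prod_eq_iff)
    ultimately show ?thesis by (simp add: P'_def zero_prod_def)
  qed
  then show ?thesis using fst_summand_h[OF f] by (auto simp: M_cond_def)
qed

lemma M'_subset: "M' sg sh n \<subseteq> L' sg sh n \<inter> M_cond"
  unfolding M'_def
proof (rule F.span_minimal)
  show "F.subspace (L' sg sh n \<inter> M_cond)" by (intro F.subspace_inter subspace_L' subspace_M_cond)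
  show "\<Union> {summand_g sg sh k 0 |k. 1 \<le> k \<and> int k - 1 = n} \<union>
    \<Union> {summand_h sg sh k l |k l. 1 \<le> k \<and> 1 \<le> l \<and> int (k + l) - 1 = n} \<union>
    \<Union> {summand_h sg sh 0 l |l. 1 \<le> l \<and> int l - 1 = n} \<subseteq> L' sg sh n \<inter> M_cond"
    using alt_hom_L'[OF summand_alt(1)[of _ _ 0]] alt_hom_L'[OF summand_alt(2)] alt_hom_L'[OF
      summand_alt(2)[of _ 0]]
      summand_g_M_cond summand_h_M_cond by fastforce
qed

lemma A'_subset: "A' sg sh n \<subseteq> L' sg sh n \<inter> A_cond"
  unfolding A'_def
proof (rule F.span_minimal)
  show "F.subspace (L' sg sh n \<inter> A_cond)" by (intro F.subspace_inter subspace_L' subspace_A_cond)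
  show "\<Union> {summand_h sg sh k 0 |k. 1 \<le> k \<and> int k - 1 = n} \<subseteq> L' sg sh n \<inter> A_cond"
    using alt_hom_L'[OF summand_alt(2)[of _ _ 0]] summand_h_A_cond by fastforce
qed

text \<open>Supplies the preimages under \<open>embed_hom\<close> for the reverse inclusions;
  \<open>pr\<close> will be one of the two projections of the target.\<close>

definition part :: "('g \<times> 'h \<Rightarrow> 'w) \<Rightarrow> (('g \<times> 'h) list \<Rightarrow> 'g \<times> 'h) \<Rightarrow> nat \<Rightarrow> nat \<Rightarrow> 'g list \<Rightarrow> 'h list \<Rightarrow>
  'w::zero" where
  "part pr f k l us vs = (if length us = k \<and> length vs = l
     then pr (f (map (\<lambda>x. (x, 0)) us @ map (\<lambda>u. (0, u)) vs)) else 0)"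

lemma part_map: "part pr f k l (map fst u) (map snd v) = (if length u = k \<and> length v = l
    then pr (f (map (\<lambda>v. (fst v, 0)) u @ map (\<lambda>v. (0, snd v)) v)) else 0)"
  by (simp add: part_def comp_def)

lemma part_mixed_hom:
  assumes f: "f \<in> H n" and pr: "Vector_Spaces.linear scale sW pr"
  shows "part pr f k l \<in> mixed_hom sg sh sW k l"
proof -
  interpret pr: Vector_Spaces.linear scale sW pr by (rule pr)
  note vs = g.vector_space_axioms h.vector_space_axioms pr.vs2.vector_space_axioms
  note ml = multilinearD[OF gh.H_multilinear[OF f]]
  have scale_incl: "scale c (x, 0) = (sg c x, 0)" "scale c (0, u) = (0, sh c u)" for x u c
    by (simp_all add: scale_def)
  show ?thesis
    unfolding mixed_hom_def mem_Collect_eq alt_hom_iff[OF vs(1,3)] alt_hom_iff[OF vs(2,3)]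
  proof (intro conjI allI multilinearI vs gsymmetricI)
    fix us vs and a b :: "'g list" and x y c
    show "part pr f k l (a @ (x + y) # b) us = part pr f k l (a @ x # b) us + part pr f k l (a @ y #
      b) us"
      using ml(1)[of "map (\<lambda>x. (x, 0)) a" "(x, 0)" "(y, 0)"] by (simp add: part_def pr.add)
    show "part pr f k l (a @ sg c x # b) us = sW c (part pr f k l (a @ x # b) us)"
      using ml(2)[of "map (\<lambda>x. (x, 0)) a" c "(x, 0)"] by (simp add: part_def scale_incl pr.scale)
    show "part pr f k l (a @ x # y # b) us = msign (1 * 1) (part pr f k l (a @ y # x # b) us)"
      using gh.H_antisym[OF f, of "map (\<lambda>x. (x, 0)) a" "(x, 0)" "(y, 0)" "map (\<lambda>x. (x, 0)) b @ map
        (\<lambda>u. (0, u)) us"]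
      by (simp add: part_def msign_def pr.neg)
  next
    fix us and a b :: "'h list" and x y c
    show "part pr f k l us (a @ (x + y) # b) = part pr f k l us (a @ x # b) + part pr f k l us (a @
      y # b)"
      using ml(1)[of "map (\<lambda>x. (x, 0)) us @ map (\<lambda>u. (0, u)) a" "(0, x)" "(0, y)"] by (simp add:
        part_def pr.add)
    show "part pr f k l us (a @ sh c x # b) = sW c (part pr f k l us (a @ x # b))"
      using ml(2)[of "map (\<lambda>x. (x, 0)) us @ map (\<lambda>u. (0, u)) a" c "(0, x)"] by (simp add: part_def
        scale_incl pr.scale)
    show "part pr f k l us (a @ x # y # b) = msign (1 * 1) (part pr f k l us (a @ y # x # b))"
      using gh.H_antisym[OF f, of "map (\<lambda>x. (x, 0)) us @ map (\<lambda>u. (0, u)) a" "(0, x)" "(0, y)" "map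
        (\<lambda>u. (0, u)) b"]
      by (simp add: part_def msign_def pr.neg)
  qed (simp_all add: part_def)
qed

lemma linear_projections: "Vector_Spaces.linear scale sg fst" "Vector_Spaces.linear scale sh snd"
  unfolding Vector_Spaces.linear_iff
  by (simp_all add: g.vector_space_axioms h.vector_space_axioms p.vector_space_axioms scale_def)

lemma H_expansion:
  assumes "f \<in> H p"
  shows "f xs = usum (\<lambda>_. 1) (\<lambda>u v. f (map (\<lambda>v. (fst v, 0)) u @ map (\<lambda>v. (0, snd v)) v)) xs"
proof -
  have "gsymmetric (\<lambda>_. 1) UNIV f"
    using assms unfolding alt_hom_iff[OF p.vector_space_axioms p.vector_space_axioms] by blast
  from multilinear_expansion[OF gh.H_multilinear[OF assms] this, of "\<lambda>v. (fst v, 0)" "\<lambda>v. (0, snd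
    v)" "[]" xs]
  show ?thesis by simp
qed

text \<open>\<open>f\<close> is expanded over splittings into arguments from \<gg> and from \<hh>.
  By \<open>M_cond\<close>, a term without arguments from \<hh> takes values in \<gg> and a term
  with such arguments takes values in \<hh>; the latter are sorted by the number \<open>l\<close> of
  these arguments.\<close>

lemma M'_supset: "L' sg sh n \<inter> M_cond \<subseteq> M' sg sh n"
proof
  fix f assume f: "f \<in> L' sg sh n \<inter> M_cond"
  from f have "f \<in> L' sg sh n" by blast
  then show "f \<in> M' sg sh n"
  proof (cases rule: L'_cases)
    case 1
    then show ?thesis by (simp add: M'_def F.span_zero)
  next
    case (2 p)
    let ?G = "embed_hom sg sh (\<lambda>x. (x, 0)) (p + 1) 0 (part fst f (p + 1) 0)"
    let ?E = "\<lambda>l. embed_hom sg sh (\<lambda>u. (0, u)) (p + 1 - l) l (part snd f (p + 1 - l) l)"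
    note mix = part_mixed_hom[OF 2(2) linear_projections(1)] part_mixed_hom[OF 2(2)
      linear_projections(2)]
    have "f xs = (?G + (\<Sum>l=1..p + 1. ?E l)) xs" for xs
    proof -
      have "f xs = usum (\<lambda>_. 1) (\<lambda>u v. (part fst f (p + 1) 0 (map fst u) (map snd v), 0) +
          (\<Sum>l=1..p + 1. (0 :: 'g, part snd f (p + 1 - l) l (map fst u) (map snd v)))) xs"
        unfolding H_expansion[OF 2(2), of xs]
      proof (rule usum_cong)
        fix u v :: "('g \<times> 'h) list"
        let ?w = "map (\<lambda>v. (fst v, 0)) u @ map (\<lambda>v. (0, snd v)) v"
        have "(\<Sum>l=1..p + 1. (0 :: 'g, part snd f (p + 1 - l) l (map fst u) (map snd v))) =
          (\<Sum>l=1..p + 1. if length v = l then (if length u + length v = p + 1 then (0, snd (f ?w))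
          else 0) else 0)"
          by (intro sum.cong) (auto simp: part_map zero_prod_def)
        also have "\<dots> = (if length v \<ge> 1 \<and> length u + length v = p + 1 then (0, snd (f ?w)) else 0)"
          by (auto simp: sum.delta')
        finally have S: "(\<Sum>l=1..p + 1. (0 :: 'g, part snd f (p + 1 - l) l (map fst u) (map snd v))) =
          (if length v \<ge> 1 \<and> length u + length v = p + 1 then (0, snd (f ?w)) else 0)" .
        show "f ?w = (part fst f (p + 1) 0 (map fst u) (map snd v), 0) +
          (\<Sum>l=1..p + 1. (0 :: 'g, part snd f (p + 1 - l) l (map fst u) (map snd v)))"
        proof (cases "length u + length v = p + 1")
          case True
          show ?thesis
          proof (cases v)
            case Nil
            have "snd (f ?w) = 0" using f Nil by (auto simp: M_cond_def)
            then show ?thesis using True Nil unfolding S unfolding part_map by (simp add: prod_eq_iff)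
          next
            case (Cons y v')
            have "\<exists>x\<in>set ?w. fst x = 0" using Cons by auto
            then have "fst (f ?w) = 0" using f unfolding M_cond_def by blast
            then show ?thesis using True Cons unfolding S unfolding part_map by (simp add: prod_eq_iff)
          qed
        next
          case False
          then have "f ?w = 0" using gh.H_off[OF 2(2)] by simp
          then show ?thesis using False unfolding S unfolding part_map by (auto simp: zero_prod_def)
        qed
      qed
      also have "\<dots> = (?G + (\<Sum>l=1..p + 1. ?E l)) xs"
        by (simp add: usum_add usum_sum[symmetric] sum_apply_fun embed_hom_usum[OF mix(1)]
            embed_hom_usum[OF mix(2)] zero_prod_def[symmetric] del: of_nat_Suc sum.cl_ivl_Suc)
      finally show ?thesis .
    qed
    then have eq: "f = ?G + (\<Sum>l=1..p + 1. ?E l)" by blast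
    have G: "?G \<in> M' sg sh n"
      unfolding M'_def
      by (intro F.span_base UnI1 UnionI[of "summand_g sg sh (p + 1) 0"])
         (use mix 2(1) in \<open>auto simp: summand_g_def\<close>)
    \<comment> \<open>The value \<open>l = p + 1\<close> belongs to the maps with all arguments in
      \<hh>, the smaller values to the mixed ones.\<close>
    have "?E l \<in> M' sg sh n" if "l \<in> {1..p + 1}" for l
    proof (cases "l = p + 1")
      case True
      show ?thesis
        unfolding M'_def
        by (intro F.span_base UnI2 UnionI[of "summand_h sg sh 0 l"])
           (use True mix(2)[of 0 l] 2(1) in \<open>auto simp: summand_h_def\<close>)
    next
      case False
      then have k: "p + 1 - l \<ge> 1" "p + 1 - l + l = p + 1" "l \<ge> 1" using that by auto
      show ?thesis
        unfolding M'_def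
        by (intro F.span_base UnI1[OF UnI2] UnionI[of "summand_h sg sh (p + 1 - l) l"])
           (use k mix(2)[of "p + 1 - l" l] 2(1) in \<open>force simp: summand_h_def\<close>)+
    qed
    then have "(\<Sum>l=1..p + 1. ?E l) \<in> M' sg sh n"
      unfolding M'_def by (intro F.span_sum)
    then show ?thesis using G F.span_add unfolding M'_def eq[symmetric] by (subst eq) (rule F.span_add)
  qed
qed

lemma A'_supset: "L' sg sh n \<inter> A_cond \<subseteq> A' sg sh n"
proof
  fix f assume f: "f \<in> L' sg sh n \<inter> A_cond"
  from f have "f \<in> L' sg sh n" by blast
  then show "f \<in> A' sg sh n"
  proof (cases rule: L'_cases)
    case 1
    then show ?thesis by (simp add: A'_def F.span_zero)
  next
    case (2 p)
    let ?E = "embed_hom sg sh (\<lambda>u. (0, u)) (p + 1) 0 (part snd f (p + 1) 0)"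
    note mix = part_mixed_hom[OF 2(2) linear_projections(2)]
    have "f xs = ?E xs" for xs
    proof -
      have "f xs = usum (\<lambda>_. 1) (\<lambda>u v. (0, part snd f (p + 1) 0 (map fst u) (map snd v))) xs"
        unfolding H_expansion[OF 2(2), of xs]
      proof (rule usum_cong)
        fix u v :: "('g \<times> 'h) list"
        let ?w = "map (\<lambda>v. (fst v, 0)) u @ map (\<lambda>v. (0, snd v)) v"
        have "f ?w = 0" if "v \<noteq> []"
        proof -
          have "\<exists>x\<in>set ?w. fst x = 0" using that by (cases v) auto
          then show ?thesis using f unfolding A_cond_def by blast
        qed
        moreover have "f ?w = 0" if "length u + length v \<noteq> p + 1" using gh.H_off[OF 2(2)] that by simp
        moreover have "fst (f ?w) = 0" using f unfolding A_cond_def by blast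
        ultimately show "f ?w = (0, part snd f (p + 1) 0 (map fst u) (map snd v))"
          by (cases "v = []"; cases "length u + length v = p + 1") (simp_all add: part_def comp_def
          prod_eq_iff)
      qed
      then show ?thesis by (simp add: embed_hom_usum[OF mix] zero_prod_def[symmetric])
    qed
    then have "f = ?E" by blast
    moreover have "?E \<in> A' sg sh n"
      unfolding A'_def
      by (intro F.span_base UnionI[of "summand_h sg sh (p + 1) 0"])
         (use mix 2(1) in \<open>auto simp: summand_h_def\<close>)
    ultimately show ?thesis by simp
  qed
qed

lemma M'_eq: "M' sg sh n = L' sg sh n \<inter> M_cond"
  using M'_subset M'_supset by blast

lemma A'_eq: "A' sg sh n = L' sg sh n \<inter> A_cond"
  using A'_subset A'_supset by blast

end

section \<open>The generalised V-datum\<close>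

context hom_sum
begin

section \<open>Closure of the vanishing conditions under composition\<close>

definition ker_cond :: "(('g \<times> 'h) list \<Rightarrow> 'g \<times> 'h) set" where
  "ker_cond = {f. \<forall>xs. (\<forall>x\<in>set xs. snd x = 0) \<longrightarrow> snd (f xs) = 0}"

lemma P'_eq_0_iff: "P' f = 0 \<longleftrightarrow> f \<in> ker_cond"
proof
  assume P: "P' f = 0"
  have "snd (f xs) = 0" if "\<forall>x\<in>set xs. snd x = 0" for xs
  proof -
    have "map (\<lambda>v. (fst v, 0)) xs = xs" using that by (intro map_idI) (auto simp: prod_eq_iff)
    then show ?thesis using fun_cong[OF P, of xs] by (simp add: P'_def zero_prod_def)
  qed
  then show "f \<in> ker_cond" by (simp add: ker_cond_def)
next
  assume "f \<in> ker_cond"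
  then show "P' f = 0" by (auto simp: ker_cond_def P'_def fun_eq_iff zero_prod_def)
qed

text \<open>On arguments from \<gg> the inner map takes values in \<gg>, so the outer map again
  receives arguments from \<gg> only.\<close>

lemma nr_circ_ker_cond:
  assumes f: "f \<in> ker_cond" and g: "g \<in> ker_cond"
  shows "nr_circ f g \<in> ker_cond"
proof -
  have "snd (nr_circ f g xs) = 0" if x: "\<forall>x\<in>set xs. snd x = 0" for xs
  proof -
    have "nr_circ f g xs \<in> {y. snd y = 0}"
      unfolding nr_circ_def
    proof (rule usum_closed)
      fix u v assume "mset u + mset v = mset xs"
      then have "set u \<union> set v = set xs" by (metis set_mset_mset set_mset_union)
      then have uv: "\<forall>x\<in>set u. snd x = 0" "\<forall>x\<in>set v. snd x = 0" using x by blast+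
      then have "snd (g u) = 0" using g unfolding ker_cond_def by blast
      then have "\<forall>x\<in>set (g u # v). snd x = 0" using uv by simp
      then have "snd (f (g u # v)) = 0" using f unfolding ker_cond_def by blast
      then show "f (g u # v) \<in> {y. snd y = 0}" by blast
    qed auto
    then show ?thesis by simp
  qed
  then show ?thesis unfolding ker_cond_def by blast
qed

text \<open>An argument from \<hh> either enters \<open>g\<close>, whose value then lies in \<hh>,
  or is passed directly to \<open>f\<close>; in both cases \<open>f\<close> has an argument from
  \<hh>.\<close>

lemma nr_circ_M_cond:
  assumes f: "f \<in> M_cond" and g: "g \<in> M_cond"
  shows "nr_circ f g \<in> M_cond"
proof -
  have "fst (nr_circ f g xs) = 0" if x: "x \<in> set xs" "fst x = 0" for xs x
  proof -
    have "nr_circ f g xs \<in> {y. fst y = 0}"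
      unfolding nr_circ_def
    proof (rule usum_closed)
      fix u v assume "mset u + mset v = mset xs"
      then have "set u \<union> set v = set xs" by (metis set_mset_mset set_mset_union)
      then consider "\<exists>x\<in>set u. fst x = 0" | "\<exists>x\<in>set v. fst x = 0" using x by blast
      then have "\<exists>x\<in>set (g u # v). fst x = 0"
      proof cases
        case 1
        then have "fst (g u) = 0" using g unfolding M_cond_def by blast
        then show ?thesis by simp
      qed simp
      then have "fst (f (g u # v)) = 0" using f unfolding M_cond_def by blast
      then show "f (g u # v) \<in> {y. fst y = 0}" by blast
    qed auto
    then show ?thesis by simp
  qed
  moreover have "nr_circ f g \<in> ker_cond" using f g by (intro nr_circ_ker_cond) (auto simp:
    M_cond_def ker_cond_def)
  ultimately show ?thesis unfolding M_cond_def ker_cond_def by blast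
qed

sublocale L: graded_lie_algebra "scale_gh sg sh" "L' sg sh" "nr_gh sg sh"
  unfolding L'_def by (rule gh.graded_lie_algebra_nr)

lemma subspace_ker_cond: "F.subspace ker_cond"
  by (auto simp: F.subspace_def ker_cond_def fun_scale_def scale_def)

lemma subspace_uminus: "F.subspace S \<Longrightarrow> f \<in> S \<Longrightarrow> msign m f \<in> S"
  by (simp add: msign_def F.subspace_neg)

text \<open>The bracket of homogeneous elements is a signed difference of two compositions, so
  closure of a subspace under \<open>nr_circ\<close> suffices.\<close>

lemma graded_lie_subalgebra_circ:
  assumes S: "F.subspace S" and nr_circ: "\<And>f g. f \<in> S \<Longrightarrow> g \<in> S \<Longrightarrow> nr_circ f g \<in> S"
  shows "graded_lie_subalgebra (scale_gh sg sh) (L' sg sh) (nr_gh sg sh) (\<lambda>n. L' sg sh n \<inter> S)"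
proof -
  have "nr_gh sg sh x y \<in> S" if x: "x \<in> L' sg sh m" "x \<in> S" and y: "y \<in> L' sg sh n" "y \<in> S" for x y m n
    using x(1)
  proof (cases rule: L'_cases)
    case 1
    have "y \<in> gtotal (scale_gh sg sh) (hom_bar scale)"
      using y(1) by (auto simp: gtotal_def L'_def intro!: F.span_base)
    then show ?thesis using 1 gh.nr_bracket_zero F.subspace_0[OF S] by simp
  next
    case (2 p)
    note p = this
    show ?thesis using y(1)
    proof (cases rule: L'_cases)
      case 1
      have "x \<in> gtotal (scale_gh sg sh) (hom_bar scale)"
        using x(1) by (auto simp: gtotal_def L'_def intro!: F.span_base)
      then show ?thesis using 1 gh.nr_bracket_zero F.subspace_0[OF S] by simp
    next
      case (2 q)
      show ?thesis
        unfolding gh.nr_bracket_H[OF p(2) 2(2)]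
        by (intro F.subspace_diff[OF S] subspace_uminus[OF S] nr_circ x y)
    qed
  qed
  then show ?thesis
    unfolding graded_lie_subalgebra_def
    using L.bracket_degree by (auto intro: F.subspace_inter subspace_L' S)
qed

text \<open>The inner map takes values in \<hh>, where the outer map vanishes; each of the two
  compositions is already zero.\<close>

lemma nr_A_cond:
  assumes f: "f \<in> A_cond" and g: "g \<in> A_cond"
  shows "nr_gh sg sh f g = 0"
proof -
  have "nr_comp scale p q f g xs = 0" if "f \<in> A_cond" "g \<in> A_cond" for p q f g xs
  proof -
    have "f (g u # v) = 0" for u v
    proof -
      have "\<exists>x\<in>set (g u # v). fst x = 0" using that(2) by (auto simp: A_cond_def)
      then show ?thesis using that(1) unfolding A_cond_def by blast
    qed
    then show ?thesis by (simp add: nr_comp_def)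
  qed
  then show ?thesis using assms by (simp add: nr_bracket_def fun_eq_iff case_prod_beta)
qed

lemma M'_subalgebra: "graded_lie_subalgebra (scale_gh sg sh) (L' sg sh) (nr_gh sg sh) (M' sg sh)"
  using graded_lie_subalgebra_circ[OF subspace_M_cond nr_circ_M_cond] by (simp add: M'_eq[abs_def])

lemma A'_subalgebra: "graded_lie_subalgebra (scale_gh sg sh) (L' sg sh) (nr_gh sg sh) (A' sg sh)"
proof -
  have "F.subspace (A' sg sh n)" for n
    unfolding A'_eq by (intro F.subspace_inter subspace_L' subspace_A_cond)
  then show ?thesis
    unfolding graded_lie_subalgebra_def
    by (auto simp: nr_A_cond A'_eq F.subspace_0[OF subspace_L'] F.subspace_0[OF subspace_A_cond])
qed

lemma P'_kernel_subalgebra: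
  "graded_lie_subalgebra (scale_gh sg sh) (L' sg sh) (nr_gh sg sh) (\<lambda>n. {x \<in> L' sg sh n. P' x = 0})"
proof -
  have "(\<lambda>n. {x \<in> L' sg sh n. P' x = 0}) = (\<lambda>n. L' sg sh n \<inter> ker_cond)"
    using P'_eq_0_iff by auto
  then show ?thesis using graded_lie_subalgebra_circ[OF subspace_ker_cond nr_circ_ker_cond] by simp
qed

lemma P'_add: "P' (f + g) = P' f + P' g" and P'_scale: "P' (scale_gh sg sh c f) = scale_gh sg sh c
  (P' f)"
  by (auto simp: P'_def fun_eq_iff fun_scale_def scale_def)

text \<open>\<open>P'\<close> projects the arguments to \<gg> and the value to \<hh>. Both
  projections are linear, so the map stays alternating, and an argument from \<hh> is replaced by
  0.\<close>

lemma P'_mem_A':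
  assumes "f \<in> L' sg sh n" shows "P' f \<in> A' sg sh n"
  using assms
proof (cases rule: L'_cases)
  case 1
  moreover have "0 \<in> L' sg sh n" "0 \<in> A_cond"
    by (rule F.subspace_0 subspace_L' subspace_A_cond)+
  moreover have "P' 0 = (0 :: ('g \<times> 'h) list \<Rightarrow> 'g \<times> 'h)" by (simp add: P'_def fun_eq_iff zero_prod_def)
  ultimately show ?thesis by (simp add: A'_eq)
next
  case (2 p)
  note ml = multilinearD[OF gh.H_multilinear[OF 2(2)]]
  let ?\<pi> = "\<lambda>v :: 'g \<times> 'h. (fst v, 0 :: 'h)"
  have "P' f \<in> H p"
    unfolding alt_hom_iff[OF p.vector_space_axioms p.vector_space_axioms]
  proof (intro conjI allI impI multilinearI p.vector_space_axioms gsymmetricI)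
    show "P' f xs = 0" if "length xs \<noteq> p + 1" for xs
      using gh.H_off[OF 2(2)] that by (simp add: P'_def zero_prod_def)
    fix a b x y c
    show "P' f (a @ (x + y) # b) = P' f (a @ x # b) + P' f (a @ y # b)"
      using ml(1)[of "map ?\<pi> a" "?\<pi> x" "?\<pi> y" "map ?\<pi> b"] by (simp add: P'_def)
    show "P' f (a @ scale c x # b) = scale c (P' f (a @ x # b))"
      using ml(2)[of "map ?\<pi> a" c "?\<pi> x" "map ?\<pi> b"] by (simp add: P'_def scale_def)
    show "P' f (a @ x # y # b) = msign (1 * 1) (P' f (a @ y # x # b))"
      using gh.H_antisym[OF 2(2), of "map ?\<pi> a" "?\<pi> x" "?\<pi> y" "map ?\<pi> b"]
      by (simp add: P'_def msign_def)
  qed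
  moreover have "P' f \<in> A_cond"
  proof -
    have "P' f xs = 0" if "x \<in> set xs" "fst x = 0" for xs x
    proof -
      obtain a b where "xs = a @ x # b" using split_list[OF \<open>x \<in> set xs\<close>] by blast
      then show ?thesis
        using ml(3)[of "map ?\<pi> a" "map ?\<pi> b"] that by (simp add: P'_def zero_prod_def)
    qed
    then show ?thesis by (auto simp: A_cond_def P'_def)
  qed
  ultimately show ?thesis using 2 by (simp add: A'_eq L'_int)
qed

lemma P'_linear: "graded_linear (scale_gh sg sh) (L' sg sh) (scale_gh sg sh) (A' sg sh) P'"
  by (auto simp: graded_linear_def linear_on_set_def P'_add P'_scale P'_mem_A')

lemma P'_A': "a \<in> A' sg sh n \<Longrightarrow> P' a = a"
proof -
  have "F.subspace {a. P' a = a}"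
    by (auto simp: F.subspace_def P'_add P'_scale) (simp add: P'_def fun_eq_iff zero_prod_def)
  then have "A' sg sh n \<subseteq> {a. P' a = a}"
    unfolding A'_def using P'_summand_h_0[OF g.vector_space_axioms h.vector_space_axioms]
    by (intro F.span_minimal) auto
  then show "a \<in> A' sg sh n \<Longrightarrow> P' a = a" by blast
qed

lemma gtotal_subspace:
  assumes "F.subspace S" "\<And>n. K n \<subseteq> S" shows "gtotal (scale_gh sg sh) K \<subseteq> S"
  unfolding gtotal_def using assms by (intro F.span_minimal) auto

lemma hom_sum_V_datum:
  "generalised_V_datum
     (scale_gh sg sh) (L' sg sh) (nr_gh sg sh)
     (scale_gh sg sh) (M' sg sh) (nr_gh sg sh)
     (scale_gh sg sh) (A' sg sh) (nr_gh sg sh)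
     (\<lambda>f. f) (\<lambda>\<xi>. \<xi>) P' 0"
proof (intro generalised_V_datum.intro generalised_V_datum_axioms.intro)
  show "graded_lie_algebra (scale_gh sg sh) (L' sg sh) (nr_gh sg sh)" by (rule
    L.graded_lie_algebra_axioms)
  show "graded_lie_algebra (scale_gh sg sh) (M' sg sh) (nr_gh sg sh)"
    by (rule L.graded_lie_algebra_subalgebra[OF M'_subalgebra])
  show "graded_lie_algebra (scale_gh sg sh) (A' sg sh) (nr_gh sg sh)"
    by (rule L.graded_lie_algebra_subalgebra[OF A'_subalgebra])
  show "graded_lie_hom (scale_gh sg sh) (M' sg sh) (nr_gh sg sh) (scale_gh sg sh) (L' sg sh) (nr_gh
    sg sh) (\<lambda>f. f)"
    "graded_lie_hom (scale_gh sg sh) (A' sg sh) (nr_gh sg sh) (scale_gh sg sh) (L' sg sh) (nr_gh sg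
      sh) (\<lambda>f. f)"
    by (auto simp: graded_lie_hom_def graded_linear_def linear_on_set_def M'_eq A'_eq)
  show "nr_gh sg sh a b = 0"
    if "a \<in> gtotal (scale_gh sg sh) (A' sg sh)" "b \<in> gtotal (scale_gh sg sh) (A' sg sh)" for a b
    using gtotal_subspace[OF subspace_A_cond, of "A' sg sh"] that by (intro nr_A_cond) (auto simp:
      A'_eq)
  show "P' a = a" if "a \<in> gtotal (scale_gh sg sh) (A' sg sh)" for a
  proof -
    have "F.subspace {a. P' a = a}"
      by (auto simp: F.subspace_def P'_add P'_scale) (simp add: P'_def fun_eq_iff zero_prod_def)
    from gtotal_subspace[OF this, of "A' sg sh"] show ?thesis using that P'_A' by blast
  qed
  \<comment> \<open>As \<Delta> is 0, its conditions concern only brackets with 0.\<close>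
  have z: "nr_gh sg sh 0 f = 0" if "f \<in> gtotal (scale_gh sg sh) (L' sg sh)" for f
    using gh.nr_bracket_zero(1) that by (simp add: L'_def)
  show "nr_gh sg sh 0 0 = 0" by (rule z) (simp add: gtotal_def F.span_zero)
  show "nr_gh sg sh 0 x \<in> (\<lambda>f. f) ` gtotal (scale_gh sg sh) (M' sg sh)"
    if "x \<in> gtotal (scale_gh sg sh) (M' sg sh)" for x
  proof -
    have "x \<in> gtotal (scale_gh sg sh) (L' sg sh)"
      using that M'_eq F.span_mono[of "\<Union>n. M' sg sh n" "\<Union>n. L' sg sh n"] unfolding gtotal_def by blast
    then show ?thesis using z by (simp add: gtotal_def F.span_zero)
  qed
  show "0 \<in> L' sg sh 1" by (rule F.subspace_0[OF subspace_L'])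
  show "P' 0 = (0 :: ('g \<times> 'h) list \<Rightarrow> 'g \<times> 'h)" by (simp add: P'_def fun_eq_iff zero_prod_def)
qed (simp_all add: P'_linear P'_kernel_subalgebra)

text \<open>Elements of degree \<open>n\<close> are supported on lists of length
  \<open>n + 1\<close>, so restriction to lists of odd length is the even part, and it is linear on
  all functions.\<close>

lemma hom_sum_strict_V_datum:
  "strict_V_datum (scale_gh sg sh) (L' sg sh) (nr_gh sg sh) (M' sg sh) (A' sg sh) P'
     (\<lambda>f xs. if odd (length xs) then f xs else 0)"
proof (intro strict_V_datum.intro strict_V_datum_axioms.intro L.graded_lie_algebra_axioms
    M'_subalgebra A'_subalgebra P'_linear P'_kernel_subalgebra P'_A')
  show "nr_gh sg sh a b = 0" if "a \<in> A' sg sh m" "b \<in> A' sg sh n" for a b m n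
    using that by (simp add: A'_eq nr_A_cond)
  show "P' x = 0" if "x \<in> M' sg sh n" for x n
    using that unfolding P'_eq_0_iff by (auto simp: M'_eq M_cond_def ker_cond_def)
  show "linear_on_set (scale_gh sg sh) (scale_gh sg sh) (gtotal (scale_gh sg sh) (L' sg sh))
     (\<lambda>f xs. if odd (length xs) then f xs else 0)"
    by (auto simp: linear_on_set_def fun_eq_iff fun_scale_def)
  show "(\<lambda>xs. if odd (length xs) then x xs else 0) = (if even n then x else 0)" if "x \<in> L' sg sh n"
    for x n
    using that
  proof (cases rule: L'_cases)
    case (2 p)
    then have "x xs = 0" if "even (length xs) = even n" for xs
      using that by (intro gh.H_off[OF 2(2)]) auto
    then show ?thesis by (auto simp: fun_eq_iff)
  qed (auto simp: fun_eq_iff)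
qed

end

theorem proposition4p15:
  fixes sg :: "'k::field_char_0 \<Rightarrow> 'g::ab_group_add \<Rightarrow> 'g"
    and sh :: "'k \<Rightarrow> 'h::ab_group_add \<Rightarrow> 'h"
    and lam :: 'k
  assumes "vector_space sg" and "vector_space sh"
  shows "generalised_V_datum
           (scale_gh sg sh) (L' sg sh) (nr_gh sg sh)
           (scale_gh sg sh) (M' sg sh) (nr_gh sg sh)
           (scale_gh sg sh) (A' sg sh) (nr_gh sg sh)
           (\<lambda>f. f) (\<lambda>\<xi>. \<xi>) P' 0
    \<and> (\<exists>l.
      L_infinity_1_algebra (module_prod.scale (scale_gh sg sh) (scale_gh sg sh))
        (gsum (gshift (M' sg sh)) (A' sg sh)) l \<and>
      (\<forall>p q. \<forall>f\<in>M' sg sh p. \<forall>g\<in>M' sg sh q.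
         l 2 [(f, 0), (g, 0)] = (scale_gh sg sh ((-1) powi p) (nr_gh sg sh f g), 0)) \<and>
      (\<forall>i\<ge>2. \<forall>p. \<forall>f\<in>M' sg sh p. \<forall>\<xi>s. length \<xi>s = i - 1 \<and> set \<xi>s \<subseteq> (\<Union>q. A' sg sh q) \<longrightarrow>
         l i ((f, 0) # map (\<lambda>\<xi>. (0, \<xi>)) \<xi>s) =
           (0, scale_gh sg sh (lam ^ (i - 2)) (P' (foldl (nr_gh sg sh) f \<xi>s)))) \<and>
      (\<forall>fs \<xi>s. set fs \<subseteq> (\<Union>p. M' sg sh p) \<and> set \<xi>s \<subseteq> (\<Union>q. A' sg sh q) \<and>
         length fs + length \<xi>s \<ge> 1 \<and>
         \<not> (length fs = 2 \<and> length \<xi>s = 0) \<and> \<not> (length fs = 1 \<and> length \<xi>s \<ge> 1) \<longrightarrow>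
         l (length fs + length \<xi>s) (map (\<lambda>f. (f, 0)) fs @ map (\<lambda>\<xi>. (0, \<xi>)) \<xi>s) = 0))"
proof -
  interpret hom_sum sg sh using assms by (simp add: hom_sum_def)
  interpret V: strict_V_datum "scale_gh sg sh" "L' sg sh" "nr_gh sg sh" "M' sg sh" "A' sg sh" P'
    "\<lambda>f xs. if odd (length xs) then f xs else 0" lam
    by (rule hom_sum_strict_V_datum)
  show ?thesis
  proof (intro conjI exI[of _ V.higher_br] allI ballI impI)
    show "generalised_V_datum
           (scale_gh sg sh) (L' sg sh) (nr_gh sg sh)
           (scale_gh sg sh) (M' sg sh) (nr_gh sg sh)
           (scale_gh sg sh) (A' sg sh) (nr_gh sg sh)
           (\<lambda>f. f) (\<lambda>\<xi>. \<xi>) P' 0"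
      by (rule hom_sum_V_datum)
    show "L_infinity_1_algebra (module_prod.scale (scale_gh sg sh) (scale_gh sg sh))
        (gsum (gshift (M' sg sh)) (A' sg sh)) V.higher_br"
      by (rule V.L_infinity_1_algebra_higher_br)
    show "V.higher_br 2 [(f, 0), (g, 0)] = (scale_gh sg sh ((-1) powi p) (nr_gh sg sh f g), 0)"
      if "f \<in> M' sg sh p" "g \<in> M' sg sh q" for p q f g
      by (rule V.higher_br_MM[OF that])
    show "V.higher_br i ((f, 0) # map (\<lambda>\<xi>. (0, \<xi>)) \<xi>s) =
        (0, scale_gh sg sh (lam ^ (i - 2)) (P' (foldl (nr_gh sg sh) f \<xi>s)))"
      if "2 \<le> i" "f \<in> M' sg sh p" "length \<xi>s = i - 1 \<and> set \<xi>s \<subseteq> (\<Union>q. A' sg sh q)" for i p f \<xi>s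
      using that by (intro V.higher_br_MA) auto
    show "V.higher_br (length fs + length \<xi>s) (map (\<lambda>f. (f, 0)) fs @ map (\<lambda>\<xi>. (0, \<xi>)) \<xi>s) = 0"
      if "set fs \<subseteq> (\<Union>p. M' sg sh p) \<and> set \<xi>s \<subseteq> (\<Union>q. A' sg sh q) \<and> length fs + length \<xi>s \<ge> 1 \<and>
        \<not> (length fs = 2 \<and> length \<xi>s = 0) \<and> \<not> (length fs = 1 \<and> length \<xi>s \<ge> 1)" for fs \<xi>s
      using that by (intro V.higher_br_other) auto
  qed
qed

end
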